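(* Let $p$ be a prime different from $\operatorname{char}(\Bbbk)$, $\mathbf{t}\in\mathbb{I}_X$, and let $G_1,G_2\subseteq\mathbb{G}(\mathbf{t})$ be two pointwise transitive subgroups. Then the following are equivalent: (1) $G_1$ and $G_2$ are Galois equivalent. (2) The projections of $G_1$ and $G_2$ onto the ramification components coincide, i.e. $\pi_{\operatorname{Ram}}(G_1)=\pi_{\operatorname{Ram}}(G_2)$, where $$\pi_{\operatorname{Ram}}:\mathbb{G}(\mathbf{t})=\prod_{x\in X}\mathbb{G}_x(\mathbf{t})\longrightarrow\mathbb{G}_{\operatorname{Ram}}(\mathbf{t})=\prod_{x\in\operatorname{Ram}(\mathbf{t})}\mathbb{G}_x(\mathbf{t})$$ is the canonical projection.
   Context: $\Bbbk$ is an algebraically closed field and $X$ is a projective, irreducible, non-singular curve over $\Bbbk$. "$x\in X$" means a closed point. $A_x$ is the completion of the local ring at $x$, $K_x$ its fraction field, $\upsilon_x$ the valuation on $K_x$. $\mathbb{A}_X=\{(\alpha_x)_x\in\prod_{x}K_x : \alpha_x\in A_x \text{ for all but finitely many } x\}$, $\mathbb{I}_X=\mathbb{A}_X^*$. For $\mathbf{t}=(t_x)\in\mathbb{I}_X$, put $\mathbb{A}_X\{\mathbf{t}^{1/p}\}=\mathbb{A}_X[T]/(T^p-\mathbf{t})$, $K_x\{t_x^{1/p}\}=K_x[T]/(T^p-t_x)$, $\operatorname{Ram}(\mathbf{t})=\{x:\upsilon_x(t_x)\not\equiv0\bmod p\}$, $\mathbb{G}(\mathbf{t})=\operatorname{Aut}_{\mathbb{A}_X\text{-alg}}\mathbb{A}_X\{\mathbf{t}^{1/p}\}$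 and $\mathbb{G}_x(\mathbf{t})=\operatorname{Aut}_{K_x\text{-alg}}K_x\{t_x^{1/p}\}$. Every $g\in\mathbb{G}(\mathbf{t})$ acts componentwise through $g_x\in\mathbb{G}_x(\mathbf{t})$, which identifies $\mathbb{G}(\mathbf{t})$ with $\prod_x\mathbb{G}_x(\mathbf{t})$. A cyclic subgroup $G$ of order $p$ of $\mathbb{G}(\mathbf{t})$ is pointwise transitive if $\mathbb{A}_X\{\mathbf{t}^{1/p}\}$ is a $G$-Galois extension of $\mathbb{A}_X$; equivalently, $\mathbb{A}_X\{\mathbf{t}^{1/p}\}^G=\mathbb{A}_X$; equivalently, $G$ has an element all of whose components $g_x$ have order $p$. (A commutative ring extension $S/R$ with an action of a finite group $G$ is $G$-Galois if $G$ acts faithfully by $R$-algebra automorphisms, $S^G=R$, $S$ is separable over $R$, and for $g\neq h$ in $G$ and every nonzero idempotent $e\in S$ there is $s\in S$ with $g(s)e\neq h(s)e$.) Two pointwise transitive subgroups $G_1,G_2$ of $\mathbb{G}(\mathbf{t})$ are Galois equivalent if $(\mathbb{A}_X\{\mathbf{t}^{1/p}\},G_1)$ and $(\mathbb{A}_X\{\mathbf{t}^{1/p}\},G_2)$ are conjugate, i.e. there are an $\mathbb{A}_X$-algebra automorphism $\phi$ of $\mathbb{A}_X\{\mathbf{t}^{1/p}\}$ and a group isomorphism $\tau:G_1\to G_2$ with $\phi\circ g=\tau(g)\circ\phi$ for all $g\in G_1$. *)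

theory Defs
  imports "HOL-Computational_Algebra.Computational_Algebra" "HOL-Algebra.Algebra"
begin

section \<open>Projective varieties over an algebraically closed field\<close>

text \<open>
  The homogeneous coordinates of the projective space are indexed by a finite type \<open>'n\<close>, so its
  dimension is \<open>CARD('n) - 1\<close>. Polynomials are finitely supported functions on exponent vectors.
  A point is the set of all its coordinate vectors, i.e. a line through the origin without the
  origin. Over an algebraically closed field these are the closed points of the scheme.
\<close>

type_synonym ('n, 'k) mpoly = "('n \<Rightarrow>\<^sub>0 nat) \<Rightarrow>\<^sub>0 'k"

type_synonym ('n, 'k) point = "('n \<Rightarrow> 'k) set"

definition mpoly_eval :: "('n::finite, 'k::field) mpoly \<Rightarrow> ('n \<Rightarrow> 'k) \<Rightarrow> 'k" where
  "mpoly_eval f v = (\<Sum>m\<in>Poly_Mapping.keys f. Poly_Mapping.lookup f m *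
     (\<Prod>i\<in>UNIV. v i ^ Poly_Mapping.lookup m i))"

definition homogeneous :: "nat \<Rightarrow> ('n::finite, 'k::field) mpoly \<Rightarrow> bool" where
  "homogeneous d f \<longleftrightarrow>
     (\<forall>m\<in>Poly_Mapping.keys f. (\<Sum>i\<in>UNIV. Poly_Mapping.lookup m i) = d)"

definition proj_space :: "('n, 'k::field) point set" where
  "proj_space = {{(\<lambda>i. c * v i) | c. c \<noteq> 0} | v. v \<noteq> (\<lambda>i. 0)}"

definition vanishes_at :: "('n::finite, 'k::field) mpoly \<Rightarrow> ('n, 'k) point \<Rightarrow> bool" where
  "vanishes_at f x \<longleftrightarrow> (\<forall>v\<in>x. mpoly_eval f v = 0)"

definition zariski_closed :: "('n::finite, 'k::field) point set \<Rightarrow> bool" where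
  "zariski_closed Z \<longleftrightarrow> (\<exists>F. (\<forall>f\<in>F. \<exists>d. homogeneous d f) \<and>
     Z = {x \<in> proj_space. \<forall>f\<in>F. vanishes_at f x})"

definition irreducible_closed :: "('n::finite, 'k::field) point set \<Rightarrow> bool" where
  "irreducible_closed Z \<longleftrightarrow> zariski_closed Z \<and> Z \<noteq> {} \<and>
     (\<forall>Z1 Z2. zariski_closed Z1 \<and> zariski_closed Z2 \<and> Z = Z1 \<union> Z2 \<longrightarrow> Z = Z1 \<or> Z = Z2)"

definition irreducible_chain ::
    "('n::finite, 'k::field) point set \<Rightarrow> nat \<Rightarrow> (nat \<Rightarrow> ('n, 'k) point set) \<Rightarrow> bool" where
  "irreducible_chain C n Z \<longleftrightarrow>
     (\<forall>i\<le>n. irreducible_closed (Z i) \<and> Z i \<subseteq> C) \<and> (\<forall>i<n. Z i \<subset> Z (Suc i))"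

definition has_dim :: "('n::finite, 'k::field) point set \<Rightarrow> nat \<Rightarrow> bool" where
  "has_dim C n \<longleftrightarrow> (\<exists>Z. irreducible_chain C n Z) \<and> (\<nexists>Z. irreducible_chain C (Suc n) Z)"


section \<open>Local rings\<close>

text \<open>
  The local ring at \<open>x\<close> of an irreducible \<open>C\<close> consists of the fractions \<open>f/g\<close> of homogeneous
  polynomials of the same degree with \<open>g(x) \<noteq> 0\<close>, where \<open>f/g = f'/g'\<close> iff \<open>f g' - f' g\<close> lies in the
  (prime) homogeneous ideal of \<open>C\<close>.
\<close>

definition local_fractions ::
    "('n::finite, 'k::field) point \<Rightarrow> (('n, 'k) mpoly \<times> ('n, 'k) mpoly) set" where
  "local_fractions x =
     {(f, g). (\<exists>d. homogeneous d f \<and> homogeneous d g) \<and> \<not> vanishes_at g x}"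

definition local_rel :: "('n::finite, 'k::field) point set \<Rightarrow> ('n, 'k) point \<Rightarrow>
    (('n, 'k) mpoly \<times> ('n, 'k) mpoly) rel" where
  "local_rel C x = {((f, g), (f', g')). (f, g) \<in> local_fractions x \<and> (f', g') \<in> local_fractions x \<and>
     (\<forall>y\<in>C. vanishes_at (f * g' - f' * g) y)}"

definition local_ring :: "('n::finite, 'k::field) point set \<Rightarrow> ('n, 'k) point \<Rightarrow>
    (('n, 'k) mpoly \<times> ('n, 'k) mpoly) set ring" where
  "local_ring C x =
     \<lparr>carrier = local_fractions x // local_rel C x,
      monoid.mult = (\<lambda>a b. \<Union>(f, g)\<in>a. \<Union>(f', g')\<in>b. local_rel C x `` {(f * f', g * g')}),
      one = local_rel C x `` {(1, 1)},
      ring.zero = local_rel C x `` {(0, 1)},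
      ring.add = (\<lambda>a b. \<Union>(f, g)\<in>a. \<Union>(f', g')\<in>b. local_rel C x `` {(f * g' + f' * g, g * g')})\<rparr>"

definition local_constants :: "('n::finite, 'k::field) point set \<Rightarrow> ('n, 'k) point \<Rightarrow>
    (('n, 'k) mpoly \<times> ('n, 'k) mpoly) set set" where
  "local_constants C x = {local_rel C x `` {(Poly_Mapping.single 0 c, 1)} | c. True}"

text \<open>The maximal ideal, if the ring is local.\<close>

definition nonunits :: "('a, 'm) ring_scheme \<Rightarrow> 'a set" where
  "nonunits R = carrier R - Units R"

primrec ideal_pow :: "('a, 'm) ring_scheme \<Rightarrow> 'a set \<Rightarrow> nat \<Rightarrow> 'a set" where
  "ideal_pow R I 0 = carrier R"
| "ideal_pow R I (Suc n) = ideal_prod R (ideal_pow R I n) I"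

text \<open>
  The cotangent space \<open>\<mm>/\<mm>\<^sup>2\<close> is the image of \<open>\<mm>\<close> in the ring \<open>\<O>/\<mm>\<^sup>2\<close>, and its scalars are the
  image of the ground field in that ring.
\<close>

definition cotangent_dim ::
    "('n::finite, 'k::field) point set \<Rightarrow> ('n, 'k) point \<Rightarrow> nat \<Rightarrow> bool" where
  "cotangent_dim C x d \<longleftrightarrow>
     (let R = local_ring C x; M = nonunits R; M2 = ideal_pow R M 2
      in ring.dimension (R Quot M2) d
           ((\<lambda>c. M2 +>\<^bsub>R\<^esub> c) ` local_constants C x)
           ((\<lambda>a. M2 +>\<^bsub>R\<^esub> a) ` M))"

definition nonsingular_at :: "('n::finite, 'k::field) point set \<Rightarrow> ('n, 'k) point \<Rightarrow> bool" where
  "nonsingular_at C x \<longleftrightarrow> (\<exists>d. has_dim C d \<and> cotangent_dim C x d)"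

definition nonsingular_projective_curve ::
    "('n::finite, 'k::alg_closed_field) point set \<Rightarrow> bool" where
  "nonsingular_projective_curve C \<longleftrightarrow>
     irreducible_closed C \<and> has_dim C 1 \<and> (\<forall>x\<in>C. nonsingular_at C x)"


section \<open>Completions, fraction fields, valuations\<close>

text \<open>
  The completion is the inverse limit of the rings \<open>R/I\<^sup>n\<close>; the coset \<open>s (Suc n)\<close> is mapped to
  \<open>s n\<close> by the transition map iff it is contained in it.
\<close>

definition completion :: "('a, 'm) ring_scheme \<Rightarrow> 'a set \<Rightarrow> (nat \<Rightarrow> 'a set) ring" where
  "completion R I =
     \<lparr>carrier = {s. \<forall>n. s n \<in> carrier (R Quot ideal_pow R I n) \<and> s (Suc n) \<subseteq> s n},
      monoid.mult = (\<lambda>s u n. s n \<otimes>\<^bsub>R Quot ideal_pow R I n\<^esub> u n),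
      one = (\<lambda>n. \<one>\<^bsub>R Quot ideal_pow R I n\<^esub>),
      ring.zero = (\<lambda>n. \<zero>\<^bsub>R Quot ideal_pow R I n\<^esub>),
      ring.add = (\<lambda>s u n. s n \<oplus>\<^bsub>R Quot ideal_pow R I n\<^esub> u n)\<rparr>"

definition frac_rel :: "('a, 'm) ring_scheme \<Rightarrow> ('a \<times> 'a) rel" where
  "frac_rel R = {((a, b), (c, d)). a \<in> carrier R \<and> b \<in> carrier R - {\<zero>\<^bsub>R\<^esub>} \<and>
     c \<in> carrier R \<and> d \<in> carrier R - {\<zero>\<^bsub>R\<^esub>} \<and> a \<otimes>\<^bsub>R\<^esub> d = c \<otimes>\<^bsub>R\<^esub> b}"

definition frac :: "('a, 'm) ring_scheme \<Rightarrow> 'a \<Rightarrow> 'a \<Rightarrow> ('a \<times> 'a) set" where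
  "frac R a b = frac_rel R `` {(a, b)}"

definition frac_field :: "('a, 'm) ring_scheme \<Rightarrow> ('a \<times> 'a) set ring" where
  "frac_field R =
     \<lparr>carrier = (carrier R \<times> (carrier R - {\<zero>\<^bsub>R\<^esub>})) // frac_rel R,
      monoid.mult = (\<lambda>u v. \<Union>(a, b)\<in>u. \<Union>(c, d)\<in>v. frac R (a \<otimes>\<^bsub>R\<^esub> c) (b \<otimes>\<^bsub>R\<^esub> d)),
      one = frac R \<one>\<^bsub>R\<^esub> \<one>\<^bsub>R\<^esub>,
      ring.zero = frac R \<zero>\<^bsub>R\<^esub> \<one>\<^bsub>R\<^esub>,
      ring.add = (\<lambda>u v. \<Union>(a, b)\<in>u. \<Union>(c, d)\<in>v.
               frac R (a \<otimes>\<^bsub>R\<^esub> d \<oplus>\<^bsub>R\<^esub> c \<otimes>\<^bsub>R\<^esub> b) (b \<otimes>\<^bsub>R\<^esub> d))\<rparr>"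

text \<open>
  The normalised valuation of a discrete valuation ring and its extension to the fraction field.
  Both are meaningful for nonzero arguments only; the value at zero would be infinite.
\<close>

definition dvr_val :: "('a, 'm) ring_scheme \<Rightarrow> 'a \<Rightarrow> nat" where
  "dvr_val R a =
     (THE n. a \<in> ideal_pow R (nonunits R) n \<and> a \<notin> ideal_pow R (nonunits R) (Suc n))"

definition frac_val :: "('a, 'm) ring_scheme \<Rightarrow> ('a \<times> 'a) set \<Rightarrow> int" where
  "frac_val R z = (THE k. \<exists>(a, b)\<in>z. k = int (dvr_val R a) - int (dvr_val R b))"


section \<open>Kummer algebras and their automorphisms\<close>

text \<open>The algebra \<open>R[T]/(T\<^sup>p - t)\<close>.\<close>

definition kummer_ideal :: "('a, 'm) ring_scheme \<Rightarrow> nat \<Rightarrow> 'a \<Rightarrow> (nat \<Rightarrow> 'a) set" where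
  "kummer_ideal R p t = cgenideal (UP R)
     (up_ring.monom (UP R) \<one>\<^bsub>R\<^esub> p \<ominus>\<^bsub>UP R\<^esub> up_ring.monom (UP R) t 0)"

definition kummer_algebra :: "('a, 'm) ring_scheme \<Rightarrow> nat \<Rightarrow> 'a \<Rightarrow> (nat \<Rightarrow> 'a) set ring" where
  "kummer_algebra R p t = UP R Quot kummer_ideal R p t"

definition kummer_embed :: "('a, 'm) ring_scheme \<Rightarrow> nat \<Rightarrow> 'a \<Rightarrow> 'a \<Rightarrow> (nat \<Rightarrow> 'a) set" where
  "kummer_embed R p t a = kummer_ideal R p t +>\<^bsub>UP R\<^esub> up_ring.monom (UP R) a 0"

text \<open>
  In the following, \<open>S\<close> is a commutative algebra over \<open>R\<close> with structure map \<open>\<iota>\<close>.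
\<close>

definition alg_aut_group ::
    "('r, 'm) ring_scheme \<Rightarrow> ('s, 'n) ring_scheme \<Rightarrow> ('r \<Rightarrow> 's) \<Rightarrow> ('s \<Rightarrow> 's) monoid" where
  "alg_aut_group R S \<iota> = BijGroup (carrier S)
     \<lparr>carrier := {f \<in> Bij (carrier S). f \<in> ring_hom S S \<and> (\<forall>a\<in>carrier R. f (\<iota> a) = \<iota> a)}\<rparr>"

definition kummer_aut_group :: "('a, 'm) ring_scheme \<Rightarrow> nat \<Rightarrow> 'a \<Rightarrow>
    ((nat \<Rightarrow> 'a) set \<Rightarrow> (nat \<Rightarrow> 'a) set) monoid" where
  "kummer_aut_group R p t = alg_aut_group R (kummer_algebra R p t) (kummer_embed R p t)"


section \<open>Galois extensions of commutative rings\<close>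

text \<open>
  The tensor product \<open>S \<otimes>\<^sub>R S\<close> is the free abelian group on \<open>S \<times> S\<close> modulo the subgroup
  generated by the usual relations.
\<close>

definition tensor_relations ::
    "('r, 'm) ring_scheme \<Rightarrow> ('s, 'n) ring_scheme \<Rightarrow> ('r \<Rightarrow> 's) \<Rightarrow> ('s \<times> 's \<Rightarrow>\<^sub>0 int) set" where
  "tensor_relations R S \<iota> = generate (free_Abelian_group (carrier S \<times> carrier S))
     ({frag_of (a \<oplus>\<^bsub>S\<^esub> a', b) - frag_of (a, b) - frag_of (a', b) | a a' b.
         a \<in> carrier S \<and> a' \<in> carrier S \<and> b \<in> carrier S} \<union>
      {frag_of (a, b \<oplus>\<^bsub>S\<^esub> b') - frag_of (a, b) - frag_of (a, b') | a b b'.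
         a \<in> carrier S \<and> b \<in> carrier S \<and> b' \<in> carrier S} \<union>
      {frag_of (\<iota> r \<otimes>\<^bsub>S\<^esub> a, b) - frag_of (a, \<iota> r \<otimes>\<^bsub>S\<^esub> b) | r a b.
         r \<in> carrier R \<and> a \<in> carrier S \<and> b \<in> carrier S})"

text \<open>
  \<open>S\<close> is separable over \<open>R\<close>, i.e. projective as a module over \<open>S \<otimes>\<^sub>R S\<close>, iff the multiplication map
  \<open>S \<otimes>\<^sub>R S \<rightarrow> S\<close> has a section \<open>\<sigma>\<close> that is \<open>S \<otimes>\<^sub>R S\<close>-linear, i.e. \<open>S\<close>-linear on both sides. The
  values of \<open>\<sigma>\<close> below are representatives in the free abelian group of elements of
  \<open>S \<otimes>\<^sub>R S\<close>, and congruence modulo the relations is equality in \<open>S \<otimes>\<^sub>R S\<close>.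
\<close>

definition separable_extension ::
    "('r, 'm) ring_scheme \<Rightarrow> ('s, 'n) ring_scheme \<Rightarrow> ('r \<Rightarrow> 's) \<Rightarrow> bool" where
  "separable_extension R S \<iota> \<longleftrightarrow>
     (\<exists>\<sigma> \<in> carrier S \<rightarrow> carrier (free_Abelian_group (carrier S \<times> carrier S)).
        (\<forall>s\<in>carrier S. \<forall>u\<in>carrier S.
           \<sigma> (s \<oplus>\<^bsub>S\<^esub> u) - (\<sigma> s + \<sigma> u) \<in> tensor_relations R S \<iota> \<and>
           \<sigma> (s \<otimes>\<^bsub>S\<^esub> u) - frag_extend (\<lambda>(a, b). frag_of (s \<otimes>\<^bsub>S\<^esub> a, b)) (\<sigma> u)
             \<in> tensor_relations R S \<iota> \<and>
           \<sigma> (u \<otimes>\<^bsub>S\<^esub> s) - frag_extend (\<lambda>(a, b). frag_of (a, b \<otimes>\<^bsub>S\<^esub> s)) (\<sigma> u)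
             \<in> tensor_relations R S \<iota>) \<and>
        (\<forall>s\<in>carrier S.
           (\<Oplus>\<^bsub>S\<^esub>z\<in>Poly_Mapping.keys (\<sigma> s).
              [Poly_Mapping.lookup (\<sigma> s) z] \<cdot>\<^bsub>S\<^esub> (fst z \<otimes>\<^bsub>S\<^esub> snd z)) = s))"

text \<open>The action of \<open>G\<close> is faithful since its elements are themselves automorphisms.\<close>

definition galois_extension :: "('r, 'm) ring_scheme \<Rightarrow> ('s, 'n) ring_scheme \<Rightarrow> ('r \<Rightarrow> 's) \<Rightarrow>
    ('s \<Rightarrow> 's) set \<Rightarrow> bool" where
  "galois_extension R S \<iota> G \<longleftrightarrow>
     cring R \<and> cring S \<and> \<iota> \<in> ring_hom R S \<and> inj_on \<iota> (carrier R) \<and>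
     subgroup G (alg_aut_group R S \<iota>) \<and> finite G \<and>
     {s \<in> carrier S. \<forall>g\<in>G. g s = s} = \<iota> ` carrier R \<and>
     separable_extension R S \<iota> \<and>
     (\<forall>g\<in>G. \<forall>h\<in>G. g \<noteq> h \<longrightarrow>
        (\<forall>e\<in>carrier S. e \<otimes>\<^bsub>S\<^esub> e = e \<and> e \<noteq> \<zero>\<^bsub>S\<^esub> \<longrightarrow>
           (\<exists>s\<in>carrier S. g s \<otimes>\<^bsub>S\<^esub> e \<noteq> h s \<otimes>\<^bsub>S\<^esub> e)))"

definition galois_conjugate :: "('r, 'm) ring_scheme \<Rightarrow> ('s, 'n) ring_scheme \<Rightarrow> ('r \<Rightarrow> 's) \<Rightarrow>
    ('s \<Rightarrow> 's) set \<Rightarrow> ('s \<Rightarrow> 's) set \<Rightarrow> bool" where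
  "galois_conjugate R S \<iota> G1 G2 \<longleftrightarrow>
     (let A = alg_aut_group R S \<iota>
      in \<exists>\<phi>\<in>carrier A. \<exists>\<tau>\<in>iso (A\<lparr>carrier := G1\<rparr>) (A\<lparr>carrier := G2\<rparr>).
           \<forall>g\<in>G1. \<phi> \<otimes>\<^bsub>A\<^esub> g = \<tau> g \<otimes>\<^bsub>A\<^esub> \<phi>)"


section \<open>Adeles of a curve\<close>

type_synonym ('n, 'k) complete_elem = "nat \<Rightarrow> (('n, 'k) mpoly \<times> ('n, 'k) mpoly) set set"

type_synonym ('n, 'k) local_elem = "(('n, 'k) complete_elem \<times> ('n, 'k) complete_elem) set"

type_synonym ('n, 'k) adele = "('n, 'k) point \<Rightarrow> ('n, 'k) local_elem"

type_synonym ('n, 'k) adele_kummer_elem = "(nat \<Rightarrow> ('n, 'k) adele) set"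

type_synonym ('n, 'k) local_kummer_elem = "(nat \<Rightarrow> ('n, 'k) local_elem) set"

definition complete_local_ring :: "('n::finite, 'k::field) point set \<Rightarrow> ('n, 'k) point \<Rightarrow>
    ('n, 'k) complete_elem ring" where
  "complete_local_ring C x = completion (local_ring C x) (nonunits (local_ring C x))"

definition local_field :: "('n::finite, 'k::field) point set \<Rightarrow> ('n, 'k) point \<Rightarrow>
    ('n, 'k) local_elem ring" where
  "local_field C x = frac_field (complete_local_ring C x)"

definition local_integers :: "('n::finite, 'k::field) point set \<Rightarrow> ('n, 'k) point \<Rightarrow>
    ('n, 'k) local_elem set" where
  "local_integers C x = (\<lambda>a. frac (complete_local_ring C x) a \<one>\<^bsub>complete_local_ring C x\<^esub>) `
     carrier (complete_local_ring C x)"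

definition adele_ring :: "('n::finite, 'k::field) point set \<Rightarrow> ('n, 'k) adele ring" where
  "adele_ring C =
     \<lparr>carrier = {\<alpha> \<in> (\<Pi>\<^sub>E x\<in>C. carrier (local_field C x)).
                    finite {x \<in> C. \<alpha> x \<notin> local_integers C x}},
      monoid.mult = (\<lambda>\<alpha> \<beta>. \<lambda>x\<in>C. \<alpha> x \<otimes>\<^bsub>local_field C x\<^esub> \<beta> x),
      one = (\<lambda>x\<in>C. \<one>\<^bsub>local_field C x\<^esub>),
      ring.zero = (\<lambda>x\<in>C. \<zero>\<^bsub>local_field C x\<^esub>),
      ring.add = (\<lambda>\<alpha> \<beta>. \<lambda>x\<in>C. \<alpha> x \<oplus>\<^bsub>local_field C x\<^esub> \<beta> x)\<rparr>"

definition ideles :: "('n::finite, 'k::field) point set \<Rightarrow> ('n, 'k) adele set" where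
  "ideles C = Units (adele_ring C)"

definition Ram :: "('n::finite, 'k::field) point set \<Rightarrow> nat \<Rightarrow> ('n, 'k) adele \<Rightarrow>
    ('n, 'k) point set" where
  "Ram C p t = {x \<in> C. \<not> int p dvd frac_val (complete_local_ring C x) (t x)}"

definition adele_aut_group :: "('n::finite, 'k::field) point set \<Rightarrow> nat \<Rightarrow> ('n, 'k) adele \<Rightarrow>
    (('n, 'k) adele_kummer_elem \<Rightarrow> ('n, 'k) adele_kummer_elem) monoid" where
  "adele_aut_group C p t = kummer_aut_group (adele_ring C) p t"

definition local_aut_group :: "('n::finite, 'k::field) point set \<Rightarrow> nat \<Rightarrow> ('n, 'k) adele \<Rightarrow>
    ('n, 'k) point \<Rightarrow> (('n, 'k) local_kummer_elem \<Rightarrow> ('n, 'k) local_kummer_elem) monoid" where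
  "local_aut_group C p t x = kummer_aut_group (local_field C x) p (t x)"

text \<open>
  The ring homomorphism from the adelic to the local Kummer algebra at \<open>x\<close> that is induced by
  \<open>\<alpha> \<mapsto> \<alpha> x\<close> on coefficients and by \<open>T \<mapsto> T\<close>.
\<close>

definition local_proj :: "('n::finite, 'k::field) point set \<Rightarrow> nat \<Rightarrow> ('n, 'k) adele \<Rightarrow>
    ('n, 'k) point \<Rightarrow> ('n, 'k) adele_kummer_elem \<Rightarrow> ('n, 'k) local_kummer_elem" where
  "local_proj C p t x U = the_elem
     ((\<lambda>f. kummer_ideal (local_field C x) p (t x) +>\<^bsub>UP (local_field C x)\<^esub> (\<lambda>i. f i x)) ` U)"

definition aut_component :: "('n::finite, 'k::field) point set \<Rightarrow> nat \<Rightarrow> ('n, 'k) adele \<Rightarrow>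
    ('n, 'k) point \<Rightarrow> (('n, 'k) adele_kummer_elem \<Rightarrow> ('n, 'k) adele_kummer_elem) \<Rightarrow>
    (('n, 'k) local_kummer_elem \<Rightarrow> ('n, 'k) local_kummer_elem)" where
  "aut_component C p t x g = (THE h. h \<in> carrier (local_aut_group C p t x) \<and>
     (\<forall>s\<in>carrier (kummer_algebra (adele_ring C) p t).
        local_proj C p t x (g s) = h (local_proj C p t x s)))"

definition proj_Ram :: "('n::finite, 'k::field) point set \<Rightarrow> nat \<Rightarrow> ('n, 'k) adele \<Rightarrow>
    (('n, 'k) adele_kummer_elem \<Rightarrow> ('n, 'k) adele_kummer_elem) \<Rightarrow>
    (('n, 'k) point \<Rightarrow> ('n, 'k) local_kummer_elem \<Rightarrow> ('n, 'k) local_kummer_elem)" where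
  "proj_Ram C p t g = (\<lambda>x\<in>Ram C p t. aut_component C p t x g)"

definition pointwise_transitive :: "('n::finite, 'k::field) point set \<Rightarrow> nat \<Rightarrow>
    ('n, 'k) adele \<Rightarrow> (('n, 'k) adele_kummer_elem \<Rightarrow> ('n, 'k) adele_kummer_elem) set \<Rightarrow> bool" where
  "pointwise_transitive C p t G \<longleftrightarrow>
     subgroup G (adele_aut_group C p t) \<and>
     cyclic_group ((adele_aut_group C p t)\<lparr>carrier := G\<rparr>) \<and> card G = p \<and>
     galois_extension (adele_ring C) (kummer_algebra (adele_ring C) p t)
       (kummer_embed (adele_ring C) p t) G"

definition galois_equivalent :: "('n::finite, 'k::field) point set \<Rightarrow> nat \<Rightarrow> ('n, 'k) adele \<Rightarrow>
    (('n, 'k) adele_kummer_elem \<Rightarrow> ('n, 'k) adele_kummer_elem) set \<Rightarrow>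
    (('n, 'k) adele_kummer_elem \<Rightarrow> ('n, 'k) adele_kummer_elem) set \<Rightarrow> bool" where
  "galois_equivalent C p t G1 G2 \<longleftrightarrow>
     galois_conjugate (adele_ring C) (kummer_algebra (adele_ring C) p t)
       (kummer_embed (adele_ring C) p t) G1 G2"

end

(*
  Over an unramified point x, Hensel's lemma and p \<noteq> char split T^p - t_x into p distinct linear
  factors, so K_x{t_x^(1/p)} is K_x^p, its automorphisms are the permutations of the roots, and
  generators of pointwise transitive groups are p-cycles there; any two p-cycles are conjugate.
  Lagrange interpolation at the roots only involves their powers, their inverses and 1/p, hence is
  integral at almost all points, and the local conjugating permutations glue to an adelic
  automorphism. At a ramified point the valuation shows that K_x{t_x^(1/p)} is a domain; an
  automorphism multiplies T by a p-th root of unity, the local group is commutative, and conjugation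
  does not move its elements. For the local input, Nakayama's lemma turns dim m/m^2 = 1 into a
  uniformizer, and completeness provides p-th roots of units whose residue is a p-th power.
*)
theory Submission
  imports Defs
begin

section \<open>Kummer extensions of a field\<close>

text \<open>Let \<open>e_x\<close> be the adele that is 1 at x and 0 elsewhere. If a generator of a
  pointwise transitive group acted trivially at x, then \<open>e_x T\<close> would be fixed by the
  whole group and would be a constant, against the independence of 1 and T; this is how the fixed
  ring condition yields a nontrivial action at every point. The same idempotents show that an adelic
  automorphism has local components. Identities in the adelic algebra are checked through its images
  at the ramified points and its values at all roots at the other points. Automorphisms act on roots
  by pullback, which reverses composition. To match two groups one needs a generator of each with
  equal ramified components. As p is prime, every nonidentity element generates, and equality of the
  projections supplies the partner; the nontrivial action at a ramified point keeps it from being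
  the identity. The local ring is known only through its cotangent space: affine coordinates centred
  at x provide the finite generation for Nakayama, and the factorization of every nonzero element
  into a unit and a power of the uniformizer appears in the completion.\<close>

definition kummer_gen :: "('a, 'm) ring_scheme \<Rightarrow> nat \<Rightarrow> 'a \<Rightarrow> (nat \<Rightarrow> 'a) set" where
  "kummer_gen R p t = kummer_ideal R p t +>\<^bsub>UP R\<^esub> up_ring.monom (UP R) \<one>\<^bsub>R\<^esub> 1"

text \<open>The base is an arbitrary commutative ring because the same facts are applied to the
  adele ring, which may have zero divisors, and to every local field.\<close>

locale kummer = UP_cring R P for R (structure) and P (structure) +
  fixes p :: nat and t
  assumes p_pos: "0 < p" and t_closed [simp]: "t \<in> carrier R"
begin

abbreviation "I \<equiv> kummer_ideal R p t"
abbreviation "S \<equiv> kummer_algebra R p t"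
abbreviation "emb \<equiv> kummer_embed R p t"
abbreviation "T \<equiv> kummer_gen R p t"
abbreviation "g \<equiv> up_ring.monom P \<one> p \<ominus>\<^bsub>P\<^esub> up_ring.monom P t 0"

lemma g_closed [simp]: "g \<in> carrier P"
  by simp

lemma I_eq: "I = PIdl\<^bsub>P\<^esub> g"
  by (simp add: kummer_ideal_def P_def)

lemma I_ideal: "ideal I P"
  unfolding I_eq by (rule P.cgenideal_ideal) simp

sublocale I: ideal I P by (rule I_ideal)

lemma S_eq: "S = P Quot I"
  by (simp add: kummer_algebra_def P_def)

lemma S_cring: "cring S"
  unfolding S_eq by (rule I.quotient_is_cring) (rule P.is_cring)

sublocale S: cring S by (rule S_cring)

sublocale quot: ring_hom_cring P S "(+>\<^bsub>P\<^esub>) I"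
  unfolding S_eq by (rule I.rcos_ring_hom_cring) (rule P.is_cring)

lemma emb_eq: "emb a = I +>\<^bsub>P\<^esub> up_ring.monom P a 0"
  by (simp add: kummer_embed_def P_def)

lemma T_eq: "T = I +>\<^bsub>P\<^esub> up_ring.monom P \<one> 1"
  by (simp add: kummer_gen_def P_def)

lemma emb_hom: "emb \<in> ring_hom R S"
  unfolding emb_eq[abs_def]
  using ring_hom_trans[OF const_ring_hom quot.homh] by (simp add: comp_def)

sublocale emb: ring_hom_cring R S emb
  by unfold_locales (rule emb_hom)

lemma T_closed [simp]: "T \<in> carrier S"
  unfolding T_eq by simp

lemma quot_monom:
  assumes "a \<in> carrier R"
  shows "I +>\<^bsub>P\<^esub> up_ring.monom P a n = emb a \<otimes>\<^bsub>S\<^esub> T [^]\<^bsub>S\<^esub> n"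
proof -
  have "up_ring.monom P a n = up_ring.monom P a 0 \<otimes>\<^bsub>P\<^esub> up_ring.monom P \<one> 1 [^]\<^bsub>P\<^esub> n"
    using assms by (simp del: monom_mult add: monom_mult [THEN sym] monom_pow)
  then show ?thesis
    using assms by (simp add: emb_eq T_eq)
qed

lemma quot_eq_iff:
  assumes "f \<in> carrier P" "h \<in> carrier P"
  shows "I +>\<^bsub>P\<^esub> f = I +>\<^bsub>P\<^esub> h \<longleftrightarrow> f \<ominus>\<^bsub>P\<^esub> h \<in> I"
  using P.quotient_eq_iff_same_a_r_cos[OF I_ideal] assms by blast

lemma T_pow: "T [^]\<^bsub>S\<^esub> p = emb t"
proof -
  have "g \<in> I" unfolding I_eq by (rule P.cgenideal_self) simp
  then have "I +>\<^bsub>P\<^esub> up_ring.monom P \<one> p = I +>\<^bsub>P\<^esub> up_ring.monom P t 0"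
    by (subst quot_eq_iff) auto
  then show ?thesis using quot_monom[of \<one> p] by (simp add: emb_eq[symmetric])
qed

lemma quot_expand:
  assumes "f \<in> carrier P" "deg R f \<le> n"
  shows "I +>\<^bsub>P\<^esub> f = (\<Oplus>\<^bsub>S\<^esub>i\<in>{..n}. emb (up_ring.coeff P f i) \<otimes>\<^bsub>S\<^esub> T [^]\<^bsub>S\<^esub> i)"
proof -
  have "I +>\<^bsub>P\<^esub> f = I +>\<^bsub>P\<^esub> (\<Oplus>\<^bsub>P\<^esub> i \<in> {..n}. up_ring.monom P (up_ring.coeff P f i) i)"
    using up_repr_le[OF assms(2,1)] by simp
  also have "\<dots> = (\<Oplus>\<^bsub>S\<^esub>i\<in>{..n}. I +>\<^bsub>P\<^esub> up_ring.monom P (up_ring.coeff P f i) i)"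
    using assms by (subst quot.hom_finsum) (auto simp: comp_def)
  also have "\<dots> = (\<Oplus>\<^bsub>S\<^esub>i\<in>{..n}. emb (up_ring.coeff P f i) \<otimes>\<^bsub>S\<^esub> T [^]\<^bsub>S\<^esub> i)"
    using assms by (intro S.finsum_cong') (auto simp: quot_monom)
  finally show ?thesis .
qed

lemma carrier_S: "carrier S = (+>\<^bsub>P\<^esub>) I ` carrier P"
  unfolding S_eq by (auto simp: FactRing_def A_RCOSETS_def')

lemma deg_g:
  assumes "\<one> \<noteq> \<zero>" shows "deg R g = p" "up_ring.coeff P g p = \<one>"
proof -
  show 1: "up_ring.coeff P g p = \<one>" using p_pos by (simp add: a_minus_def)
  show "deg R g = p"
    using 1 p_pos assms
    by (intro antisym deg_aboveI deg_belowI) (auto simp: a_minus_def)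
qed

text \<open>Normal form of an element of \<open>S\<close>: the residue class of a polynomial of
  degree below \<open>p\<close>. Values of the sequence from index \<open>p\<close> on are
  ignored.\<close>

definition comb :: "(nat \<Rightarrow> 'a) \<Rightarrow> (nat \<Rightarrow> 'a) set" where
  "comb a = (\<Oplus>\<^bsub>S\<^esub>i\<in>{..<p}. emb (a i) \<otimes>\<^bsub>S\<^esub> T [^]\<^bsub>S\<^esub> i)"

lemma comb_closed [simp]: "a \<in> {..<p} \<rightarrow> carrier R \<Longrightarrow> comb a \<in> carrier S"
  unfolding comb_def by (intro S.finsum_closed) (auto simp: Pi_iff)

text \<open>Division by the monic polynomial \<open>g\<close> leaves a remainder of degree below
  \<open>p\<close>.\<close>

lemma span:
  assumes "s \<in> carrier S"
  obtains a where "a \<in> UNIV \<rightarrow> carrier R" "s = comb a"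
proof -
  obtain f where f: "f \<in> carrier P" "s = I +>\<^bsub>P\<^esub> f" using assms unfolding carrier_S by auto
  have "\<exists>r\<in>carrier P. s = I +>\<^bsub>P\<^esub> r \<and> (\<forall>n\<ge>p. up_ring.coeff P r n = \<zero>)"
  proof (cases "\<one> = \<zero>")
    case True
    then have "carrier R = {\<zero>}" using R.one_zeroD by simp
    then show ?thesis using f coeff_closed[OF f(1)] by auto
  next
    case False
    have gnz: "g \<noteq> \<zero>\<^bsub>P\<^esub>" using deg_g[OF False] False coeff_zero by metis
    obtain q r k where qr: "q \<in> carrier P" "r \<in> carrier P"
       "up_ring.coeff P g (deg R g) [^] (k::nat) \<odot>\<^bsub>P\<^esub> f = g \<otimes>\<^bsub>P\<^esub> q \<oplus>\<^bsub>P\<^esub> r"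
       "r = \<zero>\<^bsub>P\<^esub> \<or> deg R r < deg R g"
      using long_div_theorem[OF g_closed f(1) gnz] by blast
    have fe: "f = g \<otimes>\<^bsub>P\<^esub> q \<oplus>\<^bsub>P\<^esub> r"
      using qr(3) f(1) by (simp only: deg_g[OF False] R.nat_pow_one smult_one)
    have "f \<ominus>\<^bsub>P\<^esub> r = q \<otimes>\<^bsub>P\<^esub> g" unfolding fe using qr(1,2) g_closed by algebra
    then have "f \<ominus>\<^bsub>P\<^esub> r \<in> I" unfolding I_eq cgenideal_def using qr(1) by auto
    then have "s = I +>\<^bsub>P\<^esub> r" using f qr quot_eq_iff by blast
    moreover have "up_ring.coeff P r n = \<zero>" if "n \<ge> p" for n
      using qr(4) that deg_g[OF False] qr(2) deg_aboveD[of r n] by auto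
    ultimately show ?thesis using qr(2) by blast
  qed
  then obtain r where r: "r \<in> carrier P" "s = I +>\<^bsub>P\<^esub> r" "\<And>n. n \<ge> p \<Longrightarrow> up_ring.coeff P r n = \<zero>" by blast
  have "deg R r \<le> p - 1" using r p_pos by (intro deg_aboveI) auto
  then have "s = comb (up_ring.coeff P r)"
    unfolding r(2) comb_def
    using p_pos by (subst quot_expand[OF r(1)]) (auto simp: lessThan_Suc_atMost[symmetric])
  then show ?thesis using r(1) by (intro that[of "up_ring.coeff P r"]) (auto simp: Pi_iff)
qed

lemma comb_eq_quot:
  assumes "a \<in> {..<p} \<rightarrow> carrier R"
  shows "comb a = I +>\<^bsub>P\<^esub> (\<Oplus>\<^bsub>P\<^esub>i\<in>{..<p}. up_ring.monom P (a i) i)"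
proof -
  have "I +>\<^bsub>P\<^esub> (\<Oplus>\<^bsub>P\<^esub>i\<in>{..<p}. up_ring.monom P (a i) i) =
      (\<Oplus>\<^bsub>S\<^esub>i\<in>{..<p}. I +>\<^bsub>P\<^esub> up_ring.monom P (a i) i)"
    using assms by (subst quot.hom_finsum) (auto simp: comp_def Pi_iff)
  also have "\<dots> = comb a" unfolding comb_def
    using assms by (intro S.finsum_cong') (auto simp: quot_monom Pi_iff)
  finally show ?thesis by simp
qed

text \<open>A multiple \<open>q g\<close> of degree below \<open>p\<close> vanishes: since
  \<open>g\<close> is monic, its coefficient in degree \<open>deg q + p\<close> is the leading
  coefficient of \<open>q\<close>. This argument tolerates zero divisors in
  \<open>R\<close>.\<close>

lemma indep:
  assumes a: "a \<in> {..<p} \<rightarrow> carrier R" and z: "comb a = \<zero>\<^bsub>S\<^esub>" and i: "i < p"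
  shows "a i = \<zero>"
proof -
  define f where "f = (\<Oplus>\<^bsub>P\<^esub>i\<in>{..<p}. up_ring.monom P (a i) i)"
  have fc: "f \<in> carrier P" unfolding f_def using a by (intro P.finsum_closed) (auto simp: Pi_iff)
  have cf: "up_ring.coeff P f n = (if n < p then a n else \<zero>)" for n
  proof -
    have "up_ring.coeff P f n = (\<Oplus>i\<in>{..<p}. if i = n then a i else \<zero>)"
      unfolding f_def using a
      by (subst coeff_finsum) (auto simp: Pi_iff intro!: R.finsum_cong')
    also have "\<dots> = (if n < p then a n else \<zero>)"
    proof (cases "n < p")
      case True
      then show ?thesis using R.finsum_singleton[of n "{..<p}" a] a by (auto cong: if_cong simp: eq_commute)
    next
      case False
      then have "(\<Oplus>i\<in>{..<p}. if i = n then a i else \<zero>) = (\<Oplus>i\<in>{..<p}. \<zero>)"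
        by (intro R.finsum_cong') auto
      then show ?thesis using False by simp
    qed
    finally show ?thesis .
  qed
  have "I +>\<^bsub>P\<^esub> f = I +>\<^bsub>P\<^esub> \<zero>\<^bsub>P\<^esub>" using z comb_eq_quot[OF a] unfolding f_def by simp
  then have "f \<in> I" using quot_eq_iff[OF fc P.zero_closed] fc by (simp add: a_minus_def)
  then obtain q where q: "q \<in> carrier P" "f = q \<otimes>\<^bsub>P\<^esub> g" unfolding I_eq cgenideal_def by auto
  have "up_ring.coeff P q (deg R q) = \<zero>"
  proof -
    let ?d = "deg R q"
    \<comment> \<open>Split into a shift by \<open>p\<close> and a multiple of \<open>q\<close>, so
      that in degree \<open>deg q + p\<close> the second part lies beyond the degree of
      \<open>q\<close>.\<close>
    have *: "q \<otimes>\<^bsub>P\<^esub> g = up_ring.monom P \<one> p \<otimes>\<^bsub>P\<^esub> q \<ominus>\<^bsub>P\<^esub> up_ring.monom P t 0 \<otimes>\<^bsub>P\<^esub> q"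
      using q(1) monom_closed[OF R.one_closed, of p] monom_closed[OF t_closed, of 0] by algebra
    have "\<zero> = up_ring.coeff P f (?d + p)" using cf by simp
    also have "\<dots> = up_ring.coeff P (up_ring.monom P \<one> p \<otimes>\<^bsub>P\<^esub> q) (?d + p) \<ominus>
        up_ring.coeff P (up_ring.monom P t 0 \<otimes>\<^bsub>P\<^esub> q) (?d + p)"
      unfolding q(2) * using q(1) by (intro coeff_minus) auto
    also have "\<dots> = up_ring.coeff P q ?d \<ominus> t \<otimes> up_ring.coeff P q (?d + p)"
      using coeff_monom_mult[OF R.one_closed q(1), of p ?d]
        coeff_monom_mult[OF t_closed q(1), of 0 "?d + p"] q(1) by simp
    also have "up_ring.coeff P q (?d + p) = \<zero>" using p_pos q(1) by (intro deg_aboveD) auto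
    finally show ?thesis using q(1) by (simp add: a_minus_def)
  qed
  then have "q = \<zero>\<^bsub>P\<^esub>" using lcoeff_nonzero2[OF q(1)] by blast
  then have "f = \<zero>\<^bsub>P\<^esub>" using q by simp
  then show ?thesis using cf[of i] i by simp
qed

text \<open>Evaluation at \<open>y\<close> kills \<open>g\<close> because \<open>y\<close> is a
  \<open>p\<close>-th root of the image of \<open>t\<close>, so it factors through the
  quotient.\<close>

lemma universal:
  assumes "cring B" "h \<in> ring_hom R B" "y \<in> carrier B" "y [^]\<^bsub>B\<^esub> p = h t"
  obtains H where "H \<in> ring_hom S B" "\<And>a. a \<in> carrier R \<Longrightarrow> H (emb a) = h a" "H T = y"
proof -
  interpret U: UP_pre_univ_prop R B h P
    using UP_pre_univ_propI[OF R.is_cring assms(1,2)] unfolding P_def .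
  define E where "E = UnivPoly.eval R B h y"
  have E: "E \<in> ring_hom P B" unfolding E_def by (rule U.eval_ring_hom[OF assms(3)])
  interpret E: ring_hom_cring P B E by unfold_locales (rule E)
  have Em: "E (up_ring.monom P a n) = h a \<otimes>\<^bsub>B\<^esub> y [^]\<^bsub>B\<^esub> n" if "a \<in> carrier R" for a n
    unfolding E_def by (rule U.eval_monom[OF that assms(3)])
  have Eg: "E g = \<zero>\<^bsub>B\<^esub>"
    using Em[of \<one> p] Em[of t 0] assms
    by (simp add: a_minus_def U.S.r_neg)
  have EI: "E f = \<zero>\<^bsub>B\<^esub>" if "f \<in> I" for f
  proof -
    have "\<exists>x. f = x \<otimes>\<^bsub>P\<^esub> g \<and> x \<in> carrier P"
      using that unfolding I_eq cgenideal_def by (simp only: mem_Collect_eq)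
    then obtain x where x: "x \<in> carrier P" "f = x \<otimes>\<^bsub>P\<^esub> g" by (elim exE conjE)
    show ?thesis
      unfolding x(2) E.hom_mult[OF x(1) g_closed] Eg by (rule U.S.r_null[OF E.hom_closed[OF x(1)]])
  qed
  have Eeq: "E f = E f'" if "f \<in> carrier P" "f' \<in> carrier P" "I +>\<^bsub>P\<^esub> f = I +>\<^bsub>P\<^esub> f'" for f f'
  proof -
    have "E (f \<ominus>\<^bsub>P\<^esub> f') = \<zero>\<^bsub>B\<^esub>" using that quot_eq_iff EI by blast
    then show ?thesis using that U.S.r_right_minus_eq[of "E f" "E f'"] by (simp add: a_minus_def)
  qed
  \<comment> \<open>A representative of the coset is chosen; by \<open>Eeq\<close> the choice does
    not matter.\<close>
  define H where "H Y = E (SOME f. f \<in> carrier P \<and> Y = I +>\<^bsub>P\<^esub> f)" for Y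
  have HE: "H (I +>\<^bsub>P\<^esub> f) = E f" if "f \<in> carrier P" for f
  proof -
    let ?Q = "\<lambda>f'. f' \<in> carrier P \<and> I +>\<^bsub>P\<^esub> f = I +>\<^bsub>P\<^esub> f'"
    have "?Q (SOME f'. ?Q f')" by (rule someI[of ?Q f]) (simp add: that)
    from Eeq[OF that conjunct1[OF this] conjunct2[OF this]] show ?thesis unfolding H_def by (rule sym)
  qed
  have "H \<in> ring_hom S B"
  proof (rule ring_hom_memI)
    fix x assume "x \<in> carrier S"
    then show "H x \<in> carrier B" unfolding carrier_S using HE by auto
  next
    fix x x' assume "x \<in> carrier S" "x' \<in> carrier S"
    then obtain f f' where f: "f \<in> carrier P" "f' \<in> carrier P" "x = I +>\<^bsub>P\<^esub> f" "x' = I +>\<^bsub>P\<^esub> f'"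
      unfolding carrier_S by auto
    show "H (x \<otimes>\<^bsub>S\<^esub> x') = H x \<otimes>\<^bsub>B\<^esub> H x'"
      using f HE[of "f \<otimes>\<^bsub>P\<^esub> f'"] HE by simp
    show "H (x \<oplus>\<^bsub>S\<^esub> x') = H x \<oplus>\<^bsub>B\<^esub> H x'"
      using f HE[of "f \<oplus>\<^bsub>P\<^esub> f'"] HE by simp
  next
    show "H \<one>\<^bsub>S\<^esub> = \<one>\<^bsub>B\<^esub>" using HE[of "\<one>\<^bsub>P\<^esub>"] by simp
  qed
  moreover have "H (emb a) = h a" if "a \<in> carrier R" for a
    using HE[of "up_ring.monom P a 0"] Em[of a 0] that U.hom_closed[of a] by (simp add: emb_eq)
  moreover have "H T = y"
    using HE[of "up_ring.monom P \<one> 1"] Em[of \<one> 1] assms by (simp add: T_eq)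
  ultimately show ?thesis using that by blast
qed

lemma hom_comb:
  assumes "cring B" "H \<in> ring_hom S B" "a \<in> {..<p} \<rightarrow> carrier R"
  shows "H (comb a) = (\<Oplus>\<^bsub>B\<^esub>i\<in>{..<p}. H (emb (a i)) \<otimes>\<^bsub>B\<^esub> H T [^]\<^bsub>B\<^esub> i)"
proof -
  interpret B: cring B by fact
  interpret H: ring_hom_cring S B H by unfold_locales (rule assms)
  show ?thesis unfolding comb_def
    using assms(3) by (subst H.hom_finsum) (auto simp: comp_def Pi_iff intro!: B.finsum_cong')
qed

text \<open>By \<open>span\<close>, the constants and \<open>T\<close> generate
  \<open>S\<close>.\<close>

lemma hom_unique:
  assumes "cring B" "H \<in> ring_hom S B" "H' \<in> ring_hom S B"
    and "\<And>a. a \<in> carrier R \<Longrightarrow> H (emb a) = H' (emb a)" "H T = H' T" "s \<in> carrier S"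
  shows "H s = H' s"
proof -
  interpret B: cring B by fact
  interpret H: ring_hom_cring S B H by unfold_locales (rule assms)
  interpret H': ring_hom_cring S B H' by unfold_locales (rule assms)
  obtain a where a: "a \<in> UNIV \<rightarrow> carrier R" "s = comb a" using span[OF assms(6)] .
  have a': "a i \<in> carrier R" for i using a by auto
  show ?thesis unfolding a(2)
    using a(1) assms(4,5) by (subst (1 2) hom_comb[OF assms(1)]) (auto simp: assms a')
qed

lemma emb_inj: assumes "a \<in> carrier R" "emb a = \<zero>\<^bsub>S\<^esub>" shows "a = \<zero>"
proof -
  have "comb (\<lambda>i. if i = 0 then a else \<zero>) = (\<Oplus>\<^bsub>S\<^esub>i\<in>{..<p}. if 0 = i then emb a else \<zero>\<^bsub>S\<^esub>)"
    unfolding comb_def using assms by (intro S.finsum_cong') auto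
  also have "\<dots> = emb a" using assms p_pos S.finsum_singleton[of 0 "{..<p}" "\<lambda>_. emb a"] by auto
  finally show ?thesis using indep[of "\<lambda>i. if i = 0 then a else \<zero>" 0] assms p_pos by auto
qed

end

section \<open>Automorphisms of split Kummer algebras\<close>

text \<open>Each root splits off a linear factor, and in a domain the remaining roots are roots of
  the cofactor.\<close>

lemma (in UP_domain) card_roots_le_deg:
  assumes "f \<in> carrier P" "f \<noteq> \<zero>\<^bsub>P\<^esub>" "finite W"
    and "\<And>w. w \<in> W \<Longrightarrow> w \<in> carrier R \<and> UnivPoly.eval R R id w f = \<zero>"
  shows "card W \<le> deg R f"
  using assms
proof (induction "card W" arbitrary: f W)
  case 0
  then show ?case by simp
next
  case (Suc n)
  then obtain a where a: "a \<in> W" by fastforce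
  then have ac: "a \<in> carrier R" "UnivPoly.eval R R id a f = \<zero>" using Suc by auto
  have nt: "carrier R \<noteq> {\<zero>}" using R.one_not_zero R.carrier_one_not_zero by simp
  let ?g = "up_ring.monom P \<one> 1 \<ominus>\<^bsub>P\<^esub> up_ring.monom P a 0"
  have gc: "?g \<in> carrier P" using ac by simp
  obtain q where q: "q \<in> carrier P" "f = ?g \<otimes>\<^bsub>P\<^esub> q"
    using remainder_theorem[OF Suc.prems(1) ac(1) nt] gc unfolding ac(2) by auto
  have q0: "q \<noteq> \<zero>\<^bsub>P\<^esub>" using Suc.prems(2) q gc by auto
  have dg: "deg R ?g = 1" by (rule deg_minus_monom[OF ac(1) nt])
  have g0: "?g \<noteq> \<zero>\<^bsub>P\<^esub>" using dg deg_zero by (metis zero_neq_one)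
  have df: "deg R f = Suc (deg R q)" unfolding q(2) using deg_mult[OF g0 q0 gc q(1)] dg by simp
  have "card (W - {a}) \<le> deg R q"
  proof (rule Suc.hyps(1))
    show "n = card (W - {a})" using Suc a by simp
    fix w assume w: "w \<in> W - {a}"
    then have wc: "w \<in> carrier R" "UnivPoly.eval R R id w f = \<zero>" using Suc by auto
    interpret U: UP_pre_univ_prop R R id P by unfold_locales simp
    interpret E: ring_hom_cring P R "UnivPoly.eval R R id w"
      by unfold_locales (rule U.eval_ring_hom[OF wc(1)])
    have "UnivPoly.eval R R id w ?g = w \<ominus> a"
      using U.eval_monom[OF R.one_closed wc(1), of 1] U.eval_monom[OF ac(1) wc(1), of 0] ac(1) wc(1)
      by (simp add: a_minus_def)
    then have "\<zero> = (w \<ominus> a) \<otimes> UnivPoly.eval R R id w q"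
      using wc(2) gc q(1) unfolding q(2) by (simp only: E.hom_mult)
    then have "UnivPoly.eval R R id w q = \<zero>"
      using R.integral_iff[OF R.minus_closed[OF wc(1) ac(1)] E.hom_closed[OF q(1)]] w
        R.r_right_minus_eq[OF wc(1) ac(1)] by auto
    with wc(1) show "w \<in> carrier R \<and> UnivPoly.eval R R id w q = \<zero>" by (rule conjI)
  qed (use q q0 Suc in auto)
  then show ?case using df a Suc by simp
qed

lemma (in domain) roots_of_unity_card_le:
  assumes "0 < n" "finite W" "\<And>w. w \<in> W \<Longrightarrow> w \<in> carrier R \<and> w [^] (n::nat) = \<one>"
  shows "card W \<le> n"
proof -
  interpret U: UP_domain R "UP R" by unfold_locales simp
  let ?f = "up_ring.monom (UP R) \<one> n \<ominus>\<^bsub>UP R\<^esub> up_ring.monom (UP R) \<one> 0"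
  have d: "deg R ?f = n" using assms(1) by (simp add: U.deg_minus_eq)
  have "?f \<noteq> \<zero>\<^bsub>UP R\<^esub>" using d assms(1) U.deg_zero by (metis less_irrefl)
  moreover have "UnivPoly.eval R R id w ?f = \<zero>" if "w \<in> W" for w
    using assms(3)[OF that] by (simp add: U.evalRR_simps)
  ultimately show ?thesis using U.card_roots_le_deg[of ?f W] assms d by auto
qed

text \<open>The Vandermonde statement in terms of roots: a polynomial of degree below
  \<open>n\<close> with \<open>n\<close> roots is zero. It makes the values at the roots a complete
  test for elements of a split Kummer algebra.\<close>

lemma (in domain) coeffs_zero_of_roots:
  assumes a: "\<And>i. i < n \<Longrightarrow> a i \<in> carrier R" and W: "finite W" "W \<subseteq> carrier R" "n \<le> card W"
    and z: "\<And>w. w \<in> W \<Longrightarrow> (\<Oplus>i\<in>{..<n}. a i \<otimes> w [^] (i::nat)) = \<zero>"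
    and i: "i < n"
  shows "a i = \<zero>"
proof -
  interpret U: UP_domain R "UP R" by unfold_locales simp
  define f where "f = (\<Oplus>\<^bsub>UP R\<^esub>i\<in>{..<n}. up_ring.monom (UP R) (a i) i)"
  have fc: "f \<in> carrier (UP R)" unfolding f_def using a by (intro U.P.finsum_closed) (auto simp: Pi_iff)
  have cf: "up_ring.coeff (UP R) f k = (if k < n then a k else \<zero>)" for k
  proof -
    have "up_ring.coeff (UP R) f k = (\<Oplus>i\<in>{..<n}. if k = i then a i else \<zero>)"
      unfolding f_def using a by (subst U.coeff_finsum) (auto simp: Pi_iff intro!: finsum_cong')
    also have "\<dots> = (if k < n then a k else \<zero>)"
    proof (cases "k < n")
      case True
      then show ?thesis using finsum_singleton[of k "{..<n}" a] a by auto
    next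
      case False
      then have "(\<Oplus>i\<in>{..<n}. if k = i then a i else \<zero>) = (\<Oplus>i\<in>{..<n}. \<zero>)"
        by (intro finsum_cong') auto
      then show ?thesis using False by simp
    qed
    finally show ?thesis .
  qed
  have "f = \<zero>\<^bsub>UP R\<^esub>"
  proof (rule ccontr)
    assume nz: "f \<noteq> \<zero>\<^bsub>UP R\<^esub>"
    have "UnivPoly.eval R R id w f = \<zero>" if "w \<in> W" for w
    proof -
      have wc: "w \<in> carrier R" using that W by auto
      interpret V: UP_pre_univ_prop R R id "UP R" by unfold_locales simp
      interpret E: ring_hom_cring "UP R" R "UnivPoly.eval R R id w"
        by unfold_locales (rule V.eval_ring_hom[OF wc(1)])
      have "UnivPoly.eval R R id w f = (\<Oplus>i\<in>{..<n}. UnivPoly.eval R R id w (up_ring.monom (UP R) (a i) i))"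
        unfolding f_def using a by (subst E.hom_finsum) (auto simp: Pi_iff comp_def)
      also have "\<dots> = (\<Oplus>i\<in>{..<n}. a i \<otimes> w [^] i)"
        using a wc by (intro finsum_cong') (auto simp: V.eval_monom)
      finally show ?thesis using z[OF that] by simp
    qed
    then have "card W \<le> deg R f" using U.card_roots_le_deg[OF fc nz W(1)] W(2) by auto
    moreover have "deg R f \<le> n - 1" using cf fc i by (intro U.deg_aboveI) auto
    ultimately show False using W(3) i by simp
  qed
  then show ?thesis using cf[of i] i by simp
qed

lemma alg_aut_group_carrier:
  "f \<in> carrier (alg_aut_group R S \<iota>) \<longleftrightarrow> f \<in> extensional (carrier S) \<and>
     bij_betw f (carrier S) (carrier S) \<and> f \<in> ring_hom S S \<and> (\<forall>a\<in>carrier R. f (\<iota> a) = \<iota> a)"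
  by (auto simp: alg_aut_group_def Bij_def)

lemma alg_aut_group_mult:
  assumes "f \<in> carrier (alg_aut_group R S \<iota>)" "h \<in> carrier (alg_aut_group R S \<iota>)"
  shows "f \<otimes>\<^bsub>alg_aut_group R S \<iota>\<^esub> h = compose (carrier S) f h"
  using assms by (simp add: alg_aut_group_def BijGroup_def)

lemma alg_aut_group_one: "\<one>\<^bsub>alg_aut_group R S \<iota>\<^esub> = (\<lambda>s\<in>carrier S. s)"
  by (simp add: alg_aut_group_def BijGroup_def)

text \<open>\<open>alg_aut_group\<close> only shrinks the carrier of the group of bijections, so it
  suffices to have a subgroup. The substance is that the inverse bijection again respects the
  operations and the constants.\<close>

lemma alg_aut_group_group:
  assumes "ring S" "\<iota> \<in> carrier R \<rightarrow> carrier S"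
  shows "group (alg_aut_group R S \<iota>)"
proof -
  interpret S: ring S by fact
  let ?H = "{f \<in> Bij (carrier S). f \<in> ring_hom S S \<and> (\<forall>a\<in>carrier R. f (\<iota> a) = \<iota> a)}"
  have "subgroup ?H (BijGroup (carrier S))"
  proof (rule group.subgroupI[OF group_BijGroup])
    show "?H \<subseteq> carrier (BijGroup (carrier S))" by (auto simp: BijGroup_def)
    have "(\<lambda>s\<in>carrier S. s) \<in> ?H" using assms(2)
      by (auto simp: id_Bij Pi_iff intro!: ring_hom_memI)
    then show "?H \<noteq> {}" by blast
  next
    fix f assume f: "f \<in> ?H"
    then have b: "bij_betw f (carrier S) (carrier S)" by (simp add: Bij_def)
    define i where "i = restrict (inv_into (carrier S) f) (carrier S)"
    have ic: "i s \<in> carrier S" "f (i s) = s" if "s \<in> carrier S" for s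
      using that b by (auto simp: i_def bij_betw_def inv_into_into f_inv_into_f)
    have inj: "s = s'" if "f s = f s'" "s \<in> carrier S" "s' \<in> carrier S" for s s'
      using that b by (auto simp: bij_betw_def inj_on_def)
    have fh: "f \<in> ring_hom S S" using f by simp
    have "i \<in> ring_hom S S"
    proof (rule ring_hom_memI)
      fix x y assume xy: "x \<in> carrier S" "y \<in> carrier S"
      show "i x \<in> carrier S" using ic xy by blast
      show "i (x \<otimes>\<^bsub>S\<^esub> y) = i x \<otimes>\<^bsub>S\<^esub> i y"
        by (rule inj) (simp_all add: ring_hom_mult[OF fh] ic xy)
      show "i (x \<oplus>\<^bsub>S\<^esub> y) = i x \<oplus>\<^bsub>S\<^esub> i y"
        by (rule inj) (simp_all add: ring_hom_add[OF fh] ic xy)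
    next
      show "i \<one>\<^bsub>S\<^esub> = \<one>\<^bsub>S\<^esub>"
        by (rule inj) (simp_all add: ring_hom_one[OF fh] ic)
    qed
    moreover have "i (\<iota> a) = \<iota> a" if "a \<in> carrier R" for a
      by (rule inj) (use f that ic assms(2) in \<open>auto simp: Pi_iff\<close>)
    moreover have "i \<in> Bij (carrier S)" unfolding i_def using f by (intro restrict_inv_into_Bij) simp
    ultimately show "inv\<^bsub>BijGroup (carrier S)\<^esub> f \<in> ?H"
      using f by (simp add: inv_BijGroup i_def[symmetric])
  next
    fix f h assume f: "f \<in> ?H" "h \<in> ?H"
    then have fh: "f \<in> ring_hom S S" "h \<in> ring_hom S S" by auto
    have hc: "h s \<in> carrier S" if "s \<in> carrier S" for s using that fh by (meson ring_hom_closed)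
    have "compose (carrier S) f h \<in> ring_hom S S"
      using fh hc by (intro ring_hom_memI)
        (auto simp: compose_eq ring_hom_mult ring_hom_add ring_hom_one intro: ring_hom_closed)
    moreover have "compose (carrier S) f h (\<iota> a) = \<iota> a" if "a \<in> carrier R" for a
      using f assms(2) that by (auto simp: compose_eq Pi_iff)
    ultimately show "f \<otimes>\<^bsub>BijGroup (carrier S)\<^esub> h \<in> ?H"
      using f by (simp add: BijGroup_def compose_Bij)
  qed
  then show ?thesis unfolding alg_aut_group_def by (rule subgroup.subgroup_is_group) (rule group_BijGroup)
qed

text \<open>The orbit of a moved point fills a set of \<open>p\<close> elements: a return after
  \<open>0 < d < p\<close> steps, combined with the return after \<open>p\<close> steps by Bezout,
  would be a return after one step.\<close>

lemma prime_cycle_enumeration: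
  fixes p :: nat
  assumes "Factorial_Ring.prime p" "card Z = p" "f \<in> Z \<rightarrow> Z" "\<And>z. z \<in> Z \<Longrightarrow> (f ^^ p) z = z"
    and "z \<in> Z" "f z \<noteq> z"
  shows "bij_betw (\<lambda>i. (f ^^ i) z) {..<p} Z"
proof -
  have fin: "finite Z" using assms(1,2) by (metis card.infinite not_prime_0)
  have cl: "(f ^^ i) y \<in> Z" if "y \<in> Z" for i y
    using that assms(3) by (induction i) auto
  have per: "(f ^^ (p * k)) y = y" if "y \<in> Z" for k y
    using that assms(4) by (induction k) (auto simp: funpow_add)
  have perd: "(f ^^ (d * k)) y = y" if "(f ^^ d) y = y" for d k y
    using that by (induction k) (auto simp: funpow_add)
  have inj: "inj_on (\<lambda>i. (f ^^ i) z) {..<p}"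
  proof (rule linorder_inj_onI')
    fix i j assume ij: "i < j" "i \<in> {..<p}" "j \<in> {..<p}"
    show "(f ^^ i) z \<noteq> (f ^^ j) z"
    proof
      assume eq: "(f ^^ i) z = (f ^^ j) z"
      have "(f ^^ (p - i)) ((f ^^ i) z) = z" "(f ^^ (p - i)) ((f ^^ j) z) = (f ^^ (j - i)) z"
      proof -
        show "(f ^^ (p - i)) ((f ^^ i) z) = z"
          using per[OF assms(5), of 1] ij funpow_add[of "p - i" i f] by (simp add: comp_def)
        have "(f ^^ (p - i)) ((f ^^ j) z) = (f ^^ (p - i + j)) z" by (simp add: funpow_add)
        also have "p - i + j = (j - i) + p" using ij by auto
        also have "(f ^^ ((j - i) + p)) z = (f ^^ (j - i)) z" using assms(4,5) by (simp add: funpow_add)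
        finally show "(f ^^ (p - i)) ((f ^^ j) z) = (f ^^ (j - i)) z" .
      qed
      then have d: "(f ^^ (j - i)) z = z" using eq by simp
      have "coprime (j - i) p" using ij assms(1)
        using prime_imp_coprime[OF assms(1), of "j - i"] nat_dvd_not_less[of "j - i" p]
        by (auto simp: coprime_commute)
      then obtain k l where kl: "(j - i) * k = p * l + 1"
        using bezout_nat[of "j - i" p] ij by (auto simp: coprime_iff_gcd_eq_1)
      have "f z = (f ^^ 1) ((f ^^ (p * l)) z)" using per[OF assms(5)] by simp
      also have "\<dots> = (f ^^ ((j - i) * k)) z" unfolding kl by (simp add: funpow_add add.commute)
      also have "\<dots> = z" by (rule perd[OF d])
      finally show False using assms(6) by simp
    qed
  qed
  moreover have "(\<lambda>i. (f ^^ i) z) ` {..<p} = Z"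
    using inj cl[OF assms(5)] assms(2) fin
    by (intro card_subset_eq) (auto simp: card_image)
  ultimately show ?thesis by (simp add: bij_betw_def)
qed

text \<open>Each permutation is a single cycle, and \<open>P\<close> matches the \<open>i\<close>-th
  point of one with the \<open>i\<close>-th point of the other, starting from arbitrary moved
  points.\<close>

lemma prime_cycles_conjugate:
  fixes p :: nat
  assumes "Factorial_Ring.prime p" "card Z = p"
    and "f \<in> Z \<rightarrow> Z" "\<And>z. z \<in> Z \<Longrightarrow> (f ^^ p) z = z" "\<exists>z\<in>Z. f z \<noteq> z"
    and "h \<in> Z \<rightarrow> Z" "\<And>z. z \<in> Z \<Longrightarrow> (h ^^ p) z = z" "\<exists>z\<in>Z. h z \<noteq> z"
  obtains P where "bij_betw P Z Z" "\<And>z. z \<in> Z \<Longrightarrow> P (f z) = h (P z)"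
proof -
  obtain z w where zw: "z \<in> Z" "f z \<noteq> z" "w \<in> Z" "h w \<noteq> w" using assms by auto
  let ?a = "\<lambda>i. (f ^^ i) z" and ?b = "\<lambda>i. (h ^^ i) w"
  have a: "bij_betw ?a {..<p} Z" using assms zw by (intro prime_cycle_enumeration) auto
  have b: "bij_betw ?b {..<p} Z" using assms zw by (intro prime_cycle_enumeration) auto
  define P where "P = ?b \<circ> inv_into {..<p} ?a"
  have Pa: "P (?a i) = ?b i" if "i < p" for i
    unfolding P_def comp_def
    by (subst bij_betw_inv_into_left[OF a]) (use that in auto)
  have "bij_betw P Z Z" unfolding P_def using bij_betw_trans[OF bij_betw_inv_into[OF a] b] .
  moreover have "P (f y) = h (P y)" if y: "y \<in> Z" for y
  proof -
    obtain i where i: "i < p" "y = ?a i" using a y by (auto simp: bij_betw_def)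
    show ?thesis
    proof (cases "Suc i < p")
      case True
      then show ?thesis using Pa[of "Suc i"] Pa[of i] i by simp
    next
      \<comment> \<open>At the last index \<open>i = p - 1\<close> both cycles close up, and the
        starting points correspond.\<close>
      case False
      then have e: "Suc i = p" using i by simp
      have "f y = ?a p" unfolding i(2) e[symmetric] by simp
      then have "f y = ?a 0" using assms(4)[OF zw(1)] by simp
      moreover have "h (?b i) = ?b p" unfolding e[symmetric] by simp
      ultimately show ?thesis using Pa[of i] Pa[of 0] i assms(7)[OF zw(3)] by simp
    qed
  qed
  ultimately show ?thesis using that by blast
qed

section \<open>Restricted products of Kummer algebras\<close>

text \<open>The adele ring with the local fields \<open>K\<close> and their integers
  \<open>Oo\<close> as parameters; the curve then enters only through the properties collected in
  \<open>adelic_kummer\<close>.\<close>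

definition restricted_product :: "'x set \<Rightarrow> ('x \<Rightarrow> 'a ring) \<Rightarrow> ('x \<Rightarrow> 'a set) \<Rightarrow> ('x \<Rightarrow> 'a) ring" where
  "restricted_product C K Oo =
     \<lparr>carrier = {\<alpha> \<in> (\<Pi>\<^sub>E x\<in>C. carrier (K x)). finite {x \<in> C. \<alpha> x \<notin> Oo x}},
      monoid.mult = (\<lambda>\<alpha> \<beta>. \<lambda>x\<in>C. \<alpha> x \<otimes>\<^bsub>K x\<^esub> \<beta> x),
      one = (\<lambda>x\<in>C. \<one>\<^bsub>K x\<^esub>),
      ring.zero = (\<lambda>x\<in>C. \<zero>\<^bsub>K x\<^esub>),
      ring.add = (\<lambda>\<alpha> \<beta>. \<lambda>x\<in>C. \<alpha> x \<oplus>\<^bsub>K x\<^esub> \<beta> x)\<rparr>"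

text \<open>Any finite \<open>N\<close> may bound the exceptional set, in particular the union of
  the exceptional sets of several adeles.\<close>

lemma restricted_product_carrierI:
  assumes "\<And>x. x \<in> C \<Longrightarrow> f x \<in> carrier (K x)" "finite N" "\<And>x. x \<in> C \<Longrightarrow> x \<notin> N \<Longrightarrow> f x \<in> Oo x"
  shows "(\<lambda>x\<in>C. f x) \<in> carrier (restricted_product C K Oo)"
proof -
  have "finite {x \<in> C. (\<lambda>x\<in>C. f x) x \<notin> Oo x}"
    using assms(2) by (rule finite_subset[rotated]) (use assms(3) in auto)
  then show ?thesis using assms(1) by (simp add: restricted_product_def)
qed

lemma restricted_product_cring:
  assumes K: "\<And>x. x \<in> C \<Longrightarrow> cring (K x)" and Oo: "\<And>x. x \<in> C \<Longrightarrow> subring (Oo x) (K x)"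
  shows "cring (restricted_product C K Oo)" (is "cring ?R")
proof -
  have car: "\<alpha> \<in> carrier ?R \<longleftrightarrow> \<alpha> \<in> extensional C \<and> (\<forall>x\<in>C. \<alpha> x \<in> carrier (K x)) \<and>
      finite {x \<in> C. \<alpha> x \<notin> Oo x}" for \<alpha>
    by (auto simp: restricted_product_def PiE_def Pi_iff)
  have ops: "(\<lambda>x\<in>C. \<alpha> x \<otimes>\<^bsub>K x\<^esub> \<beta> x) \<in> carrier ?R" "(\<lambda>x\<in>C. \<alpha> x \<oplus>\<^bsub>K x\<^esub> \<beta> x) \<in> carrier ?R"
    if "\<alpha> \<in> carrier ?R" "\<beta> \<in> carrier ?R" for \<alpha> \<beta>
  proof -
    have fin: "finite ({x \<in> C. \<alpha> x \<notin> Oo x} \<union> {x \<in> C. \<beta> x \<notin> Oo x})" using that car by auto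
    show "(\<lambda>x\<in>C. \<alpha> x \<otimes>\<^bsub>K x\<^esub> \<beta> x) \<in> carrier ?R"
      using that[unfolded car] Oo K by (intro restricted_product_carrierI[OF _ fin])
        (auto intro: subringE cring.cring_simprules(5))
    show "(\<lambda>x\<in>C. \<alpha> x \<oplus>\<^bsub>K x\<^esub> \<beta> x) \<in> carrier ?R"
      using that[unfolded car] Oo K by (intro restricted_product_carrierI[OF _ fin])
        (auto intro: subringE cring.cring_simprules(1))
  qed
  have mult: "\<alpha> \<otimes>\<^bsub>?R\<^esub> \<beta> = (\<lambda>x\<in>C. \<alpha> x \<otimes>\<^bsub>K x\<^esub> \<beta> x)" and add: "\<alpha> \<oplus>\<^bsub>?R\<^esub> \<beta> = (\<lambda>x\<in>C. \<alpha> x \<oplus>\<^bsub>K x\<^esub> \<beta> x)"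
    and one: "\<one>\<^bsub>?R\<^esub> = (\<lambda>x\<in>C. \<one>\<^bsub>K x\<^esub>)" and zero: "\<zero>\<^bsub>?R\<^esub> = (\<lambda>x\<in>C. \<zero>\<^bsub>K x\<^esub>)" for \<alpha> \<beta>
    by (simp_all add: restricted_product_def)
  show ?thesis
  proof (rule cringI)
    show "abelian_group ?R"
    proof (rule abelian_groupI)
      show "\<zero>\<^bsub>?R\<^esub> \<in> carrier ?R" unfolding zero
        using Oo K by (intro restricted_product_carrierI[of _ _ _ "{}"]) (auto intro: subringE cring.cring_simprules(2))
      fix \<alpha> assume a: "\<alpha> \<in> carrier ?R"
      show "\<zero>\<^bsub>?R\<^esub> \<oplus>\<^bsub>?R\<^esub> \<alpha> = \<alpha>" unfolding add zero
        using a[unfolded car] K by (intro extensionalityI[where A=C]) (auto simp: cring.cring_simprules)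
      show "\<exists>\<beta>\<in>carrier ?R. \<beta> \<oplus>\<^bsub>?R\<^esub> \<alpha> = \<zero>\<^bsub>?R\<^esub>"
      proof
        show "(\<lambda>x\<in>C. \<ominus>\<^bsub>K x\<^esub> \<alpha> x) \<in> carrier ?R" using a[unfolded car] K Oo
          by (intro restricted_product_carrierI[of _ _ _ "{x \<in> C. \<alpha> x \<notin> Oo x}"])
             (auto intro: subringE cring.cring_simprules(3))
        show "(\<lambda>x\<in>C. \<ominus>\<^bsub>K x\<^esub> \<alpha> x) \<oplus>\<^bsub>?R\<^esub> \<alpha> = \<zero>\<^bsub>?R\<^esub>" unfolding add zero
          using a[unfolded car] K by (intro restrict_ext) (auto simp: cring.cring_simprules)
      qed
    next
      fix \<alpha> \<beta> assume ab: "\<alpha> \<in> carrier ?R" "\<beta> \<in> carrier ?R"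
      show "\<alpha> \<oplus>\<^bsub>?R\<^esub> \<beta> \<in> carrier ?R" unfolding add by (rule ops[OF ab])
      show "\<alpha> \<oplus>\<^bsub>?R\<^esub> \<beta> = \<beta> \<oplus>\<^bsub>?R\<^esub> \<alpha>" unfolding add
        using ab[unfolded car] K by (intro restrict_ext) (auto simp: cring.cring_simprules)
      fix \<gamma> assume c: "\<gamma> \<in> carrier ?R"
      show "\<alpha> \<oplus>\<^bsub>?R\<^esub> \<beta> \<oplus>\<^bsub>?R\<^esub> \<gamma> = \<alpha> \<oplus>\<^bsub>?R\<^esub> (\<beta> \<oplus>\<^bsub>?R\<^esub> \<gamma>)" unfolding add
        using ab[unfolded car] c[unfolded car] K by (intro restrict_ext) (auto simp: cring.cring_simprules)
    qed
    show "comm_monoid ?R"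
    proof (rule comm_monoidI)
      show "\<one>\<^bsub>?R\<^esub> \<in> carrier ?R" unfolding one
        using Oo K by (intro restricted_product_carrierI[of _ _ _ "{}"]) (auto intro: subringE cring.cring_simprules(6))
      fix \<alpha> assume a: "\<alpha> \<in> carrier ?R"
      show "\<one>\<^bsub>?R\<^esub> \<otimes>\<^bsub>?R\<^esub> \<alpha> = \<alpha>" unfolding mult one
        using a[unfolded car] K by (intro extensionalityI[where A=C]) (auto intro: cring.cring_simprules(12))
      fix \<beta> assume b: "\<beta> \<in> carrier ?R"
      show "\<alpha> \<otimes>\<^bsub>?R\<^esub> \<beta> \<in> carrier ?R" unfolding mult by (rule ops[OF a b])
      show "\<alpha> \<otimes>\<^bsub>?R\<^esub> \<beta> = \<beta> \<otimes>\<^bsub>?R\<^esub> \<alpha>" unfolding mult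
        using a[unfolded car] b[unfolded car] K by (intro restrict_ext) (auto intro: cring.cring_simprules(14))
      fix \<gamma> assume c: "\<gamma> \<in> carrier ?R"
      show "\<alpha> \<otimes>\<^bsub>?R\<^esub> \<beta> \<otimes>\<^bsub>?R\<^esub> \<gamma> = \<alpha> \<otimes>\<^bsub>?R\<^esub> (\<beta> \<otimes>\<^bsub>?R\<^esub> \<gamma>)" unfolding mult
        using a[unfolded car] b[unfolded car] c[unfolded car] K by (intro restrict_ext) (auto simp: cring.cring_simprules)
    qed
    fix \<alpha> \<beta> \<gamma> assume abc: "\<alpha> \<in> carrier ?R" "\<beta> \<in> carrier ?R" "\<gamma> \<in> carrier ?R"
    show "(\<alpha> \<oplus>\<^bsub>?R\<^esub> \<beta>) \<otimes>\<^bsub>?R\<^esub> \<gamma> = \<alpha> \<otimes>\<^bsub>?R\<^esub> \<gamma> \<oplus>\<^bsub>?R\<^esub> \<beta> \<otimes>\<^bsub>?R\<^esub> \<gamma>" unfolding add mult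
      using abc[unfolded car] K by (intro restrict_ext) (auto simp: cring.cring_simprules)
  qed
qed

lemma UP_coeff: "f \<in> carrier (UP R) \<Longrightarrow> up_ring.coeff (UP R) f i = f i"
  by (simp add: UP_def)

lemma UP_carrier_iff: "f \<in> carrier (UP R) \<longleftrightarrow> (\<forall>i. f i \<in> carrier R) \<and> (\<exists>n. bound \<zero>\<^bsub>R\<^esub> n f)"
  by (auto simp: UP_def up_def)

lemma ring_hom_cong:
  assumes "H \<in> ring_hom A B" "\<And>s. s \<in> carrier A \<Longrightarrow> H' s = H s" "ring A"
  shows "H' \<in> ring_hom A B"
proof -
  interpret ring A by fact
  show ?thesis using assms(2)
    by (intro ring_hom_memI)
       (auto simp: ring_hom_closed[OF assms(1)] ring_hom_mult[OF assms(1)] ring_hom_add[OF assms(1)]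
          ring_hom_one[OF assms(1)])
qed

text \<open>The form of \<open>local_proj\<close> for abstract local data. That all representatives
  of a coset have the same image, as \<open>the_elem\<close> requires, is part of the proof of
  \<open>L_eq\<close>.\<close>

definition coeff_proj :: "('x \<Rightarrow> 'a ring) \<Rightarrow> nat \<Rightarrow> ('x \<Rightarrow> 'a) \<Rightarrow> 'x \<Rightarrow> (nat \<Rightarrow> 'x \<Rightarrow> 'a) set \<Rightarrow> (nat \<Rightarrow> 'a) set" where
  "coeff_proj K p t x U = the_elem
     ((\<lambda>f. kummer_ideal (K x) p (t x) +>\<^bsub>UP (K x)\<^esub> (\<lambda>i. f i x)) ` U)"

section \<open>Adelic Kummer algebras over abstract local data\<close>

text \<open>\<open>Rm\<close> plays the ramified points. \<open>p_inv\<close> and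
  \<open>pth_closed\<close> make interpolation coefficients integral almost everywhere;
  \<open>ram_domain\<close> and \<open>ram_roots\<close> force automorphisms at a ramified point to
  multiply \<open>T\<close> by a root of unity; \<open>unram_roots\<close> says that the equation
  splits completely at the other points.\<close>

locale adelic_kummer =
  fixes C :: "'x set" and K :: "'x \<Rightarrow> 'a ring" and Oo :: "'x \<Rightarrow> 'a set" and p :: nat and t :: "'x \<Rightarrow> 'a"
    and Rm :: "'x set"
  assumes prime_p: "Factorial_Ring.prime p"
    and field_K: "\<And>x. x \<in> C \<Longrightarrow> field (K x)"
    and subring_O: "\<And>x. x \<in> C \<Longrightarrow> subring (Oo x) (K x)"
    and p_inv: "\<And>x. x \<in> C \<Longrightarrow> \<exists>q\<in>Oo x. add_pow (K x) p \<one>\<^bsub>K x\<^esub> \<otimes>\<^bsub>K x\<^esub> q = \<one>\<^bsub>K x\<^esub>"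
    and pth_closed: "\<And>x z. x \<in> C \<Longrightarrow> z \<in> carrier (K x) \<Longrightarrow> z [^]\<^bsub>K x\<^esub> p \<in> Oo x \<Longrightarrow> z \<in> Oo x"
    and t_unit: "t \<in> Units (restricted_product C K Oo)"
    and Rm_sub: "Rm \<subseteq> C"
    and ram_domain: "\<And>x. x \<in> Rm \<Longrightarrow> domain (kummer_algebra (K x) p (t x))"
    and ram_roots: "\<And>x. x \<in> Rm \<Longrightarrow> card {w \<in> carrier (K x). w [^]\<^bsub>K x\<^esub> p = \<one>\<^bsub>K x\<^esub>} = p"
    and unram_roots: "\<And>x. x \<in> C - Rm \<Longrightarrow> card {z \<in> carrier (K x). z [^]\<^bsub>K x\<^esub> p = t x} = p"
begin

abbreviation "R \<equiv> restricted_product C K Oo"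

lemma p_gt1: "1 < p" using prime_p by (rule prime_gt_1_nat)

lemma cring_K: "x \<in> C \<Longrightarrow> cring (K x)"
  using field_K by (simp add: field.axioms(1) domain.axioms(1))

sublocale kum: kummer R "UP R" p t
  using restricted_product_cring[OF cring_K subring_O] p_gt1 t_unit
  by (simp add: kummer_def UP_cring_def kummer_axioms_def Units_def)

lemma kummer_K: "x \<in> C \<Longrightarrow> kummer (K x) p (t x)"
  using cring_K p_gt1 kum.t_closed
  by (auto simp: kummer_def UP_cring_def kummer_axioms_def restricted_product_def)

lemma R_mem: "\<alpha> \<in> carrier R \<Longrightarrow> x \<in> C \<Longrightarrow> \<alpha> x \<in> carrier (K x)"
  by (auto simp: restricted_product_def)

lemma R_fin: "\<alpha> \<in> carrier R \<Longrightarrow> finite {x \<in> C. \<alpha> x \<notin> Oo x}"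
  by (auto simp: restricted_product_def)

lemma R_ext: "\<alpha> \<in> carrier R \<Longrightarrow> \<beta> \<in> carrier R \<Longrightarrow> (\<And>x. x \<in> C \<Longrightarrow> \<alpha> x = \<beta> x) \<Longrightarrow> \<alpha> = \<beta>"
  by (intro extensionalityI[where A=C]) (auto simp: restricted_product_def PiE_def)

lemma R_eval_hom: "x \<in> C \<Longrightarrow> (\<lambda>\<alpha>. \<alpha> x) \<in> ring_hom R (K x)"
  by (rule ring_hom_memI) (auto simp: restricted_product_def)

abbreviation "Sx x \<equiv> kummer_algebra (K x) p (t x)"
abbreviation "embx x \<equiv> kummer_embed (K x) p (t x)"
abbreviation "Tx x \<equiv> kummer_gen (K x) p (t x)"
abbreviation "L x \<equiv> coeff_proj K p t x"

text \<open>The cosetwise description of \<open>L x\<close> is compared with a homomorphism that is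
  already at hand. Expanding a representative in powers of \<open>T\<close> shows that the two
  agree, and hence that the image of a coset is a single element.\<close>

lemma L_eq:
  assumes x: "x \<in> C" and H: "H \<in> ring_hom kum.S (Sx x)"
    and Hemb: "\<And>\<alpha>. \<alpha> \<in> carrier R \<Longrightarrow> H (kum.emb \<alpha>) = embx x (\<alpha> x)" and HT: "H kum.T = Tx x"
    and s: "s \<in> carrier kum.S"
  shows "L x s = H s"
proof -
  interpret k: kummer "K x" "UP (K x)" p "t x" using kummer_K[OF x] by simp
  interpret H: ring_hom_cring kum.S "Sx x" H by unfold_locales (rule H)
  have *: "k.I +>\<^bsub>UP (K x)\<^esub> (\<lambda>i. f i x) = H (kum.I +>\<^bsub>UP R\<^esub> f)" if f: "f \<in> carrier (UP R)" for f
  proof -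
    let ?f = "\<lambda>i. f i x"
    have fi: "f i \<in> carrier R" for i using f unfolding UP_carrier_iff by blast
    obtain n where n: "bound \<zero>\<^bsub>R\<^esub> n f" using f unfolding UP_carrier_iff by blast
    have "bound \<zero>\<^bsub>K x\<^esub> n ?f"
      using n x by (auto simp: bound_def restricted_product_def)
    then have fx: "?f \<in> carrier (UP (K x))" using fi R_mem[OF _ x] unfolding UP_carrier_iff by blast
    have cf: "up_ring.coeff (UP R) f i = f i" for i by (rule UP_coeff[OF f])
    have cfx: "up_ring.coeff (UP (K x)) ?f i = f i x" for i by (rule UP_coeff[OF fx])
    \<comment> \<open>A common degree bound is taken, since passing to the component at
      \<open>x\<close> may lower the degree.\<close>
    define m where "m = max (deg R f) (deg (K x) ?f)"
    have "H (kum.I +>\<^bsub>UP R\<^esub> f) = H (\<Oplus>\<^bsub>kum.S\<^esub>i\<in>{..m}. kum.emb (f i) \<otimes>\<^bsub>kum.S\<^esub> kum.T [^]\<^bsub>kum.S\<^esub> i)"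
      using kum.quot_expand[OF f, of m] by (simp add: m_def cf)
    also have "\<dots> = (\<Oplus>\<^bsub>Sx x\<^esub>i\<in>{..m}. embx x (f i x) \<otimes>\<^bsub>Sx x\<^esub> Tx x [^]\<^bsub>Sx x\<^esub> i)"
      using fi R_mem[OF _ x] by (subst H.hom_finsum) (auto simp: comp_def Hemb HT intro!: k.S.finsum_cong')
    also have "\<dots> = k.I +>\<^bsub>UP (K x)\<^esub> ?f"
      using k.quot_expand[OF fx, of m] by (simp add: m_def cfx)
    finally show ?thesis by simp
  qed
  obtain f where f: "f \<in> carrier (UP R)" "s = kum.I +>\<^bsub>UP R\<^esub> f" using s unfolding kum.carrier_S by auto
  have "(\<lambda>f. k.I +>\<^bsub>UP (K x)\<^esub> (\<lambda>i. f i x)) f' = H s" if f': "f' \<in> s" for f'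
  proof -
    have "f' \<in> carrier (UP R)" using kum.I.a_elemrcos_carrier[OF f(1)] f' f(2) by simp
    moreover have "s = kum.I +>\<^bsub>UP R\<^esub> f'" using kum.I.a_repr_independence'[of f' f] f f' by simp
    ultimately show ?thesis using *[of f'] by simp
  qed
  moreover have "f \<in> s" using f kum.I.a_rcos_self by simp
  ultimately show ?thesis unfolding coeff_proj_def by (intro the_elem_image_unique) auto
qed

text \<open>The homomorphism that \<open>L_eq\<close> asks for comes from the universal
  property.\<close>

lemma L_props:
  assumes x: "x \<in> C"
  shows "L x \<in> ring_hom kum.S (Sx x)"
    and "\<And>\<alpha>. \<alpha> \<in> carrier R \<Longrightarrow> L x (kum.emb \<alpha>) = embx x (\<alpha> x)"
    and "L x kum.T = Tx x"
proof -
  interpret k: kummer "K x" "UP (K x)" p "t x" using kummer_K[OF x] by simp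
  have h: "(\<lambda>\<alpha>. embx x (\<alpha> x)) \<in> ring_hom R (Sx x)"
    using ring_hom_trans[OF R_eval_hom[OF x] k.emb_hom] by (simp add: comp_def)
  obtain H where H: "H \<in> ring_hom kum.S (Sx x)"
     "\<And>\<alpha>. \<alpha> \<in> carrier R \<Longrightarrow> H (kum.emb \<alpha>) = embx x (\<alpha> x)" "H kum.T = Tx x"
    by (rule kum.universal[OF k.S_cring h k.T_closed]) (use k.T_pow in auto)
  have e: "L x s = H s" if "s \<in> carrier kum.S" for s using L_eq[OF x H that] .
  show "L x \<in> ring_hom kum.S (Sx x)"
    by (rule ring_hom_cong[OF H(1) e kum.S.ring_axioms])
  show "L x (kum.emb \<alpha>) = embx x (\<alpha> x)" if "\<alpha> \<in> carrier R" for \<alpha> using e H(2) that by simp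
  show "L x kum.T = Tx x" using e H(3) by simp
qed

definition Z :: "'x \<Rightarrow> 'a set" where
  "Z x = {z \<in> carrier (K x). z [^]\<^bsub>K x\<^esub> p = t x}"

text \<open>Evaluation \<open>T \<mapsto> z\<close> at the point \<open>x\<close>. It is picked by
  choice because \<open>universal\<close> asserts existence only, and it is meaningful for
  \<open>z\<close> in \<open>Z x\<close>.\<close>

definition ev :: "'x \<Rightarrow> 'a \<Rightarrow> (nat \<Rightarrow> 'x \<Rightarrow> 'a) set \<Rightarrow> 'a" where
  "ev x z = (SOME H. H \<in> ring_hom kum.S (K x) \<and> (\<forall>\<alpha>\<in>carrier R. H (kum.emb \<alpha>) = \<alpha> x) \<and> H kum.T = z)"

lemma ev_props:
  assumes x: "x \<in> C" and z: "z \<in> Z x"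
  shows "ev x z \<in> ring_hom kum.S (K x)"
    and "\<And>\<alpha>. \<alpha> \<in> carrier R \<Longrightarrow> ev x z (kum.emb \<alpha>) = \<alpha> x"
    and "ev x z kum.T = z"
proof -
  obtain H where "H \<in> ring_hom kum.S (K x)" "\<And>\<alpha>. \<alpha> \<in> carrier R \<Longrightarrow> H (kum.emb \<alpha>) = \<alpha> x" "H kum.T = z"
    by (rule kum.universal[OF cring_K[OF x] R_eval_hom[OF x], of z]) (use z in \<open>auto simp: Z_def\<close>)
  then have "\<exists>H. H \<in> ring_hom kum.S (K x) \<and> (\<forall>\<alpha>\<in>carrier R. H (kum.emb \<alpha>) = \<alpha> x) \<and> H kum.T = z" by blast
  then have *: "ev x z \<in> ring_hom kum.S (K x) \<and> (\<forall>\<alpha>\<in>carrier R. ev x z (kum.emb \<alpha>) = \<alpha> x) \<and> ev x z kum.T = z"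
    unfolding ev_def by (rule someI_ex)
  from * show "ev x z \<in> ring_hom kum.S (K x)" "ev x z kum.T = z"
    "\<And>\<alpha>. \<alpha> \<in> carrier R \<Longrightarrow> ev x z (kum.emb \<alpha>) = \<alpha> x" by auto
qed

lemma card_Z: "x \<in> C - Rm \<Longrightarrow> card (Z x) = p"
  unfolding Z_def by (rule unram_roots)

lemma finite_Z: "x \<in> C - Rm \<Longrightarrow> finite (Z x)"
  using card_Z[of x] p_gt1 by (intro card_ge_0_finite) auto

lemma L_comb:
  assumes "x \<in> C" "a \<in> UNIV \<rightarrow> carrier R"
  shows "L x (kum.comb a) = kummer.comb (K x) p (t x) (\<lambda>i. a i x)"
proof -
  interpret k: kummer "K x" "UP (K x)" p "t x" using kummer_K assms by simp
  have a: "a i \<in> carrier R" "a i x \<in> carrier (K x)" for i using assms R_mem[of "a i" x] by (auto simp: Pi_iff)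
  show ?thesis unfolding k.comb_def
    using assms a by (subst kum.hom_comb[OF k.S_cring L_props(1)[OF assms(1)]])
       (auto simp: L_props Pi_iff intro!: k.S.finsum_cong')
qed

lemma ev_comb:
  assumes "x \<in> C" "z \<in> Z x" "a \<in> UNIV \<rightarrow> carrier R"
  shows "ev x z (kum.comb a) = (\<Oplus>\<^bsub>K x\<^esub>i\<in>{..<p}. a i x \<otimes>\<^bsub>K x\<^esub> z [^]\<^bsub>K x\<^esub> i)"
proof -
  interpret k: cring "K x" using cring_K assms by simp
  have a: "a i \<in> carrier R" "a i x \<in> carrier (K x)" for i using assms R_mem[of "a i" x] by (auto simp: Pi_iff)
  have "z \<in> carrier (K x)" using assms(2) by (simp add: Z_def)
  then show ?thesis
    using assms a by (subst kum.hom_comb[OF k.is_cring ev_props(1)[OF assms(1,2)]])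
       (auto simp: ev_props Pi_iff intro!: k.finsum_cong')
qed

text \<open>At an unramified point the values at \<open>p\<close> distinct roots determine the
  \<open>p\<close> coefficients of the normal form; at a ramified point the coefficients are
  independent in the local algebra.\<close>

lemma S_zeroI:
  assumes s: "s \<in> carrier kum.S"
    and 1: "\<And>x. x \<in> Rm \<Longrightarrow> L x s = \<zero>\<^bsub>Sx x\<^esub>"
    and 2: "\<And>x z. x \<in> C - Rm \<Longrightarrow> z \<in> Z x \<Longrightarrow> ev x z s = \<zero>\<^bsub>K x\<^esub>"
  shows "s = \<zero>\<^bsub>kum.S\<^esub>"
proof -
  obtain a where a: "a \<in> UNIV \<rightarrow> carrier R" "s = kum.comb a" using kum.span[OF s] .
  have ac: "a i \<in> carrier R" for i using a(1) by auto
  have "a i x = \<zero>\<^bsub>K x\<^esub>" if x: "x \<in> C" and i: "i < p" for x i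
  proof (cases "x \<in> Rm")
    case True
    interpret k: kummer "K x" "UP (K x)" p "t x" using kummer_K[OF x] by simp
    have "k.comb (\<lambda>i. a i x) = \<zero>\<^bsub>Sx x\<^esub>" using 1[OF True] L_comb[OF x a(1)] a(2) by simp
    then show ?thesis using k.indep[of "\<lambda>i. a i x" i] i R_mem[OF ac x] by auto
  next
    case False
    interpret k: field "K x" by (rule field_K[OF x])
    have x': "x \<in> C - Rm" using x False by simp
    show ?thesis
    proof (rule k.coeffs_zero_of_roots[of p "\<lambda>i. a i x" "Z x"])
      show "finite (Z x)" "p \<le> card (Z x)" using finite_Z[OF x'] card_Z[OF x'] by auto
      show "Z x \<subseteq> carrier (K x)" by (auto simp: Z_def)
      show "(\<Oplus>\<^bsub>K x\<^esub>i\<in>{..<p}. a i x \<otimes>\<^bsub>K x\<^esub> z [^]\<^bsub>K x\<^esub> i) = \<zero>\<^bsub>K x\<^esub>" if "z \<in> Z x" for z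
        using 2[OF x' that] ev_comb[OF x that a(1)] a(2) by simp
    qed (use i R_mem[OF ac x] in auto)
  qed
  then have "a i = \<zero>\<^bsub>R\<^esub>" if "i < p" for i
    using that by (intro R_ext ac kum.R.zero_closed) (auto simp: restricted_product_def)
  then have "kum.comb a = (\<Oplus>\<^bsub>kum.S\<^esub>i\<in>{..<p}. \<zero>\<^bsub>kum.S\<^esub>)" unfolding kum.comb_def
    by (intro kum.S.finsum_cong') auto
  then show ?thesis using a(2) by simp
qed

lemma S_eqI:
  assumes s: "s \<in> carrier kum.S" "s' \<in> carrier kum.S"
    and 1: "\<And>x. x \<in> Rm \<Longrightarrow> L x s = L x s'"
    and 2: "\<And>x z. x \<in> C - Rm \<Longrightarrow> z \<in> Z x \<Longrightarrow> ev x z s = ev x z s'"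
  shows "s = s'"
proof -
  have "s \<ominus>\<^bsub>kum.S\<^esub> s' = \<zero>\<^bsub>kum.S\<^esub>"
  proof (rule S_zeroI)
    show "L x (s \<ominus>\<^bsub>kum.S\<^esub> s') = \<zero>\<^bsub>Sx x\<^esub>" if x: "x \<in> Rm" for x
    proof -
      have xC: "x \<in> C" using x Rm_sub by auto
      interpret k: kummer "K x" "UP (K x)" p "t x" using kummer_K[OF xC] by simp
      interpret H: ring_hom_cring kum.S "Sx x" "L x" by unfold_locales (rule L_props(1)[OF xC])
      show ?thesis using s 1[OF x] by (simp add: a_minus_def k.S.r_neg)
    qed
    show "ev x z (s \<ominus>\<^bsub>kum.S\<^esub> s') = \<zero>\<^bsub>K x\<^esub>" if x: "x \<in> C - Rm" and z: "z \<in> Z x" for x z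
    proof -
      have xC: "x \<in> C" using x by auto
      interpret k: cring "K x" by (rule cring_K[OF xC])
      interpret H: ring_hom_cring kum.S "K x" "ev x z" by unfold_locales (rule ev_props(1)[OF xC z])
      show ?thesis using s 2[OF x z] by (simp add: a_minus_def k.r_neg)
    qed
  qed (use s in simp)
  then show ?thesis using s by simp
qed

end

text \<open>For \<open>p > 1\<close> the elements 1 and \<open>T\<close> are independent. With
  \<open>a\<close> an idempotent adele this shows that \<open>a T\<close> is not a constant.\<close>

lemma (in kummer) emb_T_eq_emb:
  assumes "1 < p" "a \<in> carrier R" "b \<in> carrier R" "emb a \<otimes>\<^bsub>S\<^esub> T = emb b"
  shows "a = \<zero>"
proof -
  let ?c = "\<lambda>i::nat. if i = 0 then \<ominus> b else if i = 1 then a else \<zero>"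
  have d: "{..<p} = insert 0 (insert 1 {2..<p})" using assms(1) by auto
  have z: "(\<Oplus>\<^bsub>S\<^esub>i\<in>{2..<p}. emb (?c i) \<otimes>\<^bsub>S\<^esub> T [^]\<^bsub>S\<^esub> i) = (\<Oplus>\<^bsub>S\<^esub>i\<in>{2..<p}. \<zero>\<^bsub>S\<^esub>)"
    by (intro S.finsum_cong') auto
  have "comb ?c = emb (\<ominus> b) \<oplus>\<^bsub>S\<^esub> (emb a \<otimes>\<^bsub>S\<^esub> T)"
    unfolding comb_def d using assms(2,3) z
    by (subst S.finsum_insert; (subst S.finsum_insert)?) (auto simp: Pi_iff)
  also have "\<dots> = \<zero>\<^bsub>S\<^esub>" unfolding assms(4) using assms(3) by (simp add: S.l_neg)
  finally have "?c 1 = \<zero>" using assms by (intro indep[of ?c]) auto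
  then show ?thesis by simp
qed

section \<open>Local components of adelic automorphisms\<close>

context adelic_kummer
begin

abbreviation "A \<equiv> alg_aut_group R kum.S kum.emb"

lemma A_group: "group A"
  by (rule alg_aut_group_group) (auto intro: kum.S.ring_axioms)

sublocale A: group A by (rule A_group)

lemma A_props:
  assumes "f \<in> carrier A"
  shows "f \<in> ring_hom kum.S kum.S" "\<And>\<alpha>. \<alpha> \<in> carrier R \<Longrightarrow> f (kum.emb \<alpha>) = kum.emb \<alpha>"
    "\<And>s. s \<in> carrier kum.S \<Longrightarrow> f s \<in> carrier kum.S"
proof -
  show 1: "f \<in> ring_hom kum.S kum.S" using assms by (simp add: alg_aut_group_carrier)
  show "f s \<in> carrier kum.S" if "s \<in> carrier kum.S" for s using ring_hom_closed[OF 1 that] .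
  show "f (kum.emb \<alpha>) = kum.emb \<alpha>" if "\<alpha> \<in> carrier R" for \<alpha>
    using assms that by (simp add: alg_aut_group_carrier)
qed

lemma A_mult: "f \<in> carrier A \<Longrightarrow> h \<in> carrier A \<Longrightarrow> s \<in> carrier kum.S \<Longrightarrow> (f \<otimes>\<^bsub>A\<^esub> h) s = f (h s)"
  by (simp add: alg_aut_group_mult compose_eq)

lemma A_one: "s \<in> carrier kum.S \<Longrightarrow> \<one>\<^bsub>A\<^esub> s = s"
  by (simp add: alg_aut_group_one)

lemma A_eqI:
  assumes "f \<in> carrier A" "h \<in> carrier A" "f kum.T = h kum.T"
  shows "f = h"
proof (rule extensionalityI[where A="carrier kum.S"])
  show "f s = h s" if "s \<in> carrier kum.S" for s
    using kum.hom_unique[OF kum.S_cring A_props(1)[OF assms(1)] A_props(1)[OF assms(2)] _ assms(3) that]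
    by (simp add: A_props(2) assms)
qed (use assms in \<open>auto simp: alg_aut_group_carrier\<close>)

lemma L_zeroI:
  assumes s: "s \<in> carrier kum.S" and 1: "\<And>x. x \<in> C \<Longrightarrow> L x s = \<zero>\<^bsub>Sx x\<^esub>"
  shows "s = \<zero>\<^bsub>kum.S\<^esub>"
proof -
  obtain a where a: "a \<in> UNIV \<rightarrow> carrier R" "s = kum.comb a" using kum.span[OF s] .
  have ac: "a i \<in> carrier R" for i using a(1) by auto
  have "a i x = \<zero>\<^bsub>K x\<^esub>" if x: "x \<in> C" and i: "i < p" for x i
  proof -
    interpret k: kummer "K x" "UP (K x)" p "t x" using kummer_K[OF x] by simp
    have "k.comb (\<lambda>i. a i x) = \<zero>\<^bsub>Sx x\<^esub>" using 1[OF x] L_comb[OF x a(1)] a(2) by simp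
    then show ?thesis using k.indep[of "\<lambda>i. a i x" i] i R_mem[OF ac x] by auto
  qed
  then have "a i = \<zero>\<^bsub>R\<^esub>" if "i < p" for i
    using that by (intro R_ext ac kum.R.zero_closed) (auto simp: restricted_product_def)
  then have "kum.comb a = (\<Oplus>\<^bsub>kum.S\<^esub>i\<in>{..<p}. \<zero>\<^bsub>kum.S\<^esub>)" unfolding kum.comb_def
    by (intro kum.S.finsum_cong') auto
  then show ?thesis using a(2) by simp
qed

text \<open>For \<open>a = 1\<close> this is the idempotent that isolates \<open>x\<close>; for
  other \<open>a\<close> it lifts a local constant to an adele, which automorphisms fix.\<close>

definition point_adele :: "'x \<Rightarrow> 'a \<Rightarrow> 'x \<Rightarrow> 'a" where
  "point_adele x a = (\<lambda>y\<in>C. if y = x then a else \<zero>\<^bsub>K y\<^esub>)"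

lemma point_adele_closed: "x \<in> C \<Longrightarrow> a \<in> carrier (K x) \<Longrightarrow> point_adele x a \<in> carrier R"
  unfolding point_adele_def
  by (rule restricted_product_carrierI[of _ _ _ "{x}"])
     (auto simp: cring.cring_simprules(2)[OF cring_K] subringE(2)[OF subring_O])

lemma point_adele_eval: "y \<in> C \<Longrightarrow> point_adele x a y = (if y = x then a else \<zero>\<^bsub>K y\<^esub>)"
  by (simp add: point_adele_def)

lemma L_surj:
  assumes x: "x \<in> C" and u: "u \<in> carrier (Sx x)"
  obtains s where "s \<in> carrier kum.S" "L x s = u"
proof -
  interpret k: kummer "K x" "UP (K x)" p "t x" using kummer_K[OF x] by simp
  obtain a where a: "a \<in> UNIV \<rightarrow> carrier (K x)" "u = k.comb a" using k.span[OF u] .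
  let ?a = "\<lambda>i. point_adele x (a i)"
  have c: "?a \<in> UNIV \<rightarrow> carrier R" using a point_adele_closed[OF x] by auto
  have "L x (kum.comb ?a) = u" using L_comb[OF x c] a(2) x by (simp add: point_adele_eval)
  then show ?thesis using that[of "kum.comb ?a"] c kum.comb_closed[of ?a] by (simp add: Pi_iff)
qed

text \<open>The kernel of \<open>L x\<close> is the annihilator of the idempotent at
  \<open>x\<close>. An automorphism fixes this idempotent and therefore preserves the
  kernel.\<close>

lemma L_compat:
  assumes f: "f \<in> carrier A" and x: "x \<in> C" and s: "s \<in> carrier kum.S" "s' \<in> carrier kum.S"
    and eq: "L x s = L x s'"
  shows "L x (f s) = L x (f s')"
proof -
  interpret F: ring_hom_cring kum.S kum.S f by unfold_locales (rule A_props(1)[OF f])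
  define d where "d = s \<ominus>\<^bsub>kum.S\<^esub> s'"
  have d: "d \<in> carrier kum.S" using s by (simp add: d_def)
  let ?e = "point_adele x \<one>\<^bsub>K x\<^esub>"
  have e: "?e \<in> carrier R" using x cring_K[OF x] by (intro point_adele_closed) (auto simp: cring.cring_simprules)
  \<comment> \<open>The difference \<open>d\<close> vanishes at \<open>x\<close>, the idempotent
    vanishes everywhere else.\<close>
  have "kum.emb ?e \<otimes>\<^bsub>kum.S\<^esub> d = \<zero>\<^bsub>kum.S\<^esub>"
  proof (rule L_zeroI)
    fix y assume y: "y \<in> C"
    interpret k: kummer "K y" "UP (K y)" p "t y" using kummer_K[OF y] by simp
    interpret H: ring_hom_cring kum.S "Sx y" "L y" by unfold_locales (rule L_props(1)[OF y])
    show "L y (kum.emb ?e \<otimes>\<^bsub>kum.S\<^esub> d) = \<zero>\<^bsub>Sx y\<^esub>"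
    proof (cases "y = x")
      case True
      have "L y s = L y s'" using eq True by simp
      then have "L y d = \<zero>\<^bsub>Sx y\<^esub>" unfolding d_def using s by (simp add: a_minus_def k.S.r_neg)
      then show ?thesis using d e by simp
    next
      case False
      then show ?thesis using d e y by (simp add: L_props(2) point_adele_eval)
    qed
  qed (use d e in simp)
  then have "f (kum.emb ?e \<otimes>\<^bsub>kum.S\<^esub> d) = \<zero>\<^bsub>kum.S\<^esub>" by simp
  then have z: "kum.emb ?e \<otimes>\<^bsub>kum.S\<^esub> f d = \<zero>\<^bsub>kum.S\<^esub>" using d e A_props(2)[OF f] by simp
  interpret k: kummer "K x" "UP (K x)" p "t x" using kummer_K[OF x] by simp
  interpret H: ring_hom_cring kum.S "Sx x" "L x" by unfold_locales (rule L_props(1)[OF x])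
  have "L x (kum.emb ?e \<otimes>\<^bsub>kum.S\<^esub> f d) = \<zero>\<^bsub>Sx x\<^esub>" unfolding z by simp
  then have "L x (f d) = \<zero>\<^bsub>Sx x\<^esub>" using d e x by (simp add: L_props(2) point_adele_eval)
  then have "L x (f s) \<ominus>\<^bsub>Sx x\<^esub> L x (f s') = \<zero>\<^bsub>Sx x\<^esub>" using s by (simp add: d_def a_minus_def)
  then show ?thesis using s by simp
qed

abbreviation "Ax x \<equiv> kummer_aut_group (K x) p (t x)"

text \<open>The same description as in \<open>aut_component\<close>, so that the two can be
  identified by unfolding.\<close>

definition component :: "'x \<Rightarrow> ((nat \<Rightarrow> 'x \<Rightarrow> 'a) set \<Rightarrow> (nat \<Rightarrow> 'x \<Rightarrow> 'a) set) \<Rightarrow> (nat \<Rightarrow> 'a) set \<Rightarrow> (nat \<Rightarrow> 'a) set" where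
  "component x f = (THE h. h \<in> carrier (Ax x) \<and> (\<forall>s\<in>carrier kum.S. L x (f s) = h (L x s)))"

text \<open>By \<open>L_compat\<close> the automorphism respects the fibres of the surjection
  \<open>L x\<close>, so it descends. The induced map is cut off outside the carrier, as elements of
  the group of bijections are.\<close>

lemma induced_hom:
  assumes f: "f \<in> carrier A" and x: "x \<in> C"
  obtains h where "h \<in> ring_hom (Sx x) (Sx x)" "\<And>s. s \<in> carrier kum.S \<Longrightarrow> L x (f s) = h (L x s)"
    "\<And>a. a \<in> carrier (K x) \<Longrightarrow> h (embx x a) = embx x a" "h \<in> extensional (carrier (Sx x))"
proof -
  interpret k: kummer "K x" "UP (K x)" p "t x" using kummer_K[OF x] by simp
  interpret H: ring_hom_cring kum.S "Sx x" "L x" by unfold_locales (rule L_props(1)[OF x])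
  interpret F: ring_hom_cring kum.S kum.S f by unfold_locales (rule A_props(1)[OF f])
  define h where "h = (\<lambda>u\<in>carrier (Sx x). L x (f (SOME s. s \<in> carrier kum.S \<and> L x s = u)))"
  have h: "h (L x s) = L x (f s)" if s: "s \<in> carrier kum.S" for s
  proof -
    let ?Q = "\<lambda>s'. s' \<in> carrier kum.S \<and> L x s' = L x s"
    have *: "?Q (SOME s'. ?Q s')" by (rule someI[of ?Q s]) (simp add: s)
    show ?thesis unfolding h_def using L_compat[OF f x conjunct1[OF *] s conjunct2[OF *]] s by simp
  qed
  have "h \<in> ring_hom (Sx x) (Sx x)"
  proof (rule ring_hom_memI)
    fix u assume "u \<in> carrier (Sx x)"
    then obtain s where s: "s \<in> carrier kum.S" "L x s = u" using L_surj[OF x] by blast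
    show "h u \<in> carrier (Sx x)" using h[OF s(1)] s by simp
  next
    fix u v assume u: "u \<in> carrier (Sx x)" and v: "v \<in> carrier (Sx x)"
    obtain s where s: "s \<in> carrier kum.S" "L x s = u" using L_surj[OF x u] .
    obtain r where r: "r \<in> carrier kum.S" "L x r = v" using L_surj[OF x v] .
    show "h (u \<otimes>\<^bsub>Sx x\<^esub> v) = h u \<otimes>\<^bsub>Sx x\<^esub> h v"
      using h[of "s \<otimes>\<^bsub>kum.S\<^esub> r"] h[OF s(1)] h[OF r(1)] s r by simp
    show "h (u \<oplus>\<^bsub>Sx x\<^esub> v) = h u \<oplus>\<^bsub>Sx x\<^esub> h v"
      using h[of "s \<oplus>\<^bsub>kum.S\<^esub> r"] h[OF s(1)] h[OF r(1)] s r by simp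
  next
    show "h \<one>\<^bsub>Sx x\<^esub> = \<one>\<^bsub>Sx x\<^esub>" using h[OF kum.S.one_closed] by simp
  qed
  moreover have "h (embx x a) = embx x a" if a: "a \<in> carrier (K x)" for a
    using h[of "kum.emb (point_adele x a)"] point_adele_closed[OF x a] A_props(2)[OF f] x by (simp add: L_props(2) point_adele_eval)
  moreover have "h \<in> extensional (carrier (Sx x))" by (simp add: h_def)
  ultimately show ?thesis using that h by auto
qed

text \<open>The map induced by the inverse of \<open>f\<close> is inverse to the one induced by
  \<open>f\<close>, which gives an automorphism; uniqueness follows from the surjectivity of
  \<open>L x\<close>.\<close>

lemma component:
  assumes f: "f \<in> carrier A" and x: "x \<in> C"
  shows "component x f \<in> carrier (Ax x)"
    "\<And>s. s \<in> carrier kum.S \<Longrightarrow> L x (f s) = component x f (L x s)"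
proof -
  obtain h where h: "h \<in> ring_hom (Sx x) (Sx x)" "\<And>s. s \<in> carrier kum.S \<Longrightarrow> L x (f s) = h (L x s)"
    "\<And>a. a \<in> carrier (K x) \<Longrightarrow> h (embx x a) = embx x a" "h \<in> extensional (carrier (Sx x))"
    using induced_hom[OF f x] by blast
  have fi: "inv\<^bsub>A\<^esub> f \<in> carrier A" using f by simp
  obtain k where k: "k \<in> ring_hom (Sx x) (Sx x)" "\<And>s. s \<in> carrier kum.S \<Longrightarrow> L x ((inv\<^bsub>A\<^esub> f) s) = k (L x s)"
    using induced_hom[OF fi x] by metis
  have ff: "f ((inv\<^bsub>A\<^esub> f) s) = s" "(inv\<^bsub>A\<^esub> f) (f s) = s" if "s \<in> carrier kum.S" for s
    using A_mult[OF f fi that] A_mult[OF fi f that] A_one[OF that] f by auto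
  have hk: "h (k u) = u \<and> k (h u) = u" if u: "u \<in> carrier (Sx x)" for u
  proof -
    obtain s where s: "s \<in> carrier kum.S" "L x s = u" using L_surj[OF x u] .
    have fs: "f s \<in> carrier kum.S" "(inv\<^bsub>A\<^esub> f) s \<in> carrier kum.S" using A_props(3)[OF f s(1)] A_props(3)[OF fi s(1)] .
    show ?thesis using h(2)[OF s(1)] k(2)[OF s(1)] h(2)[OF fs(2)] k(2)[OF fs(1)] ff[OF s(1)] s(2) by simp
  qed
  have "bij_betw h (carrier (Sx x)) (carrier (Sx x))"
    by (rule bij_betwI[of _ _ _ k]) (use hk ring_hom_closed[OF h(1)] ring_hom_closed[OF k(1)] in auto)
  then have hA: "h \<in> carrier (Ax x)" using h by (simp add: kummer_aut_group_def alg_aut_group_carrier)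
  have "component x f = h" unfolding component_def
  proof (rule the_equality)
    show "h \<in> carrier (Ax x) \<and> (\<forall>s\<in>carrier kum.S. L x (f s) = h (L x s))" using hA h by auto
    fix h' assume h': "h' \<in> carrier (Ax x) \<and> (\<forall>s\<in>carrier kum.S. L x (f s) = h' (L x s))"
    show "h' = h"
    proof (rule extensionalityI[where A="carrier (Sx x)"])
      fix u assume "u \<in> carrier (Sx x)"
      then obtain s where s: "s \<in> carrier kum.S" "L x s = u" using L_surj[OF x] by blast
      show "h' u = h u" using h' h(2)[OF s(1)] s by auto
    qed (use h' h in \<open>auto simp: kummer_aut_group_def alg_aut_group_carrier\<close>)
  qed
  then show "component x f \<in> carrier (Ax x)" "\<And>s. s \<in> carrier kum.S \<Longrightarrow> L x (f s) = component x f (L x s)"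
    using hA h by auto
qed

lemma component_eq_iff:
  assumes f: "f \<in> carrier A" "h \<in> carrier A" and x: "x \<in> C"
  shows "component x f = component x h \<longleftrightarrow> (\<forall>s\<in>carrier kum.S. L x (f s) = L x (h s))"
proof
  assume "component x f = component x h"
  then show "\<forall>s\<in>carrier kum.S. L x (f s) = L x (h s)" using component[OF f(1) x] component[OF f(2) x] by simp
next
  assume *: "\<forall>s\<in>carrier kum.S. L x (f s) = L x (h s)"
  show "component x f = component x h"
    unfolding component_def using * by (intro arg_cong[where f=The] ext) auto
qed

text \<open>The quotient of the image of \<open>T\<close> by \<open>T\<close> is a
  \<open>p\<close>-th root of unity in a domain. The \<open>p\<close> roots of unity of
  \<open>K x\<close> already exhaust the possibilities, so the quotient is a constant.\<close>

lemma ramified_root: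
  assumes f: "f \<in> carrier A" and x: "x \<in> Rm"
  obtains w where "w \<in> carrier (K x)" "L x (f kum.T) = embx x w \<otimes>\<^bsub>Sx x\<^esub> Tx x"
proof -
  have xC: "x \<in> C" using x Rm_sub by auto
  interpret k: kummer "K x" "UP (K x)" p "t x" using kummer_K[OF xC] by simp
  interpret K: field "K x" by (rule field_K[OF xC])
  interpret D: domain "Sx x" by (rule ram_domain[OF x])
  interpret H: ring_hom_cring kum.S "Sx x" "L x" by unfold_locales (rule L_props(1)[OF xC])
  interpret F: ring_hom_cring kum.S kum.S f by unfold_locales (rule A_props(1)[OF f])
  obtain t' where t': "t' \<in> carrier R" "t \<otimes>\<^bsub>R\<^esub> t' = \<one>\<^bsub>R\<^esub>" using t_unit unfolding Units_def by auto
  have t'x: "t' x \<in> carrier (K x)" "t x \<otimes>\<^bsub>K x\<^esub> t' x = \<one>\<^bsub>K x\<^esub>"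
    using R_mem[OF t'(1) xC] fun_cong[OF t'(2), of x] xC by (auto simp: restricted_product_def)
  define u where "u = L x (f kum.T)"
  \<comment> \<open>The inverse of \<open>T\<close>: the relation \<open>T^p = t_x\<close> with
    \<open>t_x\<close> invertible makes \<open>T\<close> a unit.\<close>
  define Ti where "Ti = embx x (t' x) \<otimes>\<^bsub>Sx x\<^esub> Tx x [^]\<^bsub>Sx x\<^esub> (p - 1)"
  have Tic: "Ti \<in> carrier (Sx x)" and uc: "u \<in> carrier (Sx x)" using t'x unfolding Ti_def u_def by auto
  have TTi: "Ti \<otimes>\<^bsub>Sx x\<^esub> Tx x = \<one>\<^bsub>Sx x\<^esub>"
  proof -
    have "Ti \<otimes>\<^bsub>Sx x\<^esub> Tx x = embx x (t' x) \<otimes>\<^bsub>Sx x\<^esub> (Tx x [^]\<^bsub>Sx x\<^esub> Suc (p - 1))"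
      unfolding Ti_def using t'x by (simp add: k.S.m_assoc)
    also have "\<dots> = embx x (t' x) \<otimes>\<^bsub>Sx x\<^esub> embx x (t x)" using p_gt1 k.T_pow by simp
    also have "\<dots> = embx x (t x \<otimes>\<^bsub>K x\<^esub> t' x)" using t'x(1) by (simp add: k.S.m_comm)
    finally show ?thesis unfolding t'x(2) by simp
  qed
  have up: "u [^]\<^bsub>Sx x\<^esub> p = Tx x [^]\<^bsub>Sx x\<^esub> p"
  proof -
    have "u [^]\<^bsub>Sx x\<^esub> p = L x (f (kum.T [^]\<^bsub>kum.S\<^esub> p))" by (simp add: u_def)
    also have "\<dots> = embx x (t x)" unfolding kum.T_pow using A_props(2)[OF f] L_props(2)[OF xC] by simp
    finally show ?thesis using k.T_pow by simp
  qed
  have v1: "(u \<otimes>\<^bsub>Sx x\<^esub> Ti) [^]\<^bsub>Sx x\<^esub> p = \<one>\<^bsub>Sx x\<^esub>"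
  proof -
    have "(u \<otimes>\<^bsub>Sx x\<^esub> Ti) [^]\<^bsub>Sx x\<^esub> p = (Tx x \<otimes>\<^bsub>Sx x\<^esub> Ti) [^]\<^bsub>Sx x\<^esub> p"
      using uc Tic by (simp add: k.S.nat_pow_distrib up)
    also have "Tx x \<otimes>\<^bsub>Sx x\<^esub> Ti = \<one>\<^bsub>Sx x\<^esub>" using TTi Tic by (simp add: k.S.m_comm)
    finally show ?thesis by simp
  qed
  let ?W = "{w \<in> carrier (K x). w [^]\<^bsub>K x\<^esub> p = \<one>\<^bsub>K x\<^esub>}"
  have Wfin: "finite ?W" using ram_roots[OF x] p_gt1 by (intro card_ge_0_finite) simp
  have inj: "inj_on (embx x) ?W"
  proof (rule inj_onI)
    fix a b assume ab: "a \<in> ?W" "b \<in> ?W" "embx x a = embx x b"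
    then have "embx x (a \<ominus>\<^bsub>K x\<^esub> b) = \<zero>\<^bsub>Sx x\<^esub>" by (simp add: a_minus_def k.S.r_neg)
    then show "a = b" using k.emb_inj[of "a \<ominus>\<^bsub>K x\<^esub> b"] ab by simp
  qed
  have We: "embx x a \<in> carrier (Sx x) \<and> embx x a [^]\<^bsub>Sx x\<^esub> p = \<one>\<^bsub>Sx x\<^esub>" if "a \<in> ?W" for a
  proof -
    have "embx x a [^]\<^bsub>Sx x\<^esub> p = embx x (a [^]\<^bsub>K x\<^esub> p)"
      by (rule k.emb.hom_pow[symmetric]) (use that in simp)
    also have "a [^]\<^bsub>K x\<^esub> p = \<one>\<^bsub>K x\<^esub>" using that by simp
    finally show ?thesis using that by simp
  qed
  have "u \<otimes>\<^bsub>Sx x\<^esub> Ti \<in> embx x ` ?W"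
  proof (rule ccontr)
    assume n: "u \<otimes>\<^bsub>Sx x\<^esub> Ti \<notin> embx x ` ?W"
    \<comment> \<open>One more root of unity would exceed the bound \<open>p\<close> that holds in
      the domain \<open>Sx x\<close>.\<close>
    have "card (insert (u \<otimes>\<^bsub>Sx x\<^esub> Ti) (embx x ` ?W)) \<le> p"
    proof (rule D.roots_of_unity_card_le)
      fix w assume "w \<in> insert (u \<otimes>\<^bsub>Sx x\<^esub> Ti) (embx x ` ?W)"
      then show "w \<in> carrier (Sx x) \<and> w [^]\<^bsub>Sx x\<^esub> p = \<one>\<^bsub>Sx x\<^esub>"
        using We v1 k.S.m_closed[OF uc Tic] by (elim insertE imageE) simp_all
    qed (use Wfin p_gt1 in auto)
    then show False using n Wfin inj ram_roots[OF x] by (simp add: card_image)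
  qed
  then obtain w where w: "w \<in> carrier (K x)" "u \<otimes>\<^bsub>Sx x\<^esub> Ti = embx x w" by auto
  have "u = embx x w \<otimes>\<^bsub>Sx x\<^esub> Tx x"
    unfolding w(2)[symmetric] using uc Tic TTi by (simp add: k.S.m_assoc)
  then show ?thesis using that w unfolding u_def by blast
qed

text \<open>Both automorphisms multiply \<open>T\<close> by a constant and fix constants, so in
  either order \<open>T\<close> is multiplied by the product of the two.\<close>

lemma ramified_commute:
  assumes f: "f \<in> carrier A" "h \<in> carrier A" and x: "x \<in> Rm" and s: "s \<in> carrier kum.S"
  shows "L x (f (h s)) = L x (h (f s))"
proof -
  have xC: "x \<in> C" using x Rm_sub by auto
  interpret k: kummer "K x" "UP (K x)" p "t x" using kummer_K[OF xC] by simp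
  have hom: "(\<lambda>s. L x (f (h s))) \<in> ring_hom kum.S (Sx x)" if "f \<in> carrier A" "h \<in> carrier A" for f h
    using ring_hom_trans[OF ring_hom_trans[OF A_props(1)[OF that(2)] A_props(1)[OF that(1)]] L_props(1)[OF xC]]
    by (simp add: comp_def)
  have key: "L x (f (h kum.T)) = embx x w \<otimes>\<^bsub>Sx x\<^esub> (embx x v \<otimes>\<^bsub>Sx x\<^esub> Tx x)"
    if f: "f \<in> carrier A" "h \<in> carrier A" and v: "v \<in> carrier (K x)" "L x (f kum.T) = embx x v \<otimes>\<^bsub>Sx x\<^esub> Tx x"
     and w: "w \<in> carrier (K x)" "L x (h kum.T) = embx x w \<otimes>\<^bsub>Sx x\<^esub> Tx x" for f h v w
  proof -
    interpret H: ring_hom_cring kum.S "Sx x" "L x" by unfold_locales (rule L_props(1)[OF xC])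
    interpret F: ring_hom_cring kum.S kum.S f by unfold_locales (rule A_props(1)[OF f(1)])
    \<comment> \<open>A substitute for the image of \<open>T\<close> under \<open>h\<close>: it
      agrees with it at \<open>x\<close>, and its coefficient is an adelic constant, fixed by
      \<open>f\<close>.\<close>
    let ?s = "kum.emb (point_adele x w) \<otimes>\<^bsub>kum.S\<^esub> kum.T"
    have a: "point_adele x w \<in> carrier R" by (rule point_adele_closed[OF xC w(1)])
    have "L x (h kum.T) = L x ?s" using a xC w by (simp add: L_props point_adele_eval)
    then have "L x (f (h kum.T)) = L x (f ?s)" using a f by (intro L_compat[OF f(1) xC]) (auto intro: A_props(3))
    also have "\<dots> = embx x w \<otimes>\<^bsub>Sx x\<^esub> L x (f kum.T)" using a xC A_props(2)[OF f(1)] by (simp add: L_props point_adele_eval)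
    finally show ?thesis using v by simp
  qed
  obtain v w where vw: "v \<in> carrier (K x)" "L x (f kum.T) = embx x v \<otimes>\<^bsub>Sx x\<^esub> Tx x"
    "w \<in> carrier (K x)" "L x (h kum.T) = embx x w \<otimes>\<^bsub>Sx x\<^esub> Tx x"
    using ramified_root[OF f(1) x] ramified_root[OF f(2) x] by metis
  show ?thesis
  proof (rule kum.hom_unique[OF k.S_cring hom[OF f] hom[OF f(2,1)] _ _ s])
    show "L x (f (h kum.T)) = L x (h (f kum.T))"
      unfolding key[OF f vw] key[OF f(2,1) vw(3,4,1,2)] using vw by (simp add: k.S.m_lcomm)
  qed (simp add: A_props(2) f)
qed

end

section \<open>Groups of prime order and finite sums\<close>

lemma (in group) prime_subgroup_powers:
  assumes H: "subgroup H G" "card H = p" "Factorial_Ring.prime p" and g: "g \<in> H" "g \<noteq> \<one>"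
  shows "g [^] p = \<one>" "H = (\<lambda>i. g [^] i) ` {..<p}"
proof -
  let ?H = "G\<lparr>carrier := H\<rparr>"
  interpret H: group ?H by (rule subgroup.subgroup_is_group[OF H(1) is_group])
  have o: "Coset.order ?H = p" using H(2) by (simp add: Coset.order_def)
  have pw: "g [^]\<^bsub>?H\<^esub> i = g [^] i" for i :: nat using nat_pow_consistent by simp
  show "g [^] p = \<one>" using H.pow_order_eq_1[of g] g o pw by simp
  have "H.ord g dvd p" using H.ord_dvd_group_order[of g] g o by simp
  moreover have "H.ord g \<noteq> 1" using H.ord_eq_1[of g] g by simp
  ultimately have og: "H.ord g = p" using H(3) by (auto simp: prime_nat_iff)
  have p0: "0 < p" using H(3) by (rule prime_gt_0_nat)
  have e: "{0..p - 1} = {..<p}" using p0 by auto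
  have inj: "inj_on (\<lambda>i. g [^] i) {..<p}" using H.ord_inj[of g] g unfolding og e pw by simp
  have "g [^] i \<in> H" for i :: nat using H.nat_pow_closed[of g i] g pw by simp
  then have "(\<lambda>i. g [^] i) ` {..<p} = H"
    using inj H(2) p0 by (intro card_subset_eq) (auto simp: card_image intro: card_ge_0_finite)
  then show "H = (\<lambda>i. g [^] i) ` {..<p}" by simp
qed

text \<open>Conjugating one generator to the other is enough: conjugation by \<open>\<phi>\<close>
  then carries each power of \<open>g\<close> to the same power of \<open>h\<close>, and both groups
  use the same exponents.\<close>

lemma (in group) conjugation_iso:
  assumes G12: "subgroup G1 G" "subgroup G2 G" and c: "\<phi> \<in> carrier G" "g \<in> carrier G" "h \<in> carrier G"
    and gen: "G1 = (\<lambda>i::nat. g [^] i) ` N" "G2 = (\<lambda>i::nat. h [^] i) ` N" and com: "\<phi> \<otimes> g = h \<otimes> \<phi>"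
  shows "\<exists>\<tau>\<in>iso (G\<lparr>carrier := G1\<rparr>) (G\<lparr>carrier := G2\<rparr>). \<forall>x\<in>G1. \<phi> \<otimes> x = \<tau> x \<otimes> \<phi>"
proof -
  define \<tau> where "\<tau> x = \<phi> \<otimes> x \<otimes> inv \<phi>" for x
  have pow: "\<phi> \<otimes> g [^] i = h [^] i \<otimes> \<phi>" for i :: nat
  proof (induction i)
    case (Suc i)
    have "\<phi> \<otimes> g [^] Suc i = (\<phi> \<otimes> g [^] i) \<otimes> g" using c by (simp add: m_assoc)
    also have "\<dots> = h [^] i \<otimes> (\<phi> \<otimes> g)" unfolding Suc using c by (simp add: m_assoc)
    finally show ?case unfolding com using c by (simp add: m_assoc)
  qed (use c in simp)
  have \<tau>p: "\<tau> (g [^] i) = h [^] i" for i :: nat unfolding \<tau>_def pow using c by (simp add: m_assoc)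
  have sub: "G1 \<subseteq> carrier G" "G2 \<subseteq> carrier G" using G12 by (auto dest: subgroup.subset)
  have "bij_betw \<tau> G1 G2"
  proof (rule bij_betw_imageI)
    show "inj_on \<tau> G1"
    proof (rule inj_onI)
      fix x y assume xy: "x \<in> G1" "y \<in> G1" "\<tau> x = \<tau> y"
      then have "x \<in> carrier G" "y \<in> carrier G" using sub by auto
      then show "x = y" using xy(3) c unfolding \<tau>_def by simp
    qed
    show "\<tau> ` G1 = G2" unfolding gen image_image \<tau>p ..
  qed
  moreover have "\<tau> \<in> hom (G\<lparr>carrier := G1\<rparr>) (G\<lparr>carrier := G2\<rparr>)"
  proof (rule homI)
    fix x assume "x \<in> carrier (G\<lparr>carrier := G1\<rparr>)"
    then show "\<tau> x \<in> carrier (G\<lparr>carrier := G2\<rparr>)" using \<open>bij_betw \<tau> G1 G2\<close> by (auto simp: bij_betw_def)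
  next
    fix x y assume "x \<in> carrier (G\<lparr>carrier := G1\<rparr>)" "y \<in> carrier (G\<lparr>carrier := G1\<rparr>)"
    then have xy: "x \<in> carrier G" "y \<in> carrier G" using sub by auto
    have "inv \<phi> \<otimes> (\<phi> \<otimes> u) = u" if "u \<in> carrier G" for u
      using that c by (simp add: m_assoc[symmetric])
    then show "\<tau> (x \<otimes>\<^bsub>G\<lparr>carrier := G1\<rparr>\<^esub> y) = \<tau> x \<otimes>\<^bsub>G\<lparr>carrier := G2\<rparr>\<^esub> \<tau> y"
      unfolding \<tau>_def using xy c by (simp add: m_assoc)
  qed
  ultimately have "\<tau> \<in> iso (G\<lparr>carrier := G1\<rparr>) (G\<lparr>carrier := G2\<rparr>)" by (simp add: iso_def)
  moreover have "\<phi> \<otimes> x = \<tau> x \<otimes> \<phi>" if "x \<in> G1" for x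
    using that sub c unfolding \<tau>_def by (auto simp: m_assoc)
  ultimately show ?thesis by blast
qed

lemma (in ring) finsum_swap:
  assumes "finite I" "finite J" "\<And>i j. i \<in> I \<Longrightarrow> j \<in> J \<Longrightarrow> f i j \<in> carrier R"
  shows "(\<Oplus>i\<in>I. \<Oplus>j\<in>J. f i j) = (\<Oplus>j\<in>J. \<Oplus>i\<in>I. f i j)"
  using assms(1,3)
proof (induction I)
  case empty
  then show ?case by simp
next
  case (insert a I)
  then have c: "f a \<in> J \<rightarrow> carrier R" "(\<lambda>j. \<Oplus>i\<in>I. f i j) \<in> J \<rightarrow> carrier R"
    "(\<lambda>i. \<Oplus>j\<in>J. f i j) \<in> I \<rightarrow> carrier R" "(\<Oplus>j\<in>J. f a j) \<in> carrier R"
    by (auto intro!: finsum_closed)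
  have "(\<Oplus>i\<in>insert a I. \<Oplus>j\<in>J. f i j) = (\<Oplus>j\<in>J. f a j) \<oplus> (\<Oplus>j\<in>J. \<Oplus>i\<in>I. f i j)"
    using insert c by (subst finsum_insert) auto
  also have "\<dots> = (\<Oplus>j\<in>J. f a j \<oplus> (\<Oplus>i\<in>I. f i j))"
    using c by (subst finsum_addf) auto
  also have "\<dots> = (\<Oplus>j\<in>J. \<Oplus>i\<in>insert a I. f i j)"
    using insert c by (intro finsum_cong') (auto intro!: finsum_insert[symmetric] finsum_closed)
  finally show ?case .
qed

lemma (in cring) geometric_sum:
  assumes "r \<in> carrier R"
  shows "(r \<ominus> \<one>) \<otimes> (\<Oplus>i\<in>{..<n}. r [^] (i::nat)) = r [^] n \<ominus> \<one>"
proof (induction n)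
  case 0
  then show ?case using assms by (simp add: a_minus_def r_neg)
next
  case (Suc n)
  define s where "s = (\<Oplus>i\<in>{..<n}. r [^] (i::nat))"
  have s: "s \<in> carrier R" unfolding s_def using assms by (intro finsum_closed) auto
  have "(\<Oplus>i\<in>{..<Suc n}. r [^] (i::nat)) = r [^] n \<oplus> s"
    unfolding s_def lessThan_Suc using assms by (intro finsum_insert) auto
  moreover have "(r \<ominus> \<one>) \<otimes> (r [^] n \<oplus> s) = (r \<ominus> \<one>) \<otimes> r [^] n \<oplus> (r \<ominus> \<one>) \<otimes> s"
    using assms s by (simp add: r_distr)
  moreover have "(r \<ominus> \<one>) \<otimes> r [^] n \<oplus> (r [^] n \<ominus> \<one>) = r \<otimes> r [^] n \<ominus> \<one>"
    using assms nat_pow_closed[OF assms, of n] by algebra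
  ultimately show ?case using Suc assms unfolding s_def[symmetric] by (simp add: m_comm)
qed

lemma (in ring) subring_finsum:
  assumes "subring H R" "\<And>i. i \<in> I \<Longrightarrow> f i \<in> H"
  shows "finsum R f I \<in> H"
  using assms(2)
proof (induction I rule: infinite_finite_induct)
  case (insert a I)
  have "f i \<in> carrier R" if "i \<in> insert a I" for i using insert.prems[OF that] subringE(1)[OF assms(1)] by auto
  then show ?case using insert subringE(7)[OF assms(1)] by (subst finsum_insert) auto
qed (use subringE(2)[OF assms(1)] in auto)

lemma (in ring) subring_pow:
  assumes "subring H R" "a \<in> H"
  shows "a [^] (n::nat) \<in> H"
  using assms subringE(3,6)[OF assms(1)] by (induction n) auto

section \<open>Interpolation at the roots over unramified points\<close>

context adelic_kummer
begin

lemma t_inv: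
  obtains t' where "t' \<in> carrier R" "\<And>x. x \<in> C \<Longrightarrow> t x \<otimes>\<^bsub>K x\<^esub> t' x = \<one>\<^bsub>K x\<^esub>"
proof -
  obtain t' where t': "t' \<in> carrier R" "t \<otimes>\<^bsub>R\<^esub> t' = \<one>\<^bsub>R\<^esub>" using t_unit unfolding Units_def by auto
  have "t x \<otimes>\<^bsub>K x\<^esub> t' x = \<one>\<^bsub>K x\<^esub>" if "x \<in> C" for x
    using fun_cong[OF t'(2), of x] that by (auto simp: restricted_product_def)
  then show ?thesis using that t' by blast
qed

text \<open>A root is nonzero because its \<open>p\<close>-th power \<open>t_x\<close> is
  invertible. The last equation says that the inverse of a root is a \<open>p\<close>-th root of the
  inverse of \<open>t_x\<close>.\<close>

lemma Z_unit:
  assumes "x \<in> C" "z \<in> Z x"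
  shows "z \<in> carrier (K x)" "z [^]\<^bsub>K x\<^esub> p = t x" "inv\<^bsub>K x\<^esub> z \<in> carrier (K x)" "z \<otimes>\<^bsub>K x\<^esub> inv\<^bsub>K x\<^esub> z = \<one>\<^bsub>K x\<^esub>" "z \<noteq> \<zero>\<^bsub>K x\<^esub>"
    "t x \<otimes>\<^bsub>K x\<^esub> (inv\<^bsub>K x\<^esub> z) [^]\<^bsub>K x\<^esub> p = \<one>\<^bsub>K x\<^esub>"
proof -
  interpret k: field "K x" by (rule field_K[OF assms(1)])
  show z: "z \<in> carrier (K x)" "z [^]\<^bsub>K x\<^esub> p = t x" using assms by (auto simp: Z_def)
  obtain t' where t': "t' \<in> carrier R" "t x \<otimes>\<^bsub>K x\<^esub> t' x = \<one>\<^bsub>K x\<^esub>" using t_inv assms(1) by metis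
  have "t' x \<in> carrier (K x)" using R_mem[OF t'(1) assms(1)] .
  then have "t x \<noteq> \<zero>\<^bsub>K x\<^esub>" using t'(2) by auto
  then show "z \<noteq> \<zero>\<^bsub>K x\<^esub>" using z p_gt1 by (auto simp: k.nat_pow_zero)
  then have "z \<in> Units (K x)" using z k.field_Units by auto
  then show i: "inv\<^bsub>K x\<^esub> z \<in> carrier (K x)" "z \<otimes>\<^bsub>K x\<^esub> inv\<^bsub>K x\<^esub> z = \<one>\<^bsub>K x\<^esub>" by auto
  have "(z \<otimes>\<^bsub>K x\<^esub> inv\<^bsub>K x\<^esub> z) [^]\<^bsub>K x\<^esub> p = t x \<otimes>\<^bsub>K x\<^esub> (inv\<^bsub>K x\<^esub> z) [^]\<^bsub>K x\<^esub> p"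
    unfolding z(2)[symmetric] by (rule k.nat_pow_distrib[OF z(1) i(1)])
  then show "t x \<otimes>\<^bsub>K x\<^esub> (inv\<^bsub>K x\<^esub> z) [^]\<^bsub>K x\<^esub> p = \<one>\<^bsub>K x\<^esub>" unfolding i(2) by simp
qed

definition p_reciprocal :: "'x \<Rightarrow> 'a" where
  "p_reciprocal x = (SOME q. q \<in> Oo x \<and> add_pow (K x) p \<one>\<^bsub>K x\<^esub> \<otimes>\<^bsub>K x\<^esub> q = \<one>\<^bsub>K x\<^esub>)"

lemma p_reciprocal:
  assumes "x \<in> C"
  shows "p_reciprocal x \<in> Oo x" "add_pow (K x) p \<one>\<^bsub>K x\<^esub> \<otimes>\<^bsub>K x\<^esub> p_reciprocal x = \<one>\<^bsub>K x\<^esub>" "p_reciprocal x \<in> carrier (K x)"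
proof -
  have "p_reciprocal x \<in> Oo x \<and> add_pow (K x) p \<one>\<^bsub>K x\<^esub> \<otimes>\<^bsub>K x\<^esub> p_reciprocal x = \<one>\<^bsub>K x\<^esub>"
    unfolding p_reciprocal_def by (rule someI_ex) (use p_inv[OF assms] in blast)
  then show "p_reciprocal x \<in> Oo x" "add_pow (K x) p \<one>\<^bsub>K x\<^esub> \<otimes>\<^bsub>K x\<^esub> p_reciprocal x = \<one>\<^bsub>K x\<^esub>" by auto
  then show "p_reciprocal x \<in> carrier (K x)" using subringE(1)[OF subring_O[OF assms]] by auto
qed

text \<open>Fourier inversion on the roots, which form a coset of the \<open>p\<close>-th roots of
  unity. Exchanging the two sums leaves geometric sums of the powers of \<open>w / z\<close>; these
  equal \<open>p\<close> for \<open>w = z\<close> and 0 otherwise. In this form one divides by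
  \<open>p\<close> and by roots, never by differences of roots.\<close>

lemma interpolation_local:
  assumes x: "x \<in> C - Rm" and P: "\<And>z. z \<in> Z x \<Longrightarrow> P z \<in> carrier (K x)" and w: "w \<in> Z x"
  shows "(\<Oplus>\<^bsub>K x\<^esub>i\<in>{..<p}. (p_reciprocal x \<otimes>\<^bsub>K x\<^esub> (\<Oplus>\<^bsub>K x\<^esub>z\<in>Z x. P z \<otimes>\<^bsub>K x\<^esub> (inv\<^bsub>K x\<^esub> z) [^]\<^bsub>K x\<^esub> i)) \<otimes>\<^bsub>K x\<^esub> w [^]\<^bsub>K x\<^esub> i) = P w"
proof -
  have xC: "x \<in> C" using x by simp
  interpret k: field "K x" by (rule field_K[OF xC])
  note zu = Z_unit[OF xC]
  let ?q = "p_reciprocal x"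
  note q = p_reciprocal[OF xC]
  let ?r = "\<lambda>z. inv\<^bsub>K x\<^esub> z \<otimes>\<^bsub>K x\<^esub> w"
  have rc: "?r z \<in> carrier (K x)" if "z \<in> Z x" for z using zu[OF that] zu[OF w] by simp
  have geo: "(\<Oplus>\<^bsub>K x\<^esub>i\<in>{..<p}. ?r z [^]\<^bsub>K x\<^esub> i) = (if w = z then add_pow (K x) p \<one>\<^bsub>K x\<^esub> else \<zero>\<^bsub>K x\<^esub>)" if z: "z \<in> Z x" for z
  proof (cases "w = z")
    case True
    have "?r z = \<one>\<^bsub>K x\<^esub>" using zu[OF z] True by (simp add: k.m_comm)
    then show ?thesis using True k.add.finprod_const[of "\<one>\<^bsub>K x\<^esub>" "{..<p}"] by simp
  next
    case False
    \<comment> \<open>A quotient of two roots is a root of unity, so the geometric sum is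
      annihilated by \<open>w / z - 1\<close>, which is nonzero for distinct roots.\<close>
    have "?r z [^]\<^bsub>K x\<^esub> p = \<one>\<^bsub>K x\<^esub>"
      using zu[OF z] zu[OF w] by (simp add: k.nat_pow_distrib k.m_comm)
    then have "(?r z \<ominus>\<^bsub>K x\<^esub> \<one>\<^bsub>K x\<^esub>) \<otimes>\<^bsub>K x\<^esub> (\<Oplus>\<^bsub>K x\<^esub>i\<in>{..<p}. ?r z [^]\<^bsub>K x\<^esub> i) = \<zero>\<^bsub>K x\<^esub>"
      using k.geometric_sum[OF rc[OF z], of p] by simp
    moreover have "?r z \<noteq> \<one>\<^bsub>K x\<^esub>"
    proof
      assume r1: "?r z = \<one>\<^bsub>K x\<^esub>"
      have "w = z \<otimes>\<^bsub>K x\<^esub> ?r z" using zu[OF z] zu[OF w] by (simp add: k.m_assoc[symmetric])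
      then show False using r1 False zu[OF z] by simp
    qed
    then have "?r z \<ominus>\<^bsub>K x\<^esub> \<one>\<^bsub>K x\<^esub> \<noteq> \<zero>\<^bsub>K x\<^esub>" using rc[OF z] by simp
    moreover have "(\<Oplus>\<^bsub>K x\<^esub>i\<in>{..<p}. ?r z [^]\<^bsub>K x\<^esub> i) \<in> carrier (K x)" using rc[OF z] by (intro k.finsum_closed) auto
    ultimately show ?thesis using False k.integral[OF _ k.minus_closed[OF rc[OF z] k.one_closed]] by auto
  qed
  have fin: "finite (Z x)" by (rule finite_Z[OF x])
  have tc: "P z \<otimes>\<^bsub>K x\<^esub> (inv\<^bsub>K x\<^esub> z) [^]\<^bsub>K x\<^esub> i \<in> carrier (K x)" if "z \<in> Z x" for z and i :: nat
    using zu[OF that] P[OF that] by simp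
  have wc: "w \<in> carrier (K x)" using zu[OF w] by simp
  have "(?q \<otimes>\<^bsub>K x\<^esub> (\<Oplus>\<^bsub>K x\<^esub>z\<in>Z x. P z \<otimes>\<^bsub>K x\<^esub> (inv\<^bsub>K x\<^esub> z) [^]\<^bsub>K x\<^esub> i)) \<otimes>\<^bsub>K x\<^esub> w [^]\<^bsub>K x\<^esub> i =
      (\<Oplus>\<^bsub>K x\<^esub>z\<in>Z x. (?q \<otimes>\<^bsub>K x\<^esub> P z) \<otimes>\<^bsub>K x\<^esub> ?r z [^]\<^bsub>K x\<^esub> i)" for i :: nat
  proof -
    have "(?q \<otimes>\<^bsub>K x\<^esub> (\<Oplus>\<^bsub>K x\<^esub>z\<in>Z x. P z \<otimes>\<^bsub>K x\<^esub> (inv\<^bsub>K x\<^esub> z) [^]\<^bsub>K x\<^esub> i)) \<otimes>\<^bsub>K x\<^esub> w [^]\<^bsub>K x\<^esub> i =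
      (\<Oplus>\<^bsub>K x\<^esub>z\<in>Z x. (?q \<otimes>\<^bsub>K x\<^esub> (P z \<otimes>\<^bsub>K x\<^esub> (inv\<^bsub>K x\<^esub> z) [^]\<^bsub>K x\<^esub> i)) \<otimes>\<^bsub>K x\<^esub> w [^]\<^bsub>K x\<^esub> i)"
      using tc q(3) wc fin by (simp add: k.finsum_rdistr k.finsum_ldistr Pi_iff)
    also have "\<dots> = (\<Oplus>\<^bsub>K x\<^esub>z\<in>Z x. (?q \<otimes>\<^bsub>K x\<^esub> P z) \<otimes>\<^bsub>K x\<^esub> ?r z [^]\<^bsub>K x\<^esub> i)"
      using q(3) wc zu P by (intro k.finsum_cong') (auto simp: k.nat_pow_distrib k.m_assoc)
    finally show ?thesis .
  qed
  then have "(\<Oplus>\<^bsub>K x\<^esub>i\<in>{..<p}. (?q \<otimes>\<^bsub>K x\<^esub> (\<Oplus>\<^bsub>K x\<^esub>z\<in>Z x. P z \<otimes>\<^bsub>K x\<^esub> (inv\<^bsub>K x\<^esub> z) [^]\<^bsub>K x\<^esub> i)) \<otimes>\<^bsub>K x\<^esub> w [^]\<^bsub>K x\<^esub> i)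
     = (\<Oplus>\<^bsub>K x\<^esub>i\<in>{..<p}. \<Oplus>\<^bsub>K x\<^esub>z\<in>Z x. (?q \<otimes>\<^bsub>K x\<^esub> P z) \<otimes>\<^bsub>K x\<^esub> ?r z [^]\<^bsub>K x\<^esub> i)" by simp
  also have "\<dots> = (\<Oplus>\<^bsub>K x\<^esub>z\<in>Z x. \<Oplus>\<^bsub>K x\<^esub>i\<in>{..<p}. (?q \<otimes>\<^bsub>K x\<^esub> P z) \<otimes>\<^bsub>K x\<^esub> ?r z [^]\<^bsub>K x\<^esub> i)"
    using fin rc q(3) P by (intro k.finsum_swap) auto
  also have "\<dots> = (\<Oplus>\<^bsub>K x\<^esub>z\<in>Z x. if w = z then P z else \<zero>\<^bsub>K x\<^esub>)"
  proof (intro k.finsum_cong')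
    fix z assume z: "z \<in> Z x"
    have "(\<Oplus>\<^bsub>K x\<^esub>i\<in>{..<p}. (?q \<otimes>\<^bsub>K x\<^esub> P z) \<otimes>\<^bsub>K x\<^esub> ?r z [^]\<^bsub>K x\<^esub> i) = (?q \<otimes>\<^bsub>K x\<^esub> P z) \<otimes>\<^bsub>K x\<^esub> (\<Oplus>\<^bsub>K x\<^esub>i\<in>{..<p}. ?r z [^]\<^bsub>K x\<^esub> i)"
      using rc[OF z] q(3) P[OF z] by (subst k.finsum_rdistr) auto
    also have "\<dots> = (if w = z then (add_pow (K x) p \<one>\<^bsub>K x\<^esub> \<otimes>\<^bsub>K x\<^esub> ?q) \<otimes>\<^bsub>K x\<^esub> P z else \<zero>\<^bsub>K x\<^esub>)"
      unfolding geo[OF z] using q(3) P[OF z] by (simp add: k.m_ac)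
    finally show "(\<Oplus>\<^bsub>K x\<^esub>i\<in>{..<p}. (?q \<otimes>\<^bsub>K x\<^esub> P z) \<otimes>\<^bsub>K x\<^esub> ?r z [^]\<^bsub>K x\<^esub> i) = (if w = z then P z else \<zero>\<^bsub>K x\<^esub>)"
      unfolding q(2) using P[OF z] by simp
  qed (use P in auto)
  also have "\<dots> = P w" using w fin P by (intro k.finsum_singleton) auto
  finally show ?thesis .
qed

text \<open>The local coefficients have to form adeles. Over the ramified points they are those of
  \<open>T\<close> itself, so that substituting \<open>y\<close> for \<open>T\<close> changes
  nothing there.\<close>

lemma interpolation:
  assumes P: "\<And>x z. x \<in> C - Rm \<Longrightarrow> z \<in> Z x \<Longrightarrow> P x z \<in> Z x"
  obtains y where "y \<in> carrier kum.S" "\<And>x. x \<in> Rm \<Longrightarrow> L x y = Tx x"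
    "\<And>x z. x \<in> C - Rm \<Longrightarrow> z \<in> Z x \<Longrightarrow> ev x z y = P x z"
proof -
  define c where "c i = (\<lambda>x\<in>C. if x \<in> Rm then (if i = 1 then \<one>\<^bsub>K x\<^esub> else \<zero>\<^bsub>K x\<^esub>)
     else p_reciprocal x \<otimes>\<^bsub>K x\<^esub> (\<Oplus>\<^bsub>K x\<^esub>z\<in>Z x. P x z \<otimes>\<^bsub>K x\<^esub> (inv\<^bsub>K x\<^esub> z) [^]\<^bsub>K x\<^esub> i))" for i :: nat
  obtain t' where t': "t' \<in> carrier R" "\<And>x. x \<in> C \<Longrightarrow> t x \<otimes>\<^bsub>K x\<^esub> t' x = \<one>\<^bsub>K x\<^esub>" using t_inv by blast
  \<comment> \<open>Outside this set \<open>t_x\<close> and its inverse are both integral; by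
    \<open>pth_closed\<close> so are all roots and their inverses, and hence the
    coefficients.\<close>
  let ?N = "{x \<in> C. t x \<notin> Oo x} \<union> {x \<in> C. t' x \<notin> Oo x}"
  have fin: "finite ?N" using R_fin[OF kum.t_closed] R_fin[OF t'(1)] by simp
  have c: "c i \<in> carrier R" for i
    unfolding c_def
  proof (rule restricted_product_carrierI[OF _ fin])
    fix x assume x: "x \<in> C"
    interpret k: field "K x" by (rule field_K[OF x])
    note so = subringE[OF subring_O[OF x]]
    note zu = Z_unit[OF x]
    have Pz: "P x z \<in> Z x" if "x \<notin> Rm" "z \<in> Z x" for z using P that x by simp
    show "(if x \<in> Rm then (if i = 1 then \<one>\<^bsub>K x\<^esub> else \<zero>\<^bsub>K x\<^esub>) else p_reciprocal x \<otimes>\<^bsub>K x\<^esub> (\<Oplus>\<^bsub>K x\<^esub>z\<in>Z x. P x z \<otimes>\<^bsub>K x\<^esub> (inv\<^bsub>K x\<^esub> z) [^]\<^bsub>K x\<^esub> i)) \<in> carrier (K x)"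
      using zu Pz p_reciprocal[OF x] by (auto intro!: k.m_closed k.finsum_closed k.nat_pow_closed)
    assume n: "x \<notin> ?N"
    have zO: "z \<in> Oo x" "inv\<^bsub>K x\<^esub> z \<in> Oo x" if z: "z \<in> Z x" for z
    proof -
      show "z \<in> Oo x" using pth_closed[OF x zu(1)[OF z]] zu(2)[OF z] n x by simp
      have tx: "t x \<in> carrier (K x)" "t' x \<in> carrier (K x)" using R_mem[OF kum.t_closed x] R_mem[OF t'(1) x] by auto
      have "(inv\<^bsub>K x\<^esub> z) [^]\<^bsub>K x\<^esub> p = (t x \<otimes>\<^bsub>K x\<^esub> t' x) \<otimes>\<^bsub>K x\<^esub> (inv\<^bsub>K x\<^esub> z) [^]\<^bsub>K x\<^esub> p" using t'(2)[OF x] zu(3)[OF z] by simp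
      also have "\<dots> = t' x \<otimes>\<^bsub>K x\<^esub> (t x \<otimes>\<^bsub>K x\<^esub> (inv\<^bsub>K x\<^esub> z) [^]\<^bsub>K x\<^esub> p)"
        using tx zu(3)[OF z] by (simp add: k.m_ac)
      also have "\<dots> = t' x" using zu[OF z] tx by simp
      finally show "inv\<^bsub>K x\<^esub> z \<in> Oo x" using pth_closed[OF x zu(3)[OF z]] n x by simp
    qed
    show "(if x \<in> Rm then (if i = 1 then \<one>\<^bsub>K x\<^esub> else \<zero>\<^bsub>K x\<^esub>) else p_reciprocal x \<otimes>\<^bsub>K x\<^esub> (\<Oplus>\<^bsub>K x\<^esub>z\<in>Z x. P x z \<otimes>\<^bsub>K x\<^esub> (inv\<^bsub>K x\<^esub> z) [^]\<^bsub>K x\<^esub> i)) \<in> Oo x"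
      using zO Pz p_reciprocal[OF x] so(2,3)
      by (auto intro!: so(6) k.subring_finsum[OF subring_O[OF x]] k.subring_pow[OF subring_O[OF x]])
  qed
  then have c': "c \<in> UNIV \<rightarrow> carrier R" by auto
  let ?y = "kum.comb c"
  have "L x ?y = Tx x" if xr: "x \<in> Rm" for x
  proof -
    have x: "x \<in> C" using xr Rm_sub by auto
    interpret k: kummer "K x" "UP (K x)" p "t x" using kummer_K[OF x] by simp
    have "L x ?y = k.comb (\<lambda>i. c i x)" by (rule L_comb[OF x c'])
    also have "\<dots> = (\<Oplus>\<^bsub>k.S\<^esub>i\<in>{..<p}. if 1 = i then Tx x [^]\<^bsub>k.S\<^esub> i else \<zero>\<^bsub>k.S\<^esub>)"
      unfolding k.comb_def using xr x by (intro k.S.finsum_cong') (auto simp: c_def)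
    also have "\<dots> = Tx x [^]\<^bsub>k.S\<^esub> (1::nat)" using p_gt1 by (intro k.S.finsum_singleton) auto
    finally show ?thesis by simp
  qed
  moreover have "ev x w ?y = P x w" if x: "x \<in> C - Rm" and w: "w \<in> Z x" for x w
  proof -
    have xC: "x \<in> C" using x by simp
    interpret k: field "K x" by (rule field_K[OF xC])
    have "ev x w ?y = (\<Oplus>\<^bsub>K x\<^esub>i\<in>{..<p}. c i x \<otimes>\<^bsub>K x\<^esub> w [^]\<^bsub>K x\<^esub> i)" by (rule ev_comb[OF xC w c'])
    also have "\<dots> = P x w"
      using interpolation_local[OF x, of "P x" w] P[OF x] Z_unit(1)[OF xC] w x by (simp add: c_def)
    finally show ?thesis .
  qed
  moreover have "?y \<in> carrier kum.S" using c' by (intro kum.comb_closed) auto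
  ultimately show ?thesis using that by blast
qed

end

section \<open>Automorphisms and permutations of the roots\<close>

context adelic_kummer
begin

text \<open>The interpolated \<open>y\<close> takes roots to roots, so the tests of
  \<open>S_eqI\<close> give \<open>y^p = t\<close>, and \<open>T \<mapsto> y\<close> extends to the
  algebra by the universal property.\<close>

lemma endomorphism:
  assumes P: "\<And>x z. x \<in> C - Rm \<Longrightarrow> z \<in> Z x \<Longrightarrow> P x z \<in> Z x"
  obtains \<phi> where "\<phi> \<in> ring_hom kum.S kum.S" "\<And>\<alpha>. \<alpha> \<in> carrier R \<Longrightarrow> \<phi> (kum.emb \<alpha>) = kum.emb \<alpha>"
    "\<And>x s. x \<in> Rm \<Longrightarrow> s \<in> carrier kum.S \<Longrightarrow> L x (\<phi> s) = L x s"
    "\<And>x z s. x \<in> C - Rm \<Longrightarrow> z \<in> Z x \<Longrightarrow> s \<in> carrier kum.S \<Longrightarrow> ev x z (\<phi> s) = ev x (P x z) s"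
proof -
  obtain y where y: "y \<in> carrier kum.S" "\<And>x. x \<in> Rm \<Longrightarrow> L x y = Tx x"
    "\<And>x z. x \<in> C - Rm \<Longrightarrow> z \<in> Z x \<Longrightarrow> ev x z y = P x z" using interpolation[of P] P by blast
  have yp: "y [^]\<^bsub>kum.S\<^esub> p = kum.emb t"
  proof (rule S_eqI)
    fix x assume x: "x \<in> Rm"
    then have xC: "x \<in> C" using Rm_sub by auto
    interpret k: kummer "K x" "UP (K x)" p "t x" using kummer_K[OF xC] by simp
    interpret H: ring_hom_cring kum.S "Sx x" "L x" by unfold_locales (rule L_props(1)[OF xC])
    show "L x (y [^]\<^bsub>kum.S\<^esub> p) = L x (kum.emb t)"
      using y(1) y(2)[OF x] k.T_pow L_props(2)[OF xC] by simp
  next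
    fix x z assume x: "x \<in> C - Rm" and z: "z \<in> Z x"
    then have xC: "x \<in> C" by auto
    interpret k: cring "K x" by (rule cring_K[OF xC])
    interpret H: ring_hom_cring kum.S "K x" "ev x z" by unfold_locales (rule ev_props(1)[OF xC z])
    show "ev x z (y [^]\<^bsub>kum.S\<^esub> p) = ev x z (kum.emb t)"
      using y(1) y(3)[OF x z] P[OF x z] ev_props(2)[OF xC z] by (simp add: Z_def)
  qed (use y in auto)
  obtain \<phi> where \<phi>: "\<phi> \<in> ring_hom kum.S kum.S" "\<And>\<alpha>. \<alpha> \<in> carrier R \<Longrightarrow> \<phi> (kum.emb \<alpha>) = kum.emb \<alpha>"
    "\<phi> kum.T = y"
    by (rule kum.universal[OF kum.S_cring kum.emb_hom y(1) yp]) blast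
  have "L x (\<phi> s) = L x s" if x: "x \<in> Rm" and s: "s \<in> carrier kum.S" for x s
  proof -
    have xC: "x \<in> C" using x Rm_sub by auto
    interpret k: kummer "K x" "UP (K x)" p "t x" using kummer_K[OF xC] by simp
    show ?thesis
    proof (rule kum.hom_unique[OF k.S_cring _ L_props(1)[OF xC] _ _ s])
      show "(\<lambda>s. L x (\<phi> s)) \<in> ring_hom kum.S (Sx x)"
        using ring_hom_trans[OF \<phi>(1) L_props(1)[OF xC]] by (simp add: comp_def)
    qed (use \<phi> y x L_props[OF xC] in auto)
  qed
  moreover have "ev x z (\<phi> s) = ev x (P x z) s" if x: "x \<in> C - Rm" and z: "z \<in> Z x" and s: "s \<in> carrier kum.S" for x z s
  proof -
    have xC: "x \<in> C" using x by auto
    show ?thesis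
    proof (rule kum.hom_unique[OF cring_K[OF xC] _ ev_props(1)[OF xC P[OF x z]] _ _ s])
      show "(\<lambda>s. ev x z (\<phi> s)) \<in> ring_hom kum.S (K x)"
        using ring_hom_trans[OF \<phi>(1) ev_props(1)[OF xC z]] by (simp add: comp_def)
    qed (use \<phi> y x z ev_props[OF xC z] ev_props[OF xC P[OF x z]] in auto)
  qed
  ultimately show ?thesis using that \<phi>(1,2) by blast
qed

text \<open>The inverse permutations define an endomorphism too; by the tests of
  \<open>S_eqI\<close> the two are mutually inverse.\<close>

lemma automorphism:
  assumes P: "\<And>x. x \<in> C - Rm \<Longrightarrow> bij_betw (P x) (Z x) (Z x)"
  obtains \<phi> where "\<phi> \<in> carrier A"
    "\<And>x s. x \<in> Rm \<Longrightarrow> s \<in> carrier kum.S \<Longrightarrow> L x (\<phi> s) = L x s"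
    "\<And>x z s. x \<in> C - Rm \<Longrightarrow> z \<in> Z x \<Longrightarrow> s \<in> carrier kum.S \<Longrightarrow> ev x z (\<phi> s) = ev x (P x z) s"
proof -
  define Q where "Q x = inv_into (Z x) (P x)" for x
  have Pz: "P x z \<in> Z x" if "x \<in> C - Rm" "z \<in> Z x" for x z using bij_betw_apply[OF P[OF that(1)] that(2)] .
  have Qz: "Q x z \<in> Z x" if "x \<in> C - Rm" "z \<in> Z x" for x z
    using bij_betw_apply[OF bij_betw_inv_into[OF P[OF that(1)]] that(2)] unfolding Q_def .
  have PQ: "P x (Q x z) = z" "Q x (P x z) = z" if "x \<in> C - Rm" "z \<in> Z x" for x z
    unfolding Q_def using bij_betw_inv_into_right[OF P[OF that(1)] that(2)]
      bij_betw_inv_into_left[OF P[OF that(1)] that(2)] by auto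
  obtain \<phi> where \<phi>: "\<phi> \<in> ring_hom kum.S kum.S" "\<And>\<alpha>. \<alpha> \<in> carrier R \<Longrightarrow> \<phi> (kum.emb \<alpha>) = kum.emb \<alpha>"
    "\<And>x s. x \<in> Rm \<Longrightarrow> s \<in> carrier kum.S \<Longrightarrow> L x (\<phi> s) = L x s"
    "\<And>x z s. x \<in> C - Rm \<Longrightarrow> z \<in> Z x \<Longrightarrow> s \<in> carrier kum.S \<Longrightarrow> ev x z (\<phi> s) = ev x (P x z) s"
    by (rule endomorphism[of P]) (erule Pz, blast+)
  obtain \<psi> where \<psi>: "\<psi> \<in> ring_hom kum.S kum.S"
    "\<And>x s. x \<in> Rm \<Longrightarrow> s \<in> carrier kum.S \<Longrightarrow> L x (\<psi> s) = L x s"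
    "\<And>x z s. x \<in> C - Rm \<Longrightarrow> z \<in> Z x \<Longrightarrow> s \<in> carrier kum.S \<Longrightarrow> ev x z (\<psi> s) = ev x (Q x z) s"
    by (rule endomorphism[of Q]) (erule Qz, blast+)
  have cl: "\<phi> s \<in> carrier kum.S" "\<psi> s \<in> carrier kum.S" if "s \<in> carrier kum.S" for s
    using ring_hom_closed[OF \<phi>(1) that] ring_hom_closed[OF \<psi>(1) that] by auto
  have inv: "\<phi> (\<psi> s) = s" "\<psi> (\<phi> s) = s" if s: "s \<in> carrier kum.S" for s
    by (rule S_eqI; simp only: cl s \<phi>(3,4) \<psi>(2,3) Pz Qz PQ)+
  define f where "f = restrict \<phi> (carrier kum.S)"
  have fe: "f s = \<phi> s" if "s \<in> carrier kum.S" for s using that by (simp add: f_def)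
  have "bij_betw f (carrier kum.S) (carrier kum.S)"
    by (rule bij_betwI[of _ _ _ \<psi>]) (use cl inv fe in auto)
  moreover have "f \<in> ring_hom kum.S kum.S" by (rule ring_hom_cong[OF \<phi>(1) fe kum.S.ring_axioms])
  moreover have "f (kum.emb \<alpha>) = kum.emb \<alpha>" if "\<alpha> \<in> carrier R" for \<alpha> using that fe \<phi>(2) by simp
  moreover have "f \<in> extensional (carrier kum.S)" by (simp add: f_def)
  ultimately have "f \<in> carrier A" by (simp add: alg_aut_group_carrier)
  then show ?thesis using that fe \<phi>(3,4) by simp
qed

text \<open>The pullback action: applying \<open>f\<close> and evaluating at \<open>z\<close> is
  evaluating at \<open>perm f x z\<close>. A composite of automorphisms thus acts by the
  permutations in reversed order.\<close>

definition perm :: "((nat \<Rightarrow> 'x \<Rightarrow> 'a) set \<Rightarrow> (nat \<Rightarrow> 'x \<Rightarrow> 'a) set) \<Rightarrow> 'x \<Rightarrow> 'a \<Rightarrow> 'a" where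
  "perm f x z = ev x z (f kum.T)"

lemma perm:
  assumes f: "f \<in> carrier A" and x: "x \<in> C" and z: "z \<in> Z x"
  shows "perm f x z \<in> Z x" "\<And>s. s \<in> carrier kum.S \<Longrightarrow> ev x z (f s) = ev x (perm f x z) s"
proof -
  interpret k: cring "K x" by (rule cring_K[OF x])
  interpret H: ring_hom_cring kum.S "K x" "ev x z" by unfold_locales (rule ev_props(1)[OF x z])
  interpret F: ring_hom_cring kum.S kum.S f by unfold_locales (rule A_props(1)[OF f])
  have "perm f x z [^]\<^bsub>K x\<^esub> p = ev x z (f (kum.T [^]\<^bsub>kum.S\<^esub> p))" by (simp add: perm_def)
  also have "\<dots> = t x" unfolding kum.T_pow using A_props(2)[OF f] ev_props(2)[OF x z] by simp
  finally show pz: "perm f x z \<in> Z x" by (simp add: Z_def perm_def)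
  show "ev x z (f s) = ev x (perm f x z) s" if s: "s \<in> carrier kum.S" for s
  proof (rule kum.hom_unique[OF k.is_cring _ ev_props(1)[OF x pz] _ _ s])
    show "(\<lambda>s. ev x z (f s)) \<in> ring_hom kum.S (K x)"
      using ring_hom_trans[OF A_props(1)[OF f] H.homh] by (simp add: comp_def)
  qed (use A_props(2)[OF f] ev_props[OF x z] ev_props[OF x pz] in \<open>auto simp: perm_def\<close>)
qed

lemma ev_pow:
  assumes f: "f \<in> carrier A" and x: "x \<in> C" and z: "z \<in> Z x" and s: "s \<in> carrier kum.S"
  shows "ev x z ((f [^]\<^bsub>A\<^esub> n) s) = ev x ((perm f x ^^ n) z) s"
  using z
proof (induction n arbitrary: z)
  case 0
  then show ?case using A_one[OF s] by simp
next
  case (Suc n)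
  have fn: "f [^]\<^bsub>A\<^esub> n \<in> carrier A" using f by simp
  have "f [^]\<^bsub>A\<^esub> Suc n = f \<otimes>\<^bsub>A\<^esub> f [^]\<^bsub>A\<^esub> n" using A.nat_pow_Suc2[OF f] .
  then have "ev x z ((f [^]\<^bsub>A\<^esub> Suc n) s) = ev x z (f ((f [^]\<^bsub>A\<^esub> n) s))"
    using A_mult[OF f fn s] by simp
  also have "\<dots> = ev x (perm f x z) ((f [^]\<^bsub>A\<^esub> n) s)"
    using perm(2)[OF f x Suc.prems A_props(3)[OF fn s]] .
  also have "\<dots> = ev x ((perm f x ^^ n) (perm f x z)) s" by (rule Suc.IH[OF perm(1)[OF f x Suc.prems]])
  finally show ?case by (simp add: funpow_swap1)
qed

lemma perm_order:
  assumes f: "f \<in> carrier A" "f [^]\<^bsub>A\<^esub> n = \<one>\<^bsub>A\<^esub>" and x: "x \<in> C" and z: "z \<in> Z x"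
  shows "(perm f x ^^ n) z = z"
proof -
  have "(perm f x ^^ m) z \<in> Z x" for m using perm(1)[OF f(1) x] z by (induction m) auto
  then show ?thesis
    using ev_pow[OF f(1) x z kum.T_closed, of n] f(2) A_one[OF kum.T_closed] ev_props(3)[OF x] z by simp
qed

text \<open>Nontriviality of the action at \<open>x\<close>, in the coordinates available there: the
  generator \<open>T\<close> at a ramified point, the roots at any other.\<close>

definition moves :: "((nat \<Rightarrow> 'x \<Rightarrow> 'a) set \<Rightarrow> (nat \<Rightarrow> 'x \<Rightarrow> 'a) set) \<Rightarrow> 'x \<Rightarrow> bool" where
  "moves f x \<longleftrightarrow> (if x \<in> Rm then L x (f kum.T) \<noteq> Tx x else (\<exists>z\<in>Z x. perm f x z \<noteq> z))"

text \<open>The fixed ring condition is tested on the product of the idempotent at \<open>x\<close>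
  with \<open>T\<close>: were it fixed, it would be a constant.\<close>

lemma generator_moves:
  assumes fx: "{s \<in> carrier kum.S. \<forall>f\<in>G. f s = s} = kum.emb ` carrier R"
    and G: "G = (\<lambda>i::nat. g [^]\<^bsub>A\<^esub> i) ` N" and g: "g \<in> carrier A" and x: "x \<in> C"
  shows "moves g x"
proof (rule ccontr)
  assume nm: "\<not> moves g x"
  interpret F: ring_hom_cring kum.S kum.S g by unfold_locales (rule A_props(1)[OF g])
  interpret kx: field "K x" by (rule field_K[OF x])
  let ?e = "point_adele x \<one>\<^bsub>K x\<^esub>"
  let ?s = "kum.emb ?e \<otimes>\<^bsub>kum.S\<^esub> kum.T"
  have e: "?e \<in> carrier R" by (rule point_adele_closed[OF x]) simp
  have gs: "g ?s = kum.emb ?e \<otimes>\<^bsub>kum.S\<^esub> g kum.T" using e A_props(2)[OF g e] by simp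
  \<comment> \<open>Away from \<open>x\<close> the idempotent kills both sides; at \<open>x\<close>
    the action is trivial by assumption.\<close>
  have "g ?s = ?s"
  proof (rule S_eqI)
    fix y assume y: "y \<in> Rm"
    then have yC: "y \<in> C" using Rm_sub by auto
    interpret k: kummer "K y" "UP (K y)" p "t y" using kummer_K[OF yC] by simp
    interpret H: ring_hom_cring kum.S "Sx y" "L y" by unfold_locales (rule L_props(1)[OF yC])
    have "L y (kum.emb ?e) = \<zero>\<^bsub>Sx y\<^esub> \<or> L y (g kum.T) = L y kum.T"
      using nm y L_props(3)[OF yC] L_props(2)[OF yC e] yC by (auto simp: moves_def point_adele_eval)
    then show "L y (g ?s) = L y ?s" unfolding gs using e by (elim disjE) simp_all
  next
    fix y z assume y: "y \<in> C - Rm" and z: "z \<in> Z y"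
    then have yC: "y \<in> C" by auto
    interpret k: cring "K y" by (rule cring_K[OF yC])
    interpret H: ring_hom_cring kum.S "K y" "ev y z" by unfold_locales (rule ev_props(1)[OF yC z])
    have "ev y z (kum.emb ?e) = \<zero>\<^bsub>K y\<^esub> \<or> ev y z (g kum.T) = ev y z kum.T"
      using nm y z ev_props(3)[OF yC z] ev_props(2)[OF yC z e] yC
      by (auto simp: moves_def perm_def point_adele_eval)
    then show "ev y z (g ?s) = ev y z ?s" unfolding gs using e by (elim disjE) simp_all
  qed (use e in auto)
  then have "(g [^]\<^bsub>A\<^esub> n) ?s = ?s" for n :: nat
  proof (induction n)
    case 0
    then show ?case using A_one[of ?s] e by simp
  next
    case (Suc n)
    then show ?case using A_mult[of "g [^]\<^bsub>A\<^esub> n" g ?s] g e by simp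
  qed
  then have "?s \<in> kum.emb ` carrier R" unfolding fx[symmetric] G using e by auto
  then obtain r where r: "r \<in> carrier R" "?s = kum.emb r" by auto
  have "?e = \<zero>\<^bsub>R\<^esub>" by (rule kum.emb_T_eq_emb[OF p_gt1 e r])
  then have "?e x = \<zero>\<^bsub>K x\<^esub>" using x by (simp add: restricted_product_def)
  then show False using x by (simp add: point_adele_eval)
qed

lemma nontrivial_powers:
  assumes "subgroup G A" "card G = p"
  obtains g where "g \<in> G" "g \<noteq> \<one>\<^bsub>A\<^esub>"
proof -
  have "G \<noteq> {\<one>\<^bsub>A\<^esub>}"
  proof
    assume "G = {\<one>\<^bsub>A\<^esub>}"
    then have "card G = 1" by simp
    then show False using assms(2) p_gt1 by linarith
  qed
  moreover have "\<one>\<^bsub>A\<^esub> \<in> G" using assms(1) by (simp add: subgroup.one_closed)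
  ultimately show ?thesis using that by blast
qed

text \<open>It ensures that the element of the second group with the components of a generator of
  the first is again a generator.\<close>

lemma component_one_moves:
  assumes "f \<in> carrier A" "x \<in> Rm" "moves f x" "h \<in> carrier A" "component x f = component x h"
  shows "h \<noteq> \<one>\<^bsub>A\<^esub>"
proof
  assume h: "h = \<one>\<^bsub>A\<^esub>"
  have xC: "x \<in> C" using assms Rm_sub by auto
  have "L x (f kum.T) = L x (h kum.T)" using component_eq_iff[OF assms(1,4) xC] assms(5) by simp
  then show False using assms(2,3) h A_one[OF kum.T_closed] L_props(3)[OF xC] by (simp add: moves_def)
qed

theorem conjugate_iff:
  assumes G1: "subgroup G1 A" "card G1 = p" "{s \<in> carrier kum.S. \<forall>f\<in>G1. f s = s} = kum.emb ` carrier R"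
    and G2: "subgroup G2 A" "card G2 = p" "{s \<in> carrier kum.S. \<forall>f\<in>G2. f s = s} = kum.emb ` carrier R"
  shows "galois_conjugate R kum.S kum.emb G1 G2 \<longleftrightarrow>
    (\<lambda>g. \<lambda>x\<in>Rm. component x g) ` G1 = (\<lambda>g. \<lambda>x\<in>Rm. component x g) ` G2"
proof
  note sub = subgroup.subset[OF G1(1)] subgroup.subset[OF G2(1)]
  assume "galois_conjugate R kum.S kum.emb G1 G2"
  then obtain \<phi> \<tau> where \<phi>: "\<phi> \<in> carrier A" and \<tau>: "\<tau> \<in> iso (A\<lparr>carrier := G1\<rparr>) (A\<lparr>carrier := G2\<rparr>)"
    and com: "\<And>g. g \<in> G1 \<Longrightarrow> \<phi> \<otimes>\<^bsub>A\<^esub> g = \<tau> g \<otimes>\<^bsub>A\<^esub> \<phi>"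
    unfolding galois_conjugate_def Let_def by blast
  have im: "\<tau> ` G1 = G2" using \<tau> by (simp add: iso_def bij_betw_def)
  have "component x g = component x (\<tau> g)" if g: "g \<in> G1" and x: "x \<in> Rm" for g x
  proof -
    have xC: "x \<in> C" using x Rm_sub by auto
    have gA: "g \<in> carrier A" "\<tau> g \<in> carrier A" using g sub im by auto
    have "L x (g s) = L x (\<tau> g s)" if s: "s \<in> carrier kum.S" for s
    proof -
      let ?i = "inv\<^bsub>A\<^esub> \<phi>"
      have gs: "g s \<in> carrier kum.S" "\<tau> g s \<in> carrier kum.S" using A_props(3) gA s by auto
      \<comment> \<open>Commutativity at \<open>x\<close> will move \<open>\<phi>\<close> to the
        left on both sides; its inverse, which respects equality at \<open>x\<close>, then removes
        it.\<close>
      have "L x (\<phi> (g s)) = L x (\<tau> g (\<phi> s))"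
        using com[OF g] A_mult[OF \<phi> gA(1) s] A_mult[OF gA(2) \<phi> s] by simp
      also have "\<dots> = L x (\<phi> (\<tau> g s))" by (rule ramified_commute[OF gA(2) \<phi> x s])
      finally have "L x (?i (\<phi> (g s))) = L x (?i (\<phi> (\<tau> g s)))"
        by (rule L_compat[OF A.inv_closed[OF \<phi>] xC A_props(3)[OF \<phi> gs(1)] A_props(3)[OF \<phi> gs(2)]])
      moreover have "?i (\<phi> u) = u" if "u \<in> carrier kum.S" for u
        using A_mult[of ?i \<phi> u] A_one[OF that] \<phi> that by simp
      ultimately show ?thesis using gs by simp
    qed
    then show ?thesis using component_eq_iff[OF gA xC] by simp
  qed
  then have "(\<lambda>g. \<lambda>x\<in>Rm. component x g) ` G1 = (\<lambda>g. \<lambda>x\<in>Rm. component x (\<tau> g)) ` G1"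
    by (intro image_cong refl restrict_ext) auto
  also have "\<dots> = (\<lambda>g. \<lambda>x\<in>Rm. component x g) ` G2" unfolding im[symmetric] image_image ..
  finally show "(\<lambda>g. \<lambda>x\<in>Rm. component x g) ` G1 = (\<lambda>g. \<lambda>x\<in>Rm. component x g) ` G2" .
next
  note sub = subgroup.subset[OF G1(1)] subgroup.subset[OF G2(1)]
  assume eq: "(\<lambda>g. \<lambda>x\<in>Rm. component x g) ` G1 = (\<lambda>g. \<lambda>x\<in>Rm. component x g) ` G2"
  obtain g where g: "g \<in> G1" "g \<noteq> \<one>\<^bsub>A\<^esub>" using nontrivial_powers[OF G1(1,2)] .
  have gA: "g \<in> carrier A" using g sub by auto
  note gp = A.prime_subgroup_powers[OF G1(1,2) prime_p g]
  have gm: "moves g x" if "x \<in> C" for x by (rule generator_moves[OF G1(3) gp(2) gA that])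
  \<comment> \<open>The partner of \<open>g\<close>: a nonidentity element of \<open>G2\<close>,
    hence a generator, with the same ramified components. Without ramified points the condition on
    components is empty and any such element serves.\<close>
  obtain h where h: "h \<in> G2" "h \<noteq> \<one>\<^bsub>A\<^esub>" and comp: "\<And>x. x \<in> Rm \<Longrightarrow> component x g = component x h"
  proof (cases "Rm = {}")
    case True
    obtain h where "h \<in> G2" "h \<noteq> \<one>\<^bsub>A\<^esub>" using nontrivial_powers[OF G2(1,2)] .
    then show ?thesis using that True by blast
  next
    case False
    then obtain x0 where x0: "x0 \<in> Rm" by blast
    have "(\<lambda>x\<in>Rm. component x g) \<in> (\<lambda>g. \<lambda>x\<in>Rm. component x g) ` G2" using g(1) unfolding eq[symmetric] by blast
    then obtain h where h: "h \<in> G2" "(\<lambda>x\<in>Rm. component x g) = (\<lambda>x\<in>Rm. component x h)" by blast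
    have comp: "component x g = component x h" if "x \<in> Rm" for x using fun_cong[OF h(2), of x] that by simp
    \<comment> \<open>A ramified point detects this: \<open>g\<close> acts nontrivially there and
      \<open>h\<close> acts in the same way.\<close>
    have "h \<noteq> \<one>\<^bsub>A\<^esub>"
      using component_one_moves[OF gA x0 gm _ comp[OF x0]] x0 h(1) sub Rm_sub by blast
    then show ?thesis using that h(1) comp by blast
  qed
  have hA: "h \<in> carrier A" using h sub by auto
  note hp = A.prime_subgroup_powers[OF G2(1,2) prime_p h]
  have hm: "moves h x" if "x \<in> C" for x by (rule generator_moves[OF G2(3) hp(2) hA that])
  \<comment> \<open>The permutations of \<open>h\<close> and \<open>g\<close> stand in the order
    opposite to the desired \<open>\<phi> g = h \<phi>\<close>, because roots are acted on by
    pullback.\<close>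
  have "\<exists>P. bij_betw P (Z x) (Z x) \<and> (\<forall>z\<in>Z x. P (perm h x z) = perm g x (P z))" if x: "x \<in> C - Rm" for x
  proof -
    have xC: "x \<in> C" using x by auto
    obtain P where "bij_betw P (Z x) (Z x)" "\<And>z. z \<in> Z x \<Longrightarrow> P (perm h x z) = perm g x (P z)"
    proof (rule prime_cycles_conjugate[OF prime_p card_Z[OF x], of "perm h x" "perm g x"])
      show "perm h x \<in> Z x \<rightarrow> Z x" "perm g x \<in> Z x \<rightarrow> Z x" using perm(1)[OF _ xC] gA hA by auto
      show "(perm h x ^^ p) z = z" "(perm g x ^^ p) z = z" if "z \<in> Z x" for z
        using perm_order[OF hA hp(1) xC that] perm_order[OF gA gp(1) xC that] by auto
      show "\<exists>z\<in>Z x. perm h x z \<noteq> z" "\<exists>z\<in>Z x. perm g x z \<noteq> z"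
        using gm[OF xC] hm[OF xC] x by (auto simp: moves_def)
    qed blast
    then show ?thesis by blast
  qed
  then obtain P where P: "\<And>x. x \<in> C - Rm \<Longrightarrow> bij_betw (P x) (Z x) (Z x)"
    "\<And>x z. x \<in> C - Rm \<Longrightarrow> z \<in> Z x \<Longrightarrow> P x (perm h x z) = perm g x (P x z)" by metis
  obtain \<phi> where \<phi>: "\<phi> \<in> carrier A"
    "\<And>x s. x \<in> Rm \<Longrightarrow> s \<in> carrier kum.S \<Longrightarrow> L x (\<phi> s) = L x s"
    "\<And>x z s. x \<in> C - Rm \<Longrightarrow> z \<in> Z x \<Longrightarrow> s \<in> carrier kum.S \<Longrightarrow> ev x z (\<phi> s) = ev x (P x z) s"
    using automorphism[OF P(1)] by blast
  have "\<phi> \<otimes>\<^bsub>A\<^esub> g = h \<otimes>\<^bsub>A\<^esub> \<phi>"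
  proof (rule A_eqI)
    have c: "g kum.T \<in> carrier kum.S" "\<phi> kum.T \<in> carrier kum.S" "h kum.T \<in> carrier kum.S"
      using A_props(3) gA hA \<phi>(1) by auto
    have "\<phi> (g kum.T) = h (\<phi> kum.T)"
    proof (rule S_eqI)
      fix x assume x: "x \<in> Rm"
      then have xC: "x \<in> C" using Rm_sub by auto
      have "L x (\<phi> (g kum.T)) = L x (g kum.T)" using \<phi>(2)[OF x c(1)] .
      also have "\<dots> = L x (h kum.T)" using component_eq_iff[OF gA hA xC] comp[OF x] by simp
      also have "\<dots> = L x (h (\<phi> kum.T))"
        using \<phi>(2)[OF x kum.T_closed] c by (intro L_compat[OF hA xC]) auto
      finally show "L x (\<phi> (g kum.T)) = L x (h (\<phi> kum.T))" .
    next
      fix x z assume x: "x \<in> C - Rm" and z: "z \<in> Z x"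
      have xC: "x \<in> C" using x by auto
      have hz: "perm h x z \<in> Z x" by (rule perm(1)[OF hA xC z])
      have "ev x z (\<phi> (g kum.T)) = perm g x (P x z)" using \<phi>(3)[OF x z c(1)] by (simp add: perm_def)
      also have "\<dots> = P x (perm h x z)" using P(2)[OF x z] by simp
      also have "\<dots> = ev x (P x (perm h x z)) kum.T"
        using ev_props(3)[OF xC bij_betw_apply[OF P(1)[OF x] hz]] by simp
      also have "\<dots> = ev x (perm h x z) (\<phi> kum.T)" using \<phi>(3)[OF x hz kum.T_closed] by simp
      also have "\<dots> = ev x z (h (\<phi> kum.T))" using perm(2)[OF hA xC z c(2)] by simp
      finally show "ev x z (\<phi> (g kum.T)) = ev x z (h (\<phi> kum.T))" .
    qed (use c A_props(3) hA \<phi>(1) in auto)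
    then show "(\<phi> \<otimes>\<^bsub>A\<^esub> g) kum.T = (h \<otimes>\<^bsub>A\<^esub> \<phi>) kum.T"
      using A_mult[OF \<phi>(1) gA kum.T_closed] A_mult[OF hA \<phi>(1) kum.T_closed] by simp
  qed (use gA hA \<phi>(1) in auto)
  then have "\<exists>\<tau>\<in>iso (A\<lparr>carrier := G1\<rparr>) (A\<lparr>carrier := G2\<rparr>). \<forall>x\<in>G1. \<phi> \<otimes>\<^bsub>A\<^esub> x = \<tau> x \<otimes>\<^bsub>A\<^esub> \<phi>"
    by (rule A.conjugation_iso[OF G1(1) G2(1) \<phi>(1) gA hA gp(2) hp(2)])
  then show "galois_conjugate R kum.S kum.emb G1 G2"
    unfolding galois_conjugate_def Let_def using \<phi>(1) by blast
qed

end

section \<open>Ramified Kummer extensions of a valued field\<close>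

text \<open>The valuation has a junk value at zero, so its laws are demanded for nonzero elements
  only.\<close>

locale valued_kummer = K?: field K for K (structure) +
  fixes v :: "'a \<Rightarrow> int" and p :: nat and t :: 'a
  assumes v_mult: "\<And>a b. a \<in> carrier K - {\<zero>} \<Longrightarrow> b \<in> carrier K - {\<zero>} \<Longrightarrow> v (a \<otimes> b) = v a + v b"
    and v_add: "\<And>a b. a \<in> carrier K - {\<zero>} \<Longrightarrow> b \<in> carrier K - {\<zero>} \<Longrightarrow> a \<oplus> b \<noteq> \<zero> \<Longrightarrow> min (v a) (v b) \<le> v (a \<oplus> b)"
    and t: "t \<in> carrier K - {\<zero>}" and p_prime: "Factorial_Ring.prime p" and nd: "\<not> int p dvd v t"
begin

sublocale kum: kummer K "UP K" p t
  using t p_prime K.is_cring by (simp add: kummer_def UP_cring_def kummer_axioms_def prime_gt_0_nat)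

lemma v_one: "v \<one> = 0"
  using v_mult[of \<one> \<one>] by simp

lemma pow_nonzero: "a \<in> carrier K - {\<zero>} \<Longrightarrow> a [^] (n::nat) \<noteq> \<zero>"
  by (induction n) (auto simp: K.integral_iff)

lemma v_pow: "a \<in> carrier K - {\<zero>} \<Longrightarrow> v (a [^] (n::nat)) = int n * v a"
proof (induction n)
  case (Suc n)
  have "a [^] n \<noteq> \<zero>" using Suc.prems pow_nonzero by simp
  then show ?case using v_mult[of "a [^] n" a] Suc by (simp add: algebra_simps)
qed (simp add: v_one)

lemma v_inv: "a \<in> carrier K - {\<zero>} \<Longrightarrow> v (inv a) = - v a"
proof -
  assume a: "a \<in> carrier K - {\<zero>}"
  then have u: "a \<in> Units K" using K.field_Units by auto
  then have "inv a \<in> carrier K - {\<zero>}" using K.Units_r_inv[OF u] a by fastforce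
  then show ?thesis using v_mult[OF a] K.Units_r_inv[OF u] v_one by fastforce
qed

text \<open>
  The weight \<open>p v(a) + i v(t)\<close> of \<open>a T\<^sup>i\<close> is \<open>p\<close> times its would-be valuation with \<open>v(T) = v(t)/p\<close>; since
  \<open>p\<close> does not divide \<open>v(t)\<close>, different \<open>i < p\<close> give different weights. Hence the leading term of a
  nonzero element is unique and leading terms multiply, so there are no zero divisors.
\<close>

definition ge :: "int \<Rightarrow> nat \<Rightarrow> 'a \<Rightarrow> bool" where
  "ge c i a \<longleftrightarrow> a = \<zero> \<or> c \<le> int p * v a + int i * v t"

text \<open>The decreasing filtration of the algebra by weight; it does the work of a valuation on
  the extension before that is known to be a domain.\<close>

definition F :: "int \<Rightarrow> (nat \<Rightarrow> 'a) set set" where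
  "F c = {kum.comb a | a. \<forall>i<p. a i \<in> carrier K \<and> ge c i (a i)}"

lemma F_sub: "F c \<subseteq> carrier kum.S"
  unfolding F_def by (auto intro!: kum.comb_closed)

lemma ge_add:
  assumes "a \<in> carrier K" "b \<in> carrier K" "ge c i a" "ge c i b"
  shows "ge c i (a \<oplus> b)"
proof (cases "a = \<zero> \<or> b = \<zero> \<or> a \<oplus> b = \<zero>")
  case True
  then show ?thesis using assms by (auto simp: ge_def)
next
  case False
  then have "min (v a) (v b) \<le> v (a \<oplus> b)" using assms by (intro v_add) auto
  then have "int p * v a \<le> int p * v (a \<oplus> b) \<or> int p * v b \<le> int p * v (a \<oplus> b)"
    using p_prime by (auto simp: min_def prime_gt_0_nat split: if_splits)
  then show ?thesis using assms False by (auto simp: ge_def)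
qed

lemma comb_add:
  assumes "\<And>i. i < p \<Longrightarrow> a i \<in> carrier K" "\<And>i. i < p \<Longrightarrow> b i \<in> carrier K"
  shows "kum.comb a \<oplus>\<^bsub>kum.S\<^esub> kum.comb b = kum.comb (\<lambda>i. a i \<oplus> b i)"
proof -
  have "kum.comb (\<lambda>i. a i \<oplus> b i) = (\<Oplus>\<^bsub>kum.S\<^esub>i\<in>{..<p}. (kum.emb (a i) \<otimes>\<^bsub>kum.S\<^esub> kum.T [^]\<^bsub>kum.S\<^esub> i) \<oplus>\<^bsub>kum.S\<^esub> (kum.emb (b i) \<otimes>\<^bsub>kum.S\<^esub> kum.T [^]\<^bsub>kum.S\<^esub> i))"
    unfolding kum.comb_def using assms by (intro kum.S.finsum_cong') (auto simp: kum.S.l_distr)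
  also have "\<dots> = kum.comb a \<oplus>\<^bsub>kum.S\<^esub> kum.comb b"
    unfolding kum.comb_def using assms by (intro kum.S.finsum_addf) auto
  finally show ?thesis by simp
qed

lemma F_add: "s \<in> F c \<Longrightarrow> r \<in> F c \<Longrightarrow> s \<oplus>\<^bsub>kum.S\<^esub> r \<in> F c"
proof -
  assume "s \<in> F c" "r \<in> F c"
  then obtain a b where ab: "\<forall>i<p. a i \<in> carrier K \<and> ge c i (a i)" "s = kum.comb a"
     "\<forall>i<p. b i \<in> carrier K \<and> ge c i (b i)" "r = kum.comb b" unfolding F_def by auto
  have "s \<oplus>\<^bsub>kum.S\<^esub> r = kum.comb (\<lambda>i. a i \<oplus> b i)" unfolding ab(2,4) using ab by (intro comb_add) auto
  moreover have "\<forall>i<p. a i \<oplus> b i \<in> carrier K \<and> ge c i (a i \<oplus> b i)" using ab ge_add by simp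
  ultimately show ?thesis unfolding F_def by blast
qed

lemma comb_single:
  assumes "i < p" "a \<in> carrier K"
  shows "kum.comb (\<lambda>j. if j = i then a else \<zero>) = kum.emb a \<otimes>\<^bsub>kum.S\<^esub> kum.T [^]\<^bsub>kum.S\<^esub> i"
proof -
  have "kum.comb (\<lambda>j. if j = i then a else \<zero>) = (\<Oplus>\<^bsub>kum.S\<^esub>j\<in>{..<p}. if i = j then kum.emb a \<otimes>\<^bsub>kum.S\<^esub> kum.T [^]\<^bsub>kum.S\<^esub> j else \<zero>\<^bsub>kum.S\<^esub>)"
    unfolding kum.comb_def using assms by (intro kum.S.finsum_cong') auto
  also have "\<dots> = kum.emb a \<otimes>\<^bsub>kum.S\<^esub> kum.T [^]\<^bsub>kum.S\<^esub> i"
    using assms by (intro kum.S.finsum_singleton) auto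
  finally show ?thesis .
qed

text \<open>Rewriting \<open>T^n\<close> with \<open>T^p = t\<close> preserves the weight: the
  factor \<open>t^q\<close> contributes \<open>p q v(t)\<close>, which is what lowering the exponent
  by \<open>p q\<close> takes away.\<close>

lemma F_monomial:
  assumes a: "a \<in> carrier K" "ge c n a"
  shows "kum.emb a \<otimes>\<^bsub>kum.S\<^esub> kum.T [^]\<^bsub>kum.S\<^esub> n \<in> F c"
proof -
  define q i where "q = n div p" and "i = n mod p"
  have ip: "i < p" and n: "n = p * q + i" using p_prime by (auto simp: q_def i_def prime_gt_0_nat)
  let ?b = "a \<otimes> t [^] q"
  have tq: "t [^] q \<in> carrier K" "t [^] q \<noteq> \<zero>" using t pow_nonzero by auto
  have b: "?b \<in> carrier K" using a tq by simp
  have "kum.T [^]\<^bsub>kum.S\<^esub> n = kum.emb (t [^] q) \<otimes>\<^bsub>kum.S\<^esub> kum.T [^]\<^bsub>kum.S\<^esub> i"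
    unfolding n using t by (simp add: kum.S.nat_pow_mult[symmetric] kum.S.nat_pow_pow[symmetric] kum.T_pow)
  then have e: "kum.emb a \<otimes>\<^bsub>kum.S\<^esub> kum.T [^]\<^bsub>kum.S\<^esub> n = kum.emb ?b \<otimes>\<^bsub>kum.S\<^esub> kum.T [^]\<^bsub>kum.S\<^esub> i"
    using a tq by (simp add: kum.S.m_assoc del: kum.emb.hom_pow)
  have "ge c i ?b"
  proof (cases "a = \<zero>")
    case False
    then have "v ?b = v a + int q * v t" using v_mult[of a "t [^] q"] a tq v_pow[OF t] by simp
    moreover have "int n = int p * int q + int i" unfolding n by simp
    ultimately have "int p * v ?b + int i * v t = int p * v a + int n * v t" by (simp add: algebra_simps)
    then show ?thesis using a False by (simp add: ge_def)
  qed (use tq in \<open>simp add: ge_def\<close>)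
  then show ?thesis unfolding e comb_single[OF ip b, symmetric] F_def using b by (intro CollectI exI conjI refl) (auto simp: ge_def)
qed

lemma F_zero: "\<zero>\<^bsub>kum.S\<^esub> \<in> F c"
  using F_monomial[of \<zero> c 0] by (simp add: ge_def)

lemma F_finsum: "(\<And>i. i \<in> I \<Longrightarrow> f i \<in> F c) \<Longrightarrow> finsum kum.S f I \<in> F c"
proof (induction I rule: infinite_finite_induct)
  case (insert i I)
  have "finsum kum.S f (insert i I) = f i \<oplus>\<^bsub>kum.S\<^esub> finsum kum.S f I"
    using insert F_sub by (intro kum.S.finsum_insert) auto
  then show ?case using insert F_add by simp
qed (simp_all add: F_zero)

lemma F_mult:
  assumes "s \<in> F c" "r \<in> F d"
  shows "s \<otimes>\<^bsub>kum.S\<^esub> r \<in> F (c + d)"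
proof -
  obtain a b where ab: "\<forall>i<p. a i \<in> carrier K \<and> ge c i (a i)" "s = kum.comb a"
     "\<forall>i<p. b i \<in> carrier K \<and> ge d i (b i)" "r = kum.comb b" using assms unfolding F_def by auto
  let ?m = "\<lambda>a i. kum.emb (a i) \<otimes>\<^bsub>kum.S\<^esub> kum.T [^]\<^bsub>kum.S\<^esub> (i::nat)"
  have rc: "r \<in> carrier kum.S" using assms F_sub by auto
  have "s \<otimes>\<^bsub>kum.S\<^esub> r = (\<Oplus>\<^bsub>kum.S\<^esub>i\<in>{..<p}. ?m a i \<otimes>\<^bsub>kum.S\<^esub> r)"
    unfolding ab(2) kum.comb_def using ab rc by (intro kum.S.finsum_ldistr) auto
  also have "\<dots> \<in> F (c + d)"
  proof (rule F_finsum)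
    fix i assume i: "i \<in> {..<p}"
    have ai: "a i \<in> carrier K" using ab i by auto
    have "?m a i \<otimes>\<^bsub>kum.S\<^esub> r = (\<Oplus>\<^bsub>kum.S\<^esub>j\<in>{..<p}. ?m a i \<otimes>\<^bsub>kum.S\<^esub> ?m b j)"
      unfolding ab(4) kum.comb_def using ab i by (intro kum.S.finsum_rdistr) auto
    also have "\<dots> \<in> F (c + d)"
    proof (rule F_finsum)
      fix j assume j: "j \<in> {..<p}"
      have bj: "b j \<in> carrier K" using ab j by auto
      have m: "?m a i \<otimes>\<^bsub>kum.S\<^esub> ?m b j = kum.emb (a i \<otimes> b j) \<otimes>\<^bsub>kum.S\<^esub> kum.T [^]\<^bsub>kum.S\<^esub> (i + j)"
        using ai bj by (simp add: kum.S.nat_pow_mult[symmetric] kum.S.m_ac)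
      have g: "ge (c + d) (i + j) (a i \<otimes> b j)"
      proof (cases "a i = \<zero> \<or> b j = \<zero>")
        case True
        then show ?thesis using ai bj by (auto simp: ge_def)
      next
        case False
        then have "v (a i \<otimes> b j) = v (a i) + v (b j)" using ai bj v_mult by auto
        moreover have "ge c i (a i)" "ge d j (b j)" using ab i j by auto
        ultimately show ?thesis using False by (simp add: ge_def algebra_simps)
      qed
      show "?m a i \<otimes>\<^bsub>kum.S\<^esub> ?m b j \<in> F (c + d)"
        unfolding m using ai bj g by (intro F_monomial) auto
    qed
    finally show "?m a i \<otimes>\<^bsub>kum.S\<^esub> r \<in> F (c + d)" .
  qed
  finally show ?thesis .
qed

lemma comb_inj:
  assumes "\<And>i. i < p \<Longrightarrow> a i \<in> carrier K" "\<And>i. i < p \<Longrightarrow> b i \<in> carrier K" "kum.comb a = kum.comb b" "i < p"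
  shows "a i = b i"
proof -
  let ?n = "\<lambda>i. \<ominus> b i"
  have "kum.comb (\<lambda>i. a i \<oplus> \<ominus> b i) = kum.comb b \<oplus>\<^bsub>kum.S\<^esub> kum.comb ?n"
    using comb_add[of a ?n] assms by simp
  also have "\<dots> = kum.comb (\<lambda>i. b i \<oplus> \<ominus> b i)" using comb_add[of b ?n] assms by simp
  also have "\<dots> = (\<Oplus>\<^bsub>kum.S\<^esub>i\<in>{..<p}. \<zero>\<^bsub>kum.S\<^esub>)"
    unfolding kum.comb_def using assms by (intro kum.S.finsum_cong') (auto simp: K.r_neg simp del: kum.emb.hom_add)
  finally have "a i \<oplus> \<ominus> b i = \<zero>" using kum.indep[of "\<lambda>i. a i \<oplus> \<ominus> b i" i] assms by simp
  then show ?thesis using assms(1,2,4) by (metis K.r_right_minus_eq a_minus_def)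
qed

text \<open>Among the nonzero coefficients one of minimal weight is split off; since this minimum is
  attained once, the rest has strictly larger weight.\<close>

lemma leading_term:
  assumes s: "s \<in> carrier kum.S" "s \<noteq> \<zero>\<^bsub>kum.S\<^esub>"
  obtains w i a s' where "i < p" "a \<in> carrier K - {\<zero>}" "w = int p * v a + int i * v t"
    "s = kum.emb a \<otimes>\<^bsub>kum.S\<^esub> kum.T [^]\<^bsub>kum.S\<^esub> i \<oplus>\<^bsub>kum.S\<^esub> s'" "s' \<in> F (w + 1)"
    "s \<in> F w" "s \<notin> F (w + 1)"
proof -
  obtain a where a: "a \<in> UNIV \<rightarrow> carrier K" "s = kum.comb a" using kum.span[OF s(1)] .
  have ac: "a i \<in> carrier K" for i using a(1) by auto
  let ?N = "{i. i < p \<and> a i \<noteq> \<zero>}"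
  let ?w = "\<lambda>i. int p * v (a i) + int i * v t"
  have "?N \<noteq> {}"
  proof
    assume "?N = {}"
    then have "s = (\<Oplus>\<^bsub>kum.S\<^esub>i\<in>{..<p}. \<zero>\<^bsub>kum.S\<^esub>)" unfolding a(2) kum.comb_def
      by (intro kum.S.finsum_cong') auto
    then show False using s(2) by simp
  qed
  moreover have "finite ?N" by simp
  ultimately obtain i where i: "i \<in> ?N" "\<And>j. j \<in> ?N \<Longrightarrow> ?w i \<le> ?w j"
    using ex_min_if_finite[of "?w ` ?N"] by (metis (mono_tags, lifting) arg_min_if_finite(1) arg_min_least)
  \<comment> \<open>Equal weights would make \<open>p\<close> divide \<open>(i - j) v(t)\<close>,
    hence \<open>i - j\<close>, which is impossible for distinct indices below
    \<open>p\<close>.\<close>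
  have strict: "?w i < ?w j" if j: "j \<in> ?N" "j \<noteq> i" for j
  proof -
    have "?w i \<noteq> ?w j"
    proof
      assume "?w i = ?w j"
      then have "(int i - int j) * v t = int p * (v (a j) - v (a i))" by (simp add: algebra_simps)
      then have "int p dvd (int i - int j) * v t" by simp
      then have "int p dvd int i - int j" using nd p_prime by (simp add: prime_dvd_mult_iff)
      moreover have "\<bar>int i - int j\<bar> < int p" using i(1) j(1) by auto
      ultimately show False using j(2) by (metis dvd_imp_le_int abs_of_nat diff_eq_eq add_0 not_le of_nat_eq_iff)
    qed
    then show ?thesis using i(2)[OF j(1)] by simp
  qed
  let ?b = "\<lambda>j. if j = i then \<zero> else a j"
  let ?m = "\<lambda>j. if j = i then a i else \<zero>"
  have ip: "i < p" "a i \<noteq> \<zero>" using i(1) by auto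
  have "kum.comb a = kum.comb (\<lambda>j. ?m j \<oplus> ?b j)" by (rule arg_cong[where f = kum.comb]) (use ac in auto)
  also have "\<dots> = kum.comb ?m \<oplus>\<^bsub>kum.S\<^esub> kum.comb ?b" using ac by (intro comb_add[symmetric]) auto
  also have "kum.comb ?m = kum.emb (a i) \<otimes>\<^bsub>kum.S\<^esub> kum.T [^]\<^bsub>kum.S\<^esub> i" by (rule comb_single[OF ip(1) ac])
  finally have se: "s = kum.emb (a i) \<otimes>\<^bsub>kum.S\<^esub> kum.T [^]\<^bsub>kum.S\<^esub> i \<oplus>\<^bsub>kum.S\<^esub> kum.comb ?b" using a(2) by simp
  have "ge (?w i + 1) j (?b j)" if "j < p" for j
    using strict[of j] that by (cases "j = i \<or> a j = \<zero>") (auto simp: ge_def)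
  then have b: "kum.comb ?b \<in> F (?w i + 1)" unfolding F_def using ac by (intro CollectI exI[of _ ?b] conjI refl) auto
  have "ge (?w i) j (a j)" if "j < p" for j using i(2)[of j] that by (auto simp: ge_def)
  then have sF: "s \<in> F (?w i)" unfolding F_def a(2) using ac by (intro CollectI exI[of _ a] conjI refl) auto
  have "s \<notin> F (?w i + 1)"
  proof
    assume "s \<in> F (?w i + 1)"
    then obtain c where c: "\<forall>j<p. c j \<in> carrier K \<and> ge (?w i + 1) j (c j)" "s = kum.comb c" unfolding F_def by auto
    then have "a i = c i" using comb_inj[of a c i] ac a(2) ip by auto
    then show False using c(1) ip by (auto simp: ge_def)
  qed
  then show ?thesis using that[OF ip(1) _ refl se b sF] ac ip by simp
qed

text \<open>The inverse of \<open>a T^i\<close> is the product of the inverses of \<open>a\<close>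
  and \<open>t^i\<close> with \<open>T^(i (p - 1))\<close>, and its weight is the negative
  one.\<close>

lemma monomial_inverse:
  assumes a: "a \<in> carrier K - {\<zero>}" and w: "w = int p * v a + int i * v t"
  obtains N where "N \<in> F (- w)" "N \<otimes>\<^bsub>kum.S\<^esub> (kum.emb a \<otimes>\<^bsub>kum.S\<^esub> kum.T [^]\<^bsub>kum.S\<^esub> i) = \<one>\<^bsub>kum.S\<^esub>"
proof -
  have u: "b \<in> carrier K - {\<zero>} \<Longrightarrow> inv b \<in> carrier K - {\<zero>} \<and> inv b \<otimes> b = \<one>" for b
    using K.field_Units K.Units_l_inv[of b] K.Units_inv_closed[of b] by fastforce
  let ?ti = "inv (t [^] i)"
  have ti: "t [^] i \<in> carrier K - {\<zero>}" using t pow_nonzero by auto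
  let ?b = "inv a \<otimes> ?ti"
  let ?N = "kum.emb ?b \<otimes>\<^bsub>kum.S\<^esub> kum.T [^]\<^bsub>kum.S\<^esub> (i * (p - 1))"
  have b: "?b \<in> carrier K" using u[OF a] u[OF ti] by simp
  have vb: "v ?b = - v a - int i * v t"
    using v_mult[of "inv a" ?ti] u[OF a] u[OF ti] v_inv[OF a] v_inv[OF ti] v_pow[OF t] by simp
  have ip: "int (i * (p - 1)) = int i * (int p - 1)" using prime_gt_0_nat[OF p_prime] by (simp add: of_nat_diff)
  have "ge (- w) (i * (p - 1)) ?b" unfolding ge_def vb w ip by (simp add: algebra_simps)
  then have NF: "?N \<in> F (- w)" by (rule F_monomial[OF b])
  have pi: "i * (p - 1) + i = p * i" using p_prime prime_gt_0_nat[of p] by (cases p) auto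
  have "?N \<otimes>\<^bsub>kum.S\<^esub> (kum.emb a \<otimes>\<^bsub>kum.S\<^esub> kum.T [^]\<^bsub>kum.S\<^esub> i)
      = kum.emb ?b \<otimes>\<^bsub>kum.S\<^esub> kum.emb a \<otimes>\<^bsub>kum.S\<^esub> (kum.T [^]\<^bsub>kum.S\<^esub> (i * (p - 1)) \<otimes>\<^bsub>kum.S\<^esub> kum.T [^]\<^bsub>kum.S\<^esub> i)"
    using kum.emb.hom_closed[OF b] kum.emb.hom_closed[of a] a kum.S.nat_pow_closed[OF kum.T_closed]
    by (simp add: kum.S.m_ac del: kum.emb.hom_mult)
  also have "kum.T [^]\<^bsub>kum.S\<^esub> (i * (p - 1)) \<otimes>\<^bsub>kum.S\<^esub> kum.T [^]\<^bsub>kum.S\<^esub> i = kum.emb (t [^] i)"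
    using t by (simp only: kum.S.nat_pow_mult[OF kum.T_closed] pi) (simp add: kum.S.nat_pow_pow[symmetric] kum.T_pow)
  also have "kum.emb ?b \<otimes>\<^bsub>kum.S\<^esub> kum.emb a \<otimes>\<^bsub>kum.S\<^esub> kum.emb (t [^] i) = kum.emb (?b \<otimes> a \<otimes> t [^] i)"
    using b a ti by (simp only: kum.emb.hom_mult K.m_closed Diff_iff)
  also have "?b \<otimes> a \<otimes> t [^] i = (inv a \<otimes> a) \<otimes> (?ti \<otimes> t [^] i)"
  proof -
    have "inv a \<in> carrier K" "?ti \<in> carrier K" "a \<in> carrier K" "t [^] i \<in> carrier K"
      using u[OF a] u[OF ti] a ti by auto
    then show ?thesis by algebra
  qed
  also have "\<dots> = \<one>" using u[OF a] u[OF ti] by simp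
  finally show ?thesis using that NF by simp
qed

text \<open>Multiply \<open>s r = 0\<close> by the inverse of the leading term of \<open>s\<close>.
  Then \<open>s\<close> becomes 1 plus something of weight at least 1, so \<open>r\<close> equals a
  multiple of itself of larger weight, against the exact weight of \<open>r\<close>.\<close>

lemma kummer_domain: "domain kum.S"
proof (rule domain.intro[OF kum.S_cring], rule domain_axioms.intro)
  show "\<one>\<^bsub>kum.S\<^esub> \<noteq> \<zero>\<^bsub>kum.S\<^esub>" using kum.emb_inj[of \<one>] by auto
  fix s r assume sr: "s \<otimes>\<^bsub>kum.S\<^esub> r = \<zero>\<^bsub>kum.S\<^esub>" "s \<in> carrier kum.S" "r \<in> carrier kum.S"
  show "s = \<zero>\<^bsub>kum.S\<^esub> \<or> r = \<zero>\<^bsub>kum.S\<^esub>"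
  proof (rule ccontr)
    assume "\<not> ?thesis"
    then have nz: "s \<noteq> \<zero>\<^bsub>kum.S\<^esub>" "r \<noteq> \<zero>\<^bsub>kum.S\<^esub>" by auto
    obtain w i a s' where s: "i < p" "a \<in> carrier K - {\<zero>}" "w = int p * v a + int i * v t"
      "s = kum.emb a \<otimes>\<^bsub>kum.S\<^esub> kum.T [^]\<^bsub>kum.S\<^esub> i \<oplus>\<^bsub>kum.S\<^esub> s'" "s' \<in> F (w + 1)"
      using leading_term[OF sr(2) nz(1)] by metis
    obtain e where r: "r \<in> F e" "r \<notin> F (e + 1)" using leading_term[OF sr(3) nz(2)] by metis
    obtain N where N: "N \<in> F (- w)" "N \<otimes>\<^bsub>kum.S\<^esub> (kum.emb a \<otimes>\<^bsub>kum.S\<^esub> kum.T [^]\<^bsub>kum.S\<^esub> i) = \<one>\<^bsub>kum.S\<^esub>"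
      using monomial_inverse[OF s(2,3)] .
    have c: "N \<in> carrier kum.S" "s' \<in> carrier kum.S" using N s F_sub by auto
    let ?M = "kum.emb a \<otimes>\<^bsub>kum.S\<^esub> kum.T [^]\<^bsub>kum.S\<^esub> i"
    have M: "?M \<in> carrier kum.S" using s by simp
    have "N \<otimes>\<^bsub>kum.S\<^esub> (s \<otimes>\<^bsub>kum.S\<^esub> r) = (N \<otimes>\<^bsub>kum.S\<^esub> ?M) \<otimes>\<^bsub>kum.S\<^esub> r \<oplus>\<^bsub>kum.S\<^esub> (N \<otimes>\<^bsub>kum.S\<^esub> s') \<otimes>\<^bsub>kum.S\<^esub> r"
      unfolding s(4) using c M sr(3) by algebra
    then have "r \<oplus>\<^bsub>kum.S\<^esub> (N \<otimes>\<^bsub>kum.S\<^esub> s') \<otimes>\<^bsub>kum.S\<^esub> r = \<zero>\<^bsub>kum.S\<^esub>"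
      unfolding N(2) sr(1) using c sr(3) by simp
    then have "r = (\<ominus>\<^bsub>kum.S\<^esub> (N \<otimes>\<^bsub>kum.S\<^esub> s')) \<otimes>\<^bsub>kum.S\<^esub> r"
      using c sr(3) kum.S.sum_zero_eq_neg by (simp add: kum.S.l_minus)
    also have "\<dots> = (kum.emb (\<ominus> \<one>) \<otimes>\<^bsub>kum.S\<^esub> (N \<otimes>\<^bsub>kum.S\<^esub> s')) \<otimes>\<^bsub>kum.S\<^esub> r"
      using c by (simp add: kum.S.l_minus)
    also have "\<dots> \<in> F (0 + (- w + (w + 1)) + e)"
    proof (intro F_mult N s r)
      \<comment> \<open>Twice this valuation is the valuation of 1.\<close>
      have "v (\<ominus> \<one>) = 0" using v_mult[of "\<ominus> \<one>" "\<ominus> \<one>"] v_one by (simp add: K.l_minus)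
      then show "kum.emb (\<ominus> \<one>) \<in> F 0" using F_monomial[of "\<ominus> \<one>" 0 0] by (simp add: ge_def)
    qed
    finally show False using r(2) by (simp add: add.commute)
  qed
qed

end

section \<open>Discrete valuation rings with roots of units\<close>

lemma (in cring) cgenideal_iff: "y \<in> PIdl x \<longleftrightarrow> (\<exists>a\<in>carrier R. y = a \<otimes> x)"
  by (auto simp: cgenideal_def)

lemma (in cring) cgenideal_prod:
  assumes a: "a \<in> carrier R" and b: "b \<in> carrier R"
  shows "ideal_prod R (PIdl a) (PIdl b) = PIdl (a \<otimes> b)"
proof
  show "ideal_prod R (PIdl a) (PIdl b) \<subseteq> PIdl (a \<otimes> b)"
  proof
    fix x assume "x \<in> ideal_prod R (PIdl a) (PIdl b)"
    then show "x \<in> PIdl (a \<otimes> b)"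
    proof (induction rule: ideal_prod.induct)
      case (prod i j)
      then obtain c d where cd: "c \<in> carrier R" "i = c \<otimes> a" "d \<in> carrier R" "j = d \<otimes> b"
        unfolding cgenideal_iff by blast
      then have "i \<otimes> j = (c \<otimes> d) \<otimes> (a \<otimes> b)" using a b by (simp add: m_ac)
      then show ?case unfolding cgenideal_iff using cd by blast
    next
      case (sum s1 s2)
      then show ?case
        by (intro additive_subgroup.a_closed[OF ideal.axioms(1)[OF cgenideal_ideal[OF m_closed[OF a b]]]])
    qed
  qed
  show "PIdl (a \<otimes> b) \<subseteq> ideal_prod R (PIdl a) (PIdl b)"
  proof
    fix x assume "x \<in> PIdl (a \<otimes> b)"
    then obtain c where c: "c \<in> carrier R" "x = (c \<otimes> a) \<otimes> b" using a b unfolding cgenideal_iff by (auto simp: m_assoc)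
    have "c \<otimes> a \<in> PIdl a" unfolding cgenideal_iff using c(1) by blast
    then show "x \<in> ideal_prod R (PIdl a) (PIdl b)" unfolding c(2) by (rule ideal_prod.prod[OF _ cgenideal_self[OF b]])
  qed
qed

lemma (in cring) ideal_pow_cgenideal:
  assumes "x \<in> carrier R"
  shows "ideal_pow R (PIdl x) n = PIdl (x [^] n)"
proof (induction n)
  case 0
  have "y \<in> carrier R \<longleftrightarrow> (\<exists>a\<in>carrier R. y = a \<otimes> \<one>)" for y by force
  then show ?case by (auto simp: cgenideal_iff)
next
  case (Suc n)
  then show ?case using cgenideal_prod[OF nat_pow_closed[OF assms] assms] by simp
qed

section \<open>Fraction fields\<close>

context domain
begin

text \<open>Transitivity cancels the middle denominator, which is nonzero in a domain.\<close>

lemma frac_rel_equiv: "equiv (carrier R \<times> (carrier R - {\<zero>})) (frac_rel R)"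
proof (rule equivI)
  show "frac_rel R \<subseteq> (carrier R \<times> (carrier R - {\<zero>})) \<times> (carrier R \<times> (carrier R - {\<zero>}))"
    by (auto simp: frac_rel_def)
  show "refl_on (carrier R \<times> (carrier R - {\<zero>})) (frac_rel R)"
    by (auto simp: refl_on_def frac_rel_def)
  show "sym (frac_rel R)" by (auto simp: sym_def frac_rel_def)
  show "trans (frac_rel R)"
  proof (rule transI)
    fix x y z assume xy: "(x, y) \<in> frac_rel R" and yz: "(y, z) \<in> frac_rel R"
    obtain a b c d e f where x: "x = (a, b)" "y = (c, d)" "z = (e, f)" by (cases x, cases y, cases z)
    have c: "a \<in> carrier R" "b \<in> carrier R" "b \<noteq> \<zero>" "c \<in> carrier R" "d \<in> carrier R" "d \<noteq> \<zero>"
      "e \<in> carrier R" "f \<in> carrier R" "f \<noteq> \<zero>" and eq: "a \<otimes> d = c \<otimes> b" "c \<otimes> f = e \<otimes> d"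
      using xy yz unfolding x frac_rel_def by auto
    have "d \<otimes> (a \<otimes> f) = (a \<otimes> d) \<otimes> f" using c by (simp add: m_ac)
    also have "\<dots> = (c \<otimes> f) \<otimes> b" unfolding eq(1) using c by (simp add: m_ac)
    also have "\<dots> = d \<otimes> (e \<otimes> b)" unfolding eq(2) using c by (simp add: m_ac)
    finally have "a \<otimes> f = e \<otimes> b" using c m_lcancel by auto
    then show "(x, z) \<in> frac_rel R" using c unfolding x frac_rel_def by auto
  qed
qed

lemma frac_eq_iff:
  assumes "a \<in> carrier R" "b \<in> carrier R - {\<zero>}" "c \<in> carrier R" "d \<in> carrier R - {\<zero>}"
  shows "frac R a b = frac R c d \<longleftrightarrow> a \<otimes> d = c \<otimes> b"
proof -
  have "frac R a b = frac R c d \<longleftrightarrow> ((a, b), (c, d)) \<in> frac_rel R"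
    unfolding frac_def using assms by (intro eq_equiv_class_iff[OF frac_rel_equiv]) auto
  then show ?thesis using assms by (auto simp: frac_rel_def)
qed

lemma mem_frac_iff:
  "(c, d) \<in> frac R a b \<longleftrightarrow> a \<in> carrier R \<and> b \<in> carrier R - {\<zero>} \<and> c \<in> carrier R \<and> d \<in> carrier R - {\<zero>} \<and> a \<otimes> d = c \<otimes> b"
  by (auto simp: frac_def frac_rel_def)

lemma frac_field_carrier:
  "z \<in> carrier (frac_field R) \<longleftrightarrow> (\<exists>a\<in>carrier R. \<exists>b\<in>carrier R - {\<zero>}. z = frac R a b)"
  by (auto simp: frac_field_def quotient_def frac_def)

lemma frac_closed [simp]: "a \<in> carrier R \<Longrightarrow> b \<in> carrier R \<Longrightarrow> b \<noteq> \<zero> \<Longrightarrow> frac R a b \<in> carrier (frac_field R)"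
  unfolding frac_field_carrier by blast

text \<open>The defining union runs over all representatives; every term is the same class and the
  index sets are nonempty, so the union is that class.\<close>

lemma frac_mult:
  assumes "a \<in> carrier R" "b \<in> carrier R - {\<zero>}" "c \<in> carrier R" "d \<in> carrier R - {\<zero>}"
  shows "frac R a b \<otimes>\<^bsub>frac_field R\<^esub> frac R c d = frac R (a \<otimes> c) (b \<otimes> d)"
proof -
  have 1: "frac R (a' \<otimes> c') (b' \<otimes> d') = frac R (a \<otimes> c) (b \<otimes> d)"
    if "(a', b') \<in> frac R a b" "(c', d') \<in> frac R c d" for a' b' c' d'
  proof -
    have h: "a' \<in> carrier R" "b' \<in> carrier R - {\<zero>}" "c' \<in> carrier R" "d' \<in> carrier R - {\<zero>}"
      "a \<otimes> b' = a' \<otimes> b" "c \<otimes> d' = c' \<otimes> d" using that by (auto simp: mem_frac_iff)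
    have "a' \<otimes> c' \<otimes> (b \<otimes> d) = (a' \<otimes> b) \<otimes> (c' \<otimes> d)" using h(1-4) assms by (simp add: m_ac)
    also have "\<dots> = a \<otimes> c \<otimes> (b' \<otimes> d')" unfolding h(5,6)[symmetric] using h(1-4) assms by (simp add: m_ac)
    finally show ?thesis using h assms by (subst frac_eq_iff) (auto simp: integral_iff)
  qed
  have 2: "(a, b) \<in> frac R a b" "(c, d) \<in> frac R c d" using assms by (auto simp: mem_frac_iff)
  have "frac R a b \<otimes>\<^bsub>frac_field R\<^esub> frac R c d =
     (\<Union>x\<in>frac R a b. \<Union>y\<in>frac R c d. frac R (a \<otimes> c) (b \<otimes> d))"
    unfolding frac_field_def using 1 by (auto simp: split_beta)
  also have "\<dots> = frac R (a \<otimes> c) (b \<otimes> d)" using 2 by blast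
  finally show ?thesis .
qed

lemma frac_add:
  assumes "a \<in> carrier R" "b \<in> carrier R - {\<zero>}" "c \<in> carrier R" "d \<in> carrier R - {\<zero>}"
  shows "frac R a b \<oplus>\<^bsub>frac_field R\<^esub> frac R c d = frac R (a \<otimes> d \<oplus> c \<otimes> b) (b \<otimes> d)"
proof -
  have 1: "frac R (a' \<otimes> d' \<oplus> c' \<otimes> b') (b' \<otimes> d') = frac R (a \<otimes> d \<oplus> c \<otimes> b) (b \<otimes> d)"
    if "(a', b') \<in> frac R a b" "(c', d') \<in> frac R c d" for a' b' c' d'
  proof -
    have h: "a' \<in> carrier R" "b' \<in> carrier R - {\<zero>}" "c' \<in> carrier R" "d' \<in> carrier R - {\<zero>}"
      "a \<otimes> b' = a' \<otimes> b" "c \<otimes> d' = c' \<otimes> d" using that by (auto simp: mem_frac_iff)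
    have "(a' \<otimes> d' \<oplus> c' \<otimes> b') \<otimes> (b \<otimes> d) = (a' \<otimes> b) \<otimes> (d \<otimes> d') \<oplus> (c' \<otimes> d) \<otimes> (b \<otimes> b')"
      using h(1-4) assms by (simp add: m_ac l_distr r_distr)
    also have "\<dots> = (a \<otimes> d \<oplus> c \<otimes> b) \<otimes> (b' \<otimes> d')" unfolding h(5,6)[symmetric] using h(1-4) assms by (simp add: m_ac l_distr r_distr)
    finally show ?thesis using h assms by (subst frac_eq_iff) (auto simp: integral_iff)
  qed
  have 2: "(a, b) \<in> frac R a b" "(c, d) \<in> frac R c d" using assms by (auto simp: mem_frac_iff)
  have "frac R a b \<oplus>\<^bsub>frac_field R\<^esub> frac R c d =
     (\<Union>x\<in>frac R a b. \<Union>y\<in>frac R c d. frac R (a \<otimes> d \<oplus> c \<otimes> b) (b \<otimes> d))"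
    unfolding frac_field_def using 1 by (auto simp: split_beta)
  also have "\<dots> = frac R (a \<otimes> d \<oplus> c \<otimes> b) (b \<otimes> d)" using 2 by blast
  finally show ?thesis .
qed

lemma frac_field_one: "\<one>\<^bsub>frac_field R\<^esub> = frac R \<one> \<one>" and frac_field_zero: "\<zero>\<^bsub>frac_field R\<^esub> = frac R \<zero> \<one>"
  by (simp_all add: frac_field_def)

lemma frac_field_cases:
  assumes "z \<in> carrier (frac_field R)"
  obtains a b where "a \<in> carrier R" "b \<in> carrier R" "b \<noteq> \<zero>" "z = frac R a b"
  using assms unfolding frac_field_carrier by blast

lemma frac_field_field: "field (frac_field R)"
proof -
  let ?K = "frac_field R"
  have cr: "cring ?K"
  proof (rule cringI)
    show "abelian_group ?K"
    proof (rule abelian_groupI)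
      show "\<zero>\<^bsub>?K\<^esub> \<in> carrier ?K" unfolding frac_field_zero by simp
      fix x assume "x \<in> carrier ?K"
      then obtain a b where x: "a \<in> carrier R" "b \<in> carrier R" "b \<noteq> \<zero>" "x = frac R a b" by (rule frac_field_cases)
      show "\<zero>\<^bsub>?K\<^esub> \<oplus>\<^bsub>?K\<^esub> x = x" unfolding frac_field_zero x(4) using x(1-3) by (simp add: frac_add)
      have "frac R (\<ominus> a) b \<oplus>\<^bsub>?K\<^esub> x = \<zero>\<^bsub>?K\<^esub>" unfolding frac_field_zero x(4) using x(1-3)
        by (simp add: frac_add frac_eq_iff integral_iff l_minus l_neg)
      then show "\<exists>y\<in>carrier ?K. y \<oplus>\<^bsub>?K\<^esub> x = \<zero>\<^bsub>?K\<^esub>" using x by (intro bexI[of _ "frac R (\<ominus> a) b"]) auto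
      fix y assume "y \<in> carrier ?K"
      then obtain c d where y: "c \<in> carrier R" "d \<in> carrier R" "d \<noteq> \<zero>" "y = frac R c d" by (rule frac_field_cases)
      show "x \<oplus>\<^bsub>?K\<^esub> y \<in> carrier ?K" unfolding x(4) y(4) using x(1-3) y(1-3) by (simp add: frac_add integral_iff)
      show "x \<oplus>\<^bsub>?K\<^esub> y = y \<oplus>\<^bsub>?K\<^esub> x" unfolding x(4) y(4) using x(1-3) y(1-3) by (simp add: frac_add a_comm m_comm)
      fix z assume "z \<in> carrier ?K"
      then obtain e f where z: "e \<in> carrier R" "f \<in> carrier R" "f \<noteq> \<zero>" "z = frac R e f" by (rule frac_field_cases)
      show "x \<oplus>\<^bsub>?K\<^esub> y \<oplus>\<^bsub>?K\<^esub> z = x \<oplus>\<^bsub>?K\<^esub> (y \<oplus>\<^bsub>?K\<^esub> z)" unfolding x(4) y(4) z(4) using x(1-3) y(1-3) z(1-3)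
        by (simp add: frac_add integral_iff l_distr r_distr m_ac a_ac)
    qed
    show "Group.comm_monoid ?K"
    proof (rule comm_monoidI)
      show "\<one>\<^bsub>?K\<^esub> \<in> carrier ?K" unfolding frac_field_one by simp
      fix x assume "x \<in> carrier ?K"
      then obtain a b where x: "a \<in> carrier R" "b \<in> carrier R" "b \<noteq> \<zero>" "x = frac R a b" by (rule frac_field_cases)
      show "\<one>\<^bsub>?K\<^esub> \<otimes>\<^bsub>?K\<^esub> x = x" unfolding frac_field_one x(4) using x(1-3) by (simp add: frac_mult)
      fix y assume "y \<in> carrier ?K"
      then obtain c d where y: "c \<in> carrier R" "d \<in> carrier R" "d \<noteq> \<zero>" "y = frac R c d" by (rule frac_field_cases)
      show "x \<otimes>\<^bsub>?K\<^esub> y \<in> carrier ?K" unfolding x(4) y(4) using x(1-3) y(1-3) by (simp add: frac_mult integral_iff)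
      show "x \<otimes>\<^bsub>?K\<^esub> y = y \<otimes>\<^bsub>?K\<^esub> x" unfolding x(4) y(4) using x(1-3) y(1-3) by (simp add: frac_mult m_comm)
      fix z assume "z \<in> carrier ?K"
      then obtain e f where z: "e \<in> carrier R" "f \<in> carrier R" "f \<noteq> \<zero>" "z = frac R e f" by (rule frac_field_cases)
      show "x \<otimes>\<^bsub>?K\<^esub> y \<otimes>\<^bsub>?K\<^esub> z = x \<otimes>\<^bsub>?K\<^esub> (y \<otimes>\<^bsub>?K\<^esub> z)" unfolding x(4) y(4) z(4) using x(1-3) y(1-3) z(1-3)
        by (simp add: frac_mult integral_iff m_ac)
    qed
    fix x y z assume "x \<in> carrier ?K" "y \<in> carrier ?K" "z \<in> carrier ?K"
    then obtain a b c d e f where x: "a \<in> carrier R" "b \<in> carrier R" "b \<noteq> \<zero>" "x = frac R a b"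
      and y: "c \<in> carrier R" "d \<in> carrier R" "d \<noteq> \<zero>" "y = frac R c d"
      and z: "e \<in> carrier R" "f \<in> carrier R" "f \<noteq> \<zero>" "z = frac R e f" by (elim frac_field_cases)
    show "(x \<oplus>\<^bsub>?K\<^esub> y) \<otimes>\<^bsub>?K\<^esub> z = x \<otimes>\<^bsub>?K\<^esub> z \<oplus>\<^bsub>?K\<^esub> y \<otimes>\<^bsub>?K\<^esub> z"
      unfolding x(4) y(4) z(4) using x(1-3) y(1-3) z(1-3)
      by (simp add: frac_add frac_mult frac_eq_iff integral_iff l_distr r_distr m_ac)
  qed
  show ?thesis
  proof (rule cring.cring_fieldI2[OF cr])
    show "\<zero>\<^bsub>?K\<^esub> \<noteq> \<one>\<^bsub>?K\<^esub>" by (simp add: frac_field_one frac_field_zero frac_eq_iff)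
    fix x assume "x \<in> carrier ?K" "x \<noteq> \<zero>\<^bsub>?K\<^esub>"
    then obtain a b where x: "a \<in> carrier R" "b \<in> carrier R" "b \<noteq> \<zero>" "x = frac R a b" "frac R a b \<noteq> \<zero>\<^bsub>?K\<^esub>"
      by (metis frac_field_cases)
    then have a: "a \<noteq> \<zero>" by (auto simp: frac_field_zero frac_eq_iff)
    have "x \<otimes>\<^bsub>?K\<^esub> frac R b a = \<one>\<^bsub>?K\<^esub>" unfolding x(4) frac_field_one using x(1-3) a
      by (simp add: frac_mult frac_eq_iff integral_iff m_comm)
    then show "\<exists>y\<in>carrier ?K. x \<otimes>\<^bsub>?K\<^esub> y = \<one>\<^bsub>?K\<^esub>" using x a by (intro bexI[of _ "frac R b a"]) auto
  qed
qed

lemma frac_embed_hom: "(\<lambda>a. frac R a \<one>) \<in> ring_hom R (frac_field R)"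
  by (rule ring_hom_memI) (auto simp: frac_mult frac_add frac_field_one)

lemma frac_embed_inj: "a \<in> carrier R \<Longrightarrow> b \<in> carrier R \<Longrightarrow> frac R a \<one> = frac R b \<one> \<longleftrightarrow> a = b"
  by (simp add: frac_eq_iff)

lemma frac_embed_subring: "subring ((\<lambda>a. frac R a \<one>) ` carrier R) (frac_field R)"
proof -
  interpret K: field "frac_field R" by (rule frac_field_field)
  interpret h: ring_hom_cring R "frac_field R" "\<lambda>a. frac R a \<one>" by unfold_locales (rule frac_embed_hom)
  show ?thesis
  proof (rule K.subringI)
    show "\<one>\<^bsub>frac_field R\<^esub> \<in> (\<lambda>a. frac R a \<one>) ` carrier R" by (rule image_eqI[of _ _ \<one>]) simp_all
    fix x assume "x \<in> (\<lambda>a. frac R a \<one>) ` carrier R"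
    then obtain a where a: "a \<in> carrier R" "x = frac R a \<one>" by auto
    show "\<ominus>\<^bsub>frac_field R\<^esub> x \<in> (\<lambda>a. frac R a \<one>) ` carrier R"
      unfolding a(2) h.hom_a_inv[OF a(1), symmetric] by (rule imageI) (use a(1) in simp)
    fix y assume "y \<in> (\<lambda>a. frac R a \<one>) ` carrier R"
    then obtain b where b: "b \<in> carrier R" "y = frac R b \<one>" by auto
    show "x \<otimes>\<^bsub>frac_field R\<^esub> y \<in> (\<lambda>a. frac R a \<one>) ` carrier R"
      unfolding a(2) b(2) h.hom_mult[OF a(1) b(1), symmetric] by (rule imageI) (use a(1) b(1) in simp)
    show "x \<oplus>\<^bsub>frac_field R\<^esub> y \<in> (\<lambda>a. frac R a \<one>) ` carrier R"
      unfolding a(2) b(2) h.hom_add[OF a(1) b(1), symmetric] by (rule imageI) (use a(1) b(1) in simp)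
  qed auto
qed

end

section \<open>Valuation and roots in the fraction field\<close>

text \<open>The properties that the completed local ring will have. \<open>factor\<close> says that
  it is a discrete valuation ring, \<open>pth_root\<close> is the outcome of Hensel's lemma, and the
  powers of \<open>\<zeta>\<close> will be all \<open>p\<close>-th roots of unity.\<close>

locale pth_root_dvr = domain +
  fixes \<pi> and p :: nat and \<zeta>
  assumes pi: "\<pi> \<in> carrier R" "\<pi> \<noteq> \<zero>" "nonunits R = PIdl \<pi>"
    and factor: "\<And>a. a \<in> carrier R \<Longrightarrow> a \<noteq> \<zero> \<Longrightarrow> \<exists>u\<in>Units R. \<exists>n::nat. a = u \<otimes> \<pi> [^] n"
    and prime_p: "Factorial_Ring.prime p"
    and pth_root: "\<And>u. u \<in> Units R \<Longrightarrow> \<exists>v\<in>carrier R. v [^] p = u"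
    and p_unit: "add_pow R p \<one> \<in> Units R"
    and zeta: "\<zeta> \<in> carrier R" "\<zeta> [^] p = \<one>" "\<zeta> \<noteq> \<one>"
begin

abbreviation "K \<equiv> frac_field R"
abbreviation "val \<equiv> dvr_val R"

lemma pi_pow: "\<pi> [^] (n::nat) \<in> carrier R" "\<pi> [^] n \<noteq> \<zero>"
  using pi by (induction n) (auto simp: integral_iff)

lemma ideal_pow_eq: "ideal_pow R (nonunits R) n = PIdl (\<pi> [^] n)"
  unfolding pi(3) by (rule ideal_pow_cgenideal[OF pi(1)])

text \<open>It gives the \<open>THE\<close> in \<open>dvr_val\<close> a unique candidate.\<close>

lemma unit_pi_in_ideal_pow:
  assumes "u \<in> Units R"
  shows "u \<otimes> \<pi> [^] n \<in> ideal_pow R (nonunits R) m \<longleftrightarrow> m \<le> n"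
proof
  assume "m \<le> n"
  then have "\<pi> [^] n = \<pi> [^] (n - m) \<otimes> \<pi> [^] m" using pi(1) by (simp add: nat_pow_mult)
  then have "u \<otimes> \<pi> [^] n = (u \<otimes> \<pi> [^] (n - m)) \<otimes> \<pi> [^] m"
    using Units_closed[OF assms] pi_pow(1) by (simp add: m_assoc)
  moreover have "u \<otimes> \<pi> [^] (n - m) \<in> carrier R" by (intro m_closed Units_closed[OF assms] pi_pow(1))
  ultimately show "u \<otimes> \<pi> [^] n \<in> ideal_pow R (nonunits R) m" unfolding ideal_pow_eq cgenideal_def by blast
next
  assume "u \<otimes> \<pi> [^] n \<in> ideal_pow R (nonunits R) m"
  then obtain a where a: "a \<in> carrier R" "u \<otimes> \<pi> [^] n = a \<otimes> \<pi> [^] m" unfolding ideal_pow_eq cgenideal_def by blast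
  show "m \<le> n"
  proof (rule ccontr)
    assume "\<not> m \<le> n"
    \<comment> \<open>With \<open>n < m\<close>, cancelling \<open>\<pi>^n\<close> leaves a factor
      \<open>\<pi>\<close> in the unit \<open>u\<close>.\<close>
    then have "m = Suc (m - n - 1) + n" by simp
    then have "\<pi> [^] m = \<pi> [^] (Suc (m - n - 1) + n)" by (rule arg_cong)
    also have "\<dots> = (\<pi> [^] (m - n - 1) \<otimes> \<pi>) \<otimes> \<pi> [^] n" using nat_pow_mult[OF pi(1)] by (simp only: nat_pow_Suc[symmetric])
    finally have "u \<otimes> \<pi> [^] n = (a \<otimes> \<pi> [^] (m - n - 1) \<otimes> \<pi>) \<otimes> \<pi> [^] n" using a pi pi_pow by (simp add: m_assoc)
    then have "u = a \<otimes> \<pi> [^] (m - n - 1) \<otimes> \<pi>" using a pi pi_pow assms m_rcancel by (metis Units_closed m_closed)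
    then have "u \<in> PIdl \<pi>" using a pi_pow unfolding cgenideal_def by blast
    then show False using assms pi(3) by (auto simp: nonunits_def)
  qed
qed

lemma val_eq:
  assumes "u \<in> Units R"
  shows "val (u \<otimes> \<pi> [^] n) = n"
  unfolding dvr_val_def
proof (rule the_equality)
  show "u \<otimes> \<pi> [^] n \<in> ideal_pow R (nonunits R) n \<and> u \<otimes> \<pi> [^] n \<notin> ideal_pow R (nonunits R) (Suc n)"
    unfolding unit_pi_in_ideal_pow[OF assms] by simp
  fix m assume "u \<otimes> \<pi> [^] n \<in> ideal_pow R (nonunits R) m \<and> u \<otimes> \<pi> [^] n \<notin> ideal_pow R (nonunits R) (Suc m)"
  then show "m = n" unfolding unit_pi_in_ideal_pow[OF assms] by simp
qed

lemma val_ge_iff: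
  assumes "a \<in> carrier R" "a \<noteq> \<zero>"
  shows "n \<le> val a \<longleftrightarrow> a \<in> PIdl (\<pi> [^] n)"
proof -
  obtain u m where u: "u \<in> Units R" "a = u \<otimes> \<pi> [^] (m::nat)" using factor[OF assms] by blast
  show ?thesis unfolding u(2) val_eq[OF u(1)] ideal_pow_eq[symmetric] unit_pi_in_ideal_pow[OF u(1)] ..
qed

lemma val_mult:
  assumes "a \<in> carrier R - {\<zero>}" "b \<in> carrier R - {\<zero>}"
  shows "val (a \<otimes> b) = val a + val b"
proof -
  obtain u m w n where u: "u \<in> Units R" "a = u \<otimes> \<pi> [^] (m::nat)" "w \<in> Units R" "b = w \<otimes> \<pi> [^] (n::nat)"
    using factor assms by (metis Diff_iff singletonI)
  have "a \<otimes> b = (u \<otimes> w) \<otimes> (\<pi> [^] m \<otimes> \<pi> [^] n)" unfolding u(2,4) using Units_closed[OF u(1)] Units_closed[OF u(3)] pi_pow(1) by (simp add: m_ac)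
  then have "a \<otimes> b = (u \<otimes> w) \<otimes> \<pi> [^] (m + n)" using pi by (simp add: nat_pow_mult)
  then show ?thesis using u val_eq by simp
qed

lemma val_add:
  assumes "a \<in> carrier R - {\<zero>}" "b \<in> carrier R - {\<zero>}" "a \<oplus> b \<noteq> \<zero>"
  shows "min (val a) (val b) \<le> val (a \<oplus> b)"
proof -
  let ?m = "min (val a) (val b)"
  have "a \<in> PIdl (\<pi> [^] ?m)" "b \<in> PIdl (\<pi> [^] ?m)" using assms val_ge_iff[of a ?m] val_ge_iff[of b ?m] by auto
  then have "a \<oplus> b \<in> PIdl (\<pi> [^] ?m)" using pi_pow additive_subgroup.a_closed[OF ideal.axioms(1)[OF cgenideal_ideal]] by blast
  then show ?thesis using assms val_ge_iff[of "a \<oplus> b" ?m] by simp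
qed

text \<open>Two representatives satisfy \<open>a d = c b\<close>, and multiplicativity of
  \<open>val\<close> makes the two differences equal.\<close>

lemma frac_val_eq:
  assumes "a \<in> carrier R - {\<zero>}" "b \<in> carrier R - {\<zero>}"
  shows "frac_val R (frac R a b) = int (val a) - int (val b)"
  unfolding frac_val_def
proof (rule the_equality)
  show "\<exists>(c, d)\<in>frac R a b. int (val a) - int (val b) = int (val c) - int (val d)"
    using assms by (intro bexI[of _ "(a, b)"]) (auto simp: mem_frac_iff)
  fix k assume "\<exists>(c, d)\<in>frac R a b. k = int (val c) - int (val d)"
  then obtain c d where cd: "(c, d) \<in> frac R a b" "k = int (val c) - int (val d)" by auto
  then have h: "c \<in> carrier R" "d \<in> carrier R - {\<zero>}" "a \<otimes> d = c \<otimes> b" by (auto simp: mem_frac_iff)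
  then have c0: "c \<in> carrier R - {\<zero>}" using assms by (auto simp: integral_iff)
  have "val a + val d = val c + val b" using h(3) val_mult[OF assms(1) h(2)] val_mult[OF c0 assms(2)] by simp
  then show "k = int (val a) - int (val b)" using cd(2) by simp
qed

lemma K_nonzero_cases:
  assumes "z \<in> carrier K - {\<zero>\<^bsub>K\<^esub>}"
  obtains a b where "a \<in> carrier R - {\<zero>}" "b \<in> carrier R - {\<zero>}" "z = frac R a b"
proof -
  obtain a b where z: "a \<in> carrier R" "b \<in> carrier R" "b \<noteq> \<zero>" "z = frac R a b" using assms frac_field_cases by blast
  moreover have "a \<noteq> \<zero>" using assms z by (auto simp: frac_field_zero frac_eq_iff)
  ultimately show ?thesis using that by auto
qed

lemma frac_val_mult:
  assumes "x \<in> carrier K - {\<zero>\<^bsub>K\<^esub>}" "y \<in> carrier K - {\<zero>\<^bsub>K\<^esub>}"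
  shows "frac_val R (x \<otimes>\<^bsub>K\<^esub> y) = frac_val R x + frac_val R y"
proof -
  obtain a b c d where h: "a \<in> carrier R - {\<zero>}" "b \<in> carrier R - {\<zero>}" "x = frac R a b"
    "c \<in> carrier R - {\<zero>}" "d \<in> carrier R - {\<zero>}" "y = frac R c d" using assms by (metis K_nonzero_cases)
  have "a \<otimes> c \<in> carrier R - {\<zero>}" "b \<otimes> d \<in> carrier R - {\<zero>}" using h by (auto simp: integral_iff)
  then show ?thesis unfolding h(3,6) using h by (simp add: frac_mult frac_val_eq val_mult)
qed

lemma frac_val_add:
  assumes "x \<in> carrier K - {\<zero>\<^bsub>K\<^esub>}" "y \<in> carrier K - {\<zero>\<^bsub>K\<^esub>}" "x \<oplus>\<^bsub>K\<^esub> y \<noteq> \<zero>\<^bsub>K\<^esub>"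
  shows "min (frac_val R x) (frac_val R y) \<le> frac_val R (x \<oplus>\<^bsub>K\<^esub> y)"
proof -
  obtain a b c d where h: "a \<in> carrier R - {\<zero>}" "b \<in> carrier R - {\<zero>}" "x = frac R a b"
    "c \<in> carrier R - {\<zero>}" "d \<in> carrier R - {\<zero>}" "y = frac R c d" using assms by (metis K_nonzero_cases)
  have n: "a \<otimes> d \<in> carrier R - {\<zero>}" "c \<otimes> b \<in> carrier R - {\<zero>}" "b \<otimes> d \<in> carrier R - {\<zero>}" using h by (auto simp: integral_iff)
  have s: "x \<oplus>\<^bsub>K\<^esub> y = frac R (a \<otimes> d \<oplus> c \<otimes> b) (b \<otimes> d)" unfolding h(3,6) using h by (simp add: frac_add)
  have nz: "a \<otimes> d \<oplus> c \<otimes> b \<noteq> \<zero>" using assms(3) n unfolding s by (auto simp: frac_field_zero frac_eq_iff)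
  have "min (val (a \<otimes> d)) (val (c \<otimes> b)) \<le> val (a \<otimes> d \<oplus> c \<otimes> b)" by (rule val_add[OF n(1,2) nz])
  moreover have "frac_val R (x \<oplus>\<^bsub>K\<^esub> y) = int (val (a \<otimes> d \<oplus> c \<otimes> b)) - int (val (b \<otimes> d))"
    unfolding s using nz n by (intro frac_val_eq) auto
  ultimately show ?thesis using h val_mult n by (auto simp: frac_val_eq)
qed

abbreviation "OK \<equiv> (\<lambda>a. frac R a \<one>) ` carrier R"

text \<open>If the valuation is nonnegative, the numerator is divisible by the power of
  \<open>\<pi>\<close> in the denominator, whose remaining factor is a unit.\<close>

lemma OK_iff:
  assumes "z \<in> carrier K - {\<zero>\<^bsub>K\<^esub>}"
  shows "z \<in> OK \<longleftrightarrow> 0 \<le> frac_val R z"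
proof
  assume "z \<in> OK"
  then obtain a where a: "a \<in> carrier R" "z = frac R a \<one>" by auto
  then have "a \<noteq> \<zero>" using assms by (auto simp: frac_field_zero)
  moreover have "val \<one> = 0" using val_mult[of \<one> \<one>] by simp
  ultimately show "0 \<le> frac_val R z" using a by (simp add: frac_val_eq)
next
  assume v: "0 \<le> frac_val R z"
  obtain a b where h: "a \<in> carrier R - {\<zero>}" "b \<in> carrier R - {\<zero>}" "z = frac R a b" using K_nonzero_cases[OF assms] .
  obtain u n where u: "u \<in> Units R" "b = u \<otimes> \<pi> [^] (n::nat)" using factor[of b] h(2) by blast
  have "n \<le> val a" using v h val_eq[OF u(1), of n] u(2) by (simp add: frac_val_eq)
  then obtain c where c: "c \<in> carrier R" "a = c \<otimes> \<pi> [^] n" using h val_ge_iff[of a n] by (auto simp: cgenideal_def)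
  have "a = (c \<otimes> inv u) \<otimes> b"
  proof -
    have "(c \<otimes> inv u) \<otimes> b = c \<otimes> (inv u \<otimes> u) \<otimes> \<pi> [^] n"
      unfolding u(2) using Units_closed[OF u(1)] Units_inv_closed[OF u(1)] c(1) pi_pow(1)
      by (simp add: m_assoc del: Units_l_inv)
    then show ?thesis using u c by simp
  qed
  then have "z = frac R (c \<otimes> inv u) \<one>" unfolding h(3) using h u c by (subst frac_eq_iff) auto
  then show "z \<in> OK" using c u by auto
qed

lemma K_field: "field K" by (rule frac_field_field)

sublocale K: field K by (rule K_field)

sublocale fr: ring_hom_cring R K "\<lambda>a. frac R a \<one>" by unfold_locales (rule frac_embed_hom)

lemma frac_val_pow:
  assumes "z \<in> carrier K - {\<zero>\<^bsub>K\<^esub>}"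
  shows "z [^]\<^bsub>K\<^esub> (n::nat) \<noteq> \<zero>\<^bsub>K\<^esub> \<and> frac_val R (z [^]\<^bsub>K\<^esub> n) = int n * frac_val R z"
proof (induction n)
  case 0
  have "frac_val R \<one>\<^bsub>K\<^esub> = 0" using frac_val_mult[of "\<one>\<^bsub>K\<^esub>" "\<one>\<^bsub>K\<^esub>"] by simp
  then show ?case by simp
next
  case (Suc n)
  then show ?case using assms frac_val_mult[of "z [^]\<^bsub>K\<^esub> n" z] K.integral[of "z [^]\<^bsub>K\<^esub> n" z] by (auto simp: algebra_simps)
qed

text \<open>The valuation of the \<open>p\<close>-th power is \<open>p\<close> times that of
  \<open>z\<close>, so both have the same sign.\<close>

lemma OK_root_closed:
  assumes "z \<in> carrier K" "z [^]\<^bsub>K\<^esub> p \<in> OK"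
  shows "z \<in> OK"
proof (cases "z = \<zero>\<^bsub>K\<^esub>")
  case True
  then show ?thesis unfolding True frac_field_zero by (intro imageI) simp
next
  case False
  then have z: "z \<in> carrier K - {\<zero>\<^bsub>K\<^esub>}" using assms by simp
  have "z [^]\<^bsub>K\<^esub> p \<in> carrier K - {\<zero>\<^bsub>K\<^esub>}" using frac_val_pow[OF z, of p] assms by simp
  then have "0 \<le> int p * frac_val R z" using OK_iff assms(2) frac_val_pow[OF z, of p] by simp
  then show ?thesis using OK_iff[OF z] prime_gt_0_nat[OF prime_p] by (simp add: zero_le_mult_iff)
qed

lemma OK_subring: "subring OK K" by (rule frac_embed_subring)

lemma OK_p_inverse: "\<exists>q\<in>OK. add_pow K p \<one>\<^bsub>K\<^esub> \<otimes>\<^bsub>K\<^esub> q = \<one>\<^bsub>K\<^esub>"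
proof -
  have *: "add_pow K n \<one>\<^bsub>K\<^esub> = frac R (add_pow R n \<one>) \<one>" for n :: nat
    by (induction n) (simp_all add: add.nat_pow_Suc K.add.nat_pow_Suc)
  have "frac R (add_pow R p \<one>) \<one> \<otimes>\<^bsub>K\<^esub> frac R (inv (add_pow R p \<one>)) \<one> = frac R (add_pow R p \<one> \<otimes> inv (add_pow R p \<one>)) \<one>"
    by (rule fr.hom_mult[symmetric]) (use p_unit in auto)
  also have "\<dots> = \<one>\<^bsub>K\<^esub>" unfolding Units_r_inv[OF p_unit] by simp
  finally show ?thesis unfolding * using p_unit by (intro bexI[of _ "frac R (inv (add_pow R p \<one>)) \<one>"]) auto
qed

text \<open>The first \<open>p\<close> powers of \<open>\<zeta>\<close> are distinct, since a
  coincidence would by Bezout give \<open>\<zeta> = 1\<close>; a field has at most \<open>p\<close>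
  such roots.\<close>

lemma roots_of_unity_card: "card {w \<in> carrier K. w [^]\<^bsub>K\<^esub> p = \<one>\<^bsub>K\<^esub>} = p"
proof -
  let ?W = "{w \<in> carrier K. w [^]\<^bsub>K\<^esub> p = \<one>\<^bsub>K\<^esub>}"
  define z where "z = frac R \<zeta> \<one>"
  have zc: "z \<in> carrier K" "z [^]\<^bsub>K\<^esub> p = \<one>\<^bsub>K\<^esub>" "z \<noteq> \<one>\<^bsub>K\<^esub>"
  proof -
    show "z \<in> carrier K" using zeta by (simp add: z_def)
    show "z [^]\<^bsub>K\<^esub> p = \<one>\<^bsub>K\<^esub>"
      unfolding z_def frac_field_one fr.hom_pow[OF zeta(1), symmetric] zeta(2) ..
    show "z \<noteq> \<one>\<^bsub>K\<^esub>"
      unfolding z_def frac_field_one frac_embed_inj[OF zeta(1) one_closed] by (rule zeta(3))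
  qed
  have p0: "0 < p" using prime_p by (rule prime_gt_0_nat)
  have "z \<noteq> \<zero>\<^bsub>K\<^esub>" using zc(2) p0 K.nat_pow_zero[of p] by auto
  then have zu: "z \<in> Units K" unfolding K.field_Units using zc(1) by simp
  have inj: "inj_on (\<lambda>i. z [^]\<^bsub>K\<^esub> i) {..<p}"
  proof (rule linorder_inj_onI')
    fix i j assume ij: "i \<in> {..<p}" "j \<in> {..<p}" "i < j"
    show "z [^]\<^bsub>K\<^esub> i \<noteq> z [^]\<^bsub>K\<^esub> j"
    proof
      assume eq: "z [^]\<^bsub>K\<^esub> i = z [^]\<^bsub>K\<^esub> j"
      have zi: "z [^]\<^bsub>K\<^esub> i \<in> Units K" using zu by (rule K.Units_pow_closed)
      have "z [^]\<^bsub>K\<^esub> i \<otimes>\<^bsub>K\<^esub> z [^]\<^bsub>K\<^esub> (j - i) = z [^]\<^bsub>K\<^esub> i \<otimes>\<^bsub>K\<^esub> \<one>\<^bsub>K\<^esub>"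
        using K.nat_pow_mult[OF zc(1), of i "j - i"] zc(1) ij(3) unfolding eq by simp
      then have d: "z [^]\<^bsub>K\<^esub> (j - i) = \<one>\<^bsub>K\<^esub>" using zi zc(1) by (subst (asm) K.Units_l_cancel) auto
      have "coprime (j - i) p" using prime_imp_coprime[OF prime_p, of "j - i"] nat_dvd_not_less[of "j - i" p] ij
        by (auto simp: coprime_commute)
      then obtain k l where kl: "(j - i) * k = p * l + 1"
        using bezout_nat[of "j - i" p] ij by (auto simp: coprime_iff_gcd_eq_1)
      have "\<one>\<^bsub>K\<^esub> = (z [^]\<^bsub>K\<^esub> (j - i)) [^]\<^bsub>K\<^esub> k" unfolding d by simp
      also have "\<dots> = z [^]\<^bsub>K\<^esub> (p * l + 1)" unfolding K.nat_pow_pow[OF zc(1)] kl ..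
      also have "\<dots> = (z [^]\<^bsub>K\<^esub> p) [^]\<^bsub>K\<^esub> l \<otimes>\<^bsub>K\<^esub> z"
        unfolding K.nat_pow_pow[OF zc(1)] by simp
      also have "\<dots> = z" unfolding zc(2) using zc(1) by simp
      finally show False using zc(3) by simp
    qed
  qed
  let ?I = "(\<lambda>i. z [^]\<^bsub>K\<^esub> i) ` {..<p}"
  have sub: "?I \<subseteq> ?W"
  proof
    fix w assume "w \<in> ?I"
    then obtain i :: nat where i: "w = z [^]\<^bsub>K\<^esub> i" by blast
    have "w [^]\<^bsub>K\<^esub> p = (z [^]\<^bsub>K\<^esub> p) [^]\<^bsub>K\<^esub> i"
      unfolding i K.nat_pow_pow[OF zc(1)] by (simp only: mult.commute)
    then have "w [^]\<^bsub>K\<^esub> p = \<one>\<^bsub>K\<^esub>" unfolding zc(2) by simp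
    moreover have "w \<in> carrier K" unfolding i using zc(1) by simp
    ultimately show "w \<in> ?W" by simp
  qed
  have "?W \<subseteq> ?I"
  proof
    fix w assume w: "w \<in> ?W"
    show "w \<in> ?I"
    proof (rule ccontr)
      assume n: "w \<notin> ?I"
      have "card (insert w ?I) \<le> p" using w sub p0 by (intro K.roots_of_unity_card_le) auto
      then show False using n inj by (simp add: card_image)
    qed
  qed
  then have "?W = ?I" using sub by simp
  then show ?thesis using inj by (simp add: card_image)
qed

text \<open>One root exists because units have \<open>p\<close>-th roots and the power of
  \<open>\<pi>\<close> is divisible by \<open>p\<close>; multiplication by it carries the roots of
  unity onto all roots.\<close>

lemma unramified_roots_card:
  assumes t: "t \<in> carrier K - {\<zero>\<^bsub>K\<^esub>}" and d: "int p dvd frac_val R t"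
  shows "card {z \<in> carrier K. z [^]\<^bsub>K\<^esub> p = t} = p"
proof -
  have p0: "0 < p" using prime_p by (rule prime_gt_0_nat)
  obtain a b where h: "a \<in> carrier R - {\<zero>}" "b \<in> carrier R - {\<zero>}" "t = frac R a b" using K_nonzero_cases[OF t] .
  \<comment> \<open>\<open>t = (a b\<^sup>p\<^sup>-\<^sup>1) / b\<^sup>p\<close>, and the numerator has valuation divisible by \<open>p\<close>.\<close>
  let ?c = "a \<otimes> b [^] (p - 1)"
  have bp: "b [^] n \<in> carrier R - {\<zero>}" for n :: nat using h(2) by (induction n) (auto simp: integral_iff)
  have c: "?c \<in> carrier R - {\<zero>}" using h bp[of "p - 1"] by (auto simp: integral_iff)
  have bpp: "b [^] (p - 1) \<otimes> b = b [^] p" using p0 nat_pow_Suc[of b "p - 1"] by simp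
  have "?c \<otimes> b = a \<otimes> b [^] p" using h bp[of "p - 1"] by (subst bpp[symmetric], intro m_assoc) auto
  then have te: "t = frac R ?c (b [^] p)" unfolding h(3)
    using h c bp[of p] by (subst frac_eq_iff) simp_all
  have vbp: "val (b [^] n) = n * val b" for n :: nat
  proof (induction n)
    case 0
    show ?case using val_mult[of \<one> \<one>] by simp
  next
    case (Suc n)
    then show ?case using val_mult[OF bp[of n] h(2)] by simp
  qed
  have "frac_val R t = int (val ?c) - int (val (b [^] p))" unfolding te by (rule frac_val_eq[OF c bp])
  then have "int (val ?c) = frac_val R t + int p * int (val b)" unfolding vbp by simp
  then have "int p dvd int (val ?c)" using d by simp
  then obtain m where m: "val ?c = p * m" by auto
  obtain u n where u: "u \<in> Units R" "?c = u \<otimes> \<pi> [^] (n::nat)" using factor[of ?c] c by blast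
  then have nm: "n = m * p" using m val_eq by (simp add: mult.commute)
  obtain v where v: "v \<in> carrier R" "v [^] p = u" using pth_root[OF u(1)] by auto
  define r where "r = frac R (v \<otimes> \<pi> [^] m) b"
  have vn: "v \<otimes> \<pi> [^] m \<in> carrier R" using v pi_pow by simp
  have fpow: "frac R x b [^]\<^bsub>K\<^esub> k = frac R (x [^] k) (b [^] k)" if x: "x \<in> carrier R" for x and k :: nat
  proof (induction k)
    case 0
    show ?case by (simp add: frac_field_one del: fr.hom_one)
  next
    case (Suc k)
    show ?case unfolding K.nat_pow_Suc nat_pow_Suc Suc using x h(2) bp[of k] by (subst frac_mult) auto
  qed
  have "(v \<otimes> \<pi> [^] m) [^] p = u \<otimes> \<pi> [^] n"
    unfolding nat_pow_distrib[OF v(1) pi_pow(1)] nat_pow_pow[OF pi(1)] v(2) nm ..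
  then have rp: "r [^]\<^bsub>K\<^esub> p = t" unfolding r_def te u(2) fpow[OF vn] by simp
  have rc: "r \<in> carrier K" using vn h by (simp add: r_def)
  have "r \<noteq> \<zero>\<^bsub>K\<^esub>" using rp t p0 by (auto simp: K.nat_pow_zero)
  then have ru: "r \<in> Units K" using rc K.field_Units by simp
  have ic: "inv\<^bsub>K\<^esub> r \<in> carrier K" and ri: "r \<otimes>\<^bsub>K\<^esub> inv\<^bsub>K\<^esub> r = \<one>\<^bsub>K\<^esub>" and ir: "inv\<^bsub>K\<^esub> r \<otimes>\<^bsub>K\<^esub> r = \<one>\<^bsub>K\<^esub>"
    using ru by auto
  have it: "(inv\<^bsub>K\<^esub> r) [^]\<^bsub>K\<^esub> p \<otimes>\<^bsub>K\<^esub> t = \<one>\<^bsub>K\<^esub>"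
    unfolding rp[symmetric] K.nat_pow_distrib[OF ic rc, symmetric] ir by simp
  have "bij_betw (\<lambda>w. r \<otimes>\<^bsub>K\<^esub> w) {w \<in> carrier K. w [^]\<^bsub>K\<^esub> p = \<one>\<^bsub>K\<^esub>} {z \<in> carrier K. z [^]\<^bsub>K\<^esub> p = t}"
  proof (rule bij_betwI[of _ _ _ "\<lambda>z. inv\<^bsub>K\<^esub> r \<otimes>\<^bsub>K\<^esub> z"])
    show "(\<lambda>w. r \<otimes>\<^bsub>K\<^esub> w) \<in> {w \<in> carrier K. w [^]\<^bsub>K\<^esub> p = \<one>\<^bsub>K\<^esub>} \<rightarrow> {z \<in> carrier K. z [^]\<^bsub>K\<^esub> p = t}"
    proof
      fix w assume "w \<in> {w \<in> carrier K. w [^]\<^bsub>K\<^esub> p = \<one>\<^bsub>K\<^esub>}"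
      then have w: "w \<in> carrier K" "w [^]\<^bsub>K\<^esub> p = \<one>\<^bsub>K\<^esub>" by auto
      have "(r \<otimes>\<^bsub>K\<^esub> w) [^]\<^bsub>K\<^esub> p = t" unfolding K.nat_pow_distrib[OF rc w(1)] rp w(2) using t by simp
      then show "r \<otimes>\<^bsub>K\<^esub> w \<in> {z \<in> carrier K. z [^]\<^bsub>K\<^esub> p = t}" using rc w(1) by simp
    qed
    show "(\<lambda>z. inv\<^bsub>K\<^esub> r \<otimes>\<^bsub>K\<^esub> z) \<in> {z \<in> carrier K. z [^]\<^bsub>K\<^esub> p = t} \<rightarrow> {w \<in> carrier K. w [^]\<^bsub>K\<^esub> p = \<one>\<^bsub>K\<^esub>}"
    proof
      fix z assume "z \<in> {z \<in> carrier K. z [^]\<^bsub>K\<^esub> p = t}"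
      then have z: "z \<in> carrier K" "z [^]\<^bsub>K\<^esub> p = t" by auto
      have "(inv\<^bsub>K\<^esub> r \<otimes>\<^bsub>K\<^esub> z) [^]\<^bsub>K\<^esub> p = \<one>\<^bsub>K\<^esub>" unfolding K.nat_pow_distrib[OF ic z(1)] z(2) by (rule it)
      then show "inv\<^bsub>K\<^esub> r \<otimes>\<^bsub>K\<^esub> z \<in> {w \<in> carrier K. w [^]\<^bsub>K\<^esub> p = \<one>\<^bsub>K\<^esub>}" using ic z(1) by simp
    qed
    show "inv\<^bsub>K\<^esub> r \<otimes>\<^bsub>K\<^esub> (r \<otimes>\<^bsub>K\<^esub> w) = w" if "w \<in> {w \<in> carrier K. w [^]\<^bsub>K\<^esub> p = \<one>\<^bsub>K\<^esub>}" for w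
      using that by (subst K.m_assoc[symmetric]) (simp_all add: ic rc ir)
    show "r \<otimes>\<^bsub>K\<^esub> (inv\<^bsub>K\<^esub> r \<otimes>\<^bsub>K\<^esub> z) = z" if "z \<in> {z \<in> carrier K. z [^]\<^bsub>K\<^esub> p = t}" for z
      using that by (subst K.m_assoc[symmetric]) (simp_all add: ic rc ri)
  qed
  from bij_betw_same_card[OF this] show ?thesis unfolding roots_of_unity_card by simp
qed

end

section \<open>Completion of a local ring\<close>

text \<open>First-order Taylor expansion of a power, as required for Newton's iteration.\<close>

lemma (in cring) binomial_mod_square:
  assumes b: "b \<in> carrier R" and d: "d \<in> carrier R"
  shows "\<exists>e\<in>carrier R. (b \<oplus> d) [^] Suc k = b [^] Suc k \<oplus> add_pow R (Suc k) \<one> \<otimes> b [^] k \<otimes> d \<oplus> d \<otimes> d \<otimes> e"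
proof (induction k)
  case 0
  show ?case using b d by (intro bexI[of _ \<zero>]) auto
next
  case (Suc k)
  then obtain e where e: "e \<in> carrier R"
    "(b \<oplus> d) [^] Suc k = b [^] Suc k \<oplus> add_pow R (Suc k) \<one> \<otimes> b [^] k \<otimes> d \<oplus> d \<otimes> d \<otimes> e" by blast
  define B where "B = b [^] k"
  define N where "N = add_pow R (Suc k) \<one>"
  have c: "B \<in> carrier R" "N \<in> carrier R" using b by (auto simp: B_def N_def)
  have "(b \<oplus> d) [^] Suc (Suc k) = (B \<otimes> b \<oplus> N \<otimes> B \<otimes> d \<oplus> d \<otimes> d \<otimes> e) \<otimes> (b \<oplus> d)"
    unfolding nat_pow_Suc[of _ "Suc k"] e(2) unfolding B_def N_def by simp
  also have "\<dots> = B \<otimes> b \<otimes> b \<oplus> (N \<oplus> \<one>) \<otimes> (B \<otimes> b) \<otimes> d \<oplus> d \<otimes> d \<otimes> (N \<otimes> B \<oplus> e \<otimes> b \<oplus> d \<otimes> e)"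
    using b d c e(1) by algebra
  also have "N \<oplus> \<one> = add_pow R (Suc (Suc k)) \<one>" unfolding N_def by (simp add: add.nat_pow_Suc)
  finally show ?case using b d c e(1) unfolding B_def by (intro bexI[of _ "N \<otimes> B \<oplus> e \<otimes> b \<oplus> d \<otimes> e"]) (auto simp: B_def)
qed

text \<open>\<open>residue_root\<close> starts Hensel's iteration and \<open>p_unit\<close> keeps it
  going. That \<open>\<zeta> - 1\<close> is a unit, and not just nonzero, is visible in the residue
  field and so persists in the completion.\<close>

locale pth_root_local = domain +
  fixes \<pi> and p :: nat and \<zeta>
  assumes pi: "\<pi> \<in> carrier R" "\<pi> \<noteq> \<zero>" "nonunits R = PIdl \<pi>"
    and prime_p: "Factorial_Ring.prime p"
    and p_unit: "add_pow R p \<one> \<in> Units R"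
    and zeta: "\<zeta> \<in> carrier R" "\<zeta> [^] p = \<one>" "\<zeta> \<ominus> \<one> \<in> Units R"
    and residue_root: "\<And>u. u \<in> Units R \<Longrightarrow> \<exists>v\<in>carrier R. v [^] p \<ominus> u \<in> PIdl \<pi>"
begin

definition I :: "nat \<Rightarrow> 'a set" where "I n = ideal_pow R (nonunits R) n"

abbreviation "A \<equiv> completion R (nonunits R)"

lemma pi_pow: "\<pi> [^] (n::nat) \<in> carrier R" "\<pi> [^] n \<noteq> \<zero>"
  using pi by (induction n) (auto simp: integral_iff)

lemma I_eq: "I n = PIdl (\<pi> [^] n)"
  unfolding I_def pi(3) by (rule ideal_pow_cgenideal[OF pi(1)])

lemma I_iff: "x \<in> I n \<longleftrightarrow> (\<exists>c\<in>carrier R. x = c \<otimes> \<pi> [^] n)"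
  unfolding I_eq cgenideal_iff ..

lemma I_ideal: "ideal (I n) R" unfolding I_eq by (rule cgenideal_ideal[OF pi_pow(1)])

lemma I_closed: "x \<in> I n \<Longrightarrow> x \<in> carrier R"
  using I_ideal ideal.Icarr by fast

lemma I_add: "x \<in> I n \<Longrightarrow> y \<in> I n \<Longrightarrow> x \<oplus> y \<in> I n"
  using additive_subgroup.a_closed[OF ideal.axioms(1)[OF I_ideal]] .

lemma I_neg: "x \<in> I n \<Longrightarrow> \<ominus> x \<in> I n"
  using additive_subgroup.a_inv_closed[OF ideal.axioms(1)[OF I_ideal]] .

lemma I_sub: "x \<in> I n \<Longrightarrow> y \<in> I n \<Longrightarrow> x \<ominus> y \<in> I n"
  unfolding a_minus_def by (rule I_add[OF _ I_neg])

lemma I_zero: "\<zero> \<in> I n"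
  using additive_subgroup.zero_closed[OF ideal.axioms(1)[OF I_ideal]] .

lemma I_mult: "x \<in> I n \<Longrightarrow> y \<in> carrier R \<Longrightarrow> x \<otimes> y \<in> I n" "x \<in> I n \<Longrightarrow> y \<in> carrier R \<Longrightarrow> y \<otimes> x \<in> I n"
  using ideal.I_r_closed[OF I_ideal] ideal.I_l_closed[OF I_ideal] by auto

lemma I_prod: "x \<in> I m \<Longrightarrow> y \<in> I n \<Longrightarrow> x \<otimes> y \<in> I (m + n)"
proof -
  assume "x \<in> I m" "y \<in> I n"
  then obtain c d where c: "c \<in> carrier R" "d \<in> carrier R" "x = c \<otimes> \<pi> [^] m" "y = d \<otimes> \<pi> [^] n" unfolding I_iff by blast
  have "x \<otimes> y = (c \<otimes> d) \<otimes> (\<pi> [^] m \<otimes> \<pi> [^] n)" unfolding c(3,4) using c(1,2) pi_pow(1) by (simp add: m_ac)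
  also have "\<dots> = (c \<otimes> d) \<otimes> \<pi> [^] (m + n)" unfolding nat_pow_mult[OF pi(1)] ..
  finally show ?thesis unfolding I_iff using c(1,2) by blast
qed

lemma I_cancel: "c \<in> carrier R \<Longrightarrow> c \<otimes> \<pi> [^] n \<in> I (n + m) \<Longrightarrow> c \<in> I m"
proof -
  assume c: "c \<in> carrier R" "c \<otimes> \<pi> [^] n \<in> I (n + m)"
  then obtain d where d: "d \<in> carrier R" "c \<otimes> \<pi> [^] n = d \<otimes> \<pi> [^] (m + n)" unfolding I_iff by (auto simp: add.commute)
  have "c \<otimes> \<pi> [^] n = (d \<otimes> \<pi> [^] m) \<otimes> \<pi> [^] n" unfolding d(2) nat_pow_mult[OF pi(1), symmetric]
    using d(1) pi_pow(1) by (simp add: m_assoc)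
  then have "c = d \<otimes> \<pi> [^] m" using m_rcancel[of "\<pi> [^] n" c "d \<otimes> \<pi> [^] m"] c(1) d(1) pi_pow by simp
  then show ?thesis unfolding I_iff using d(1) by blast
qed

lemma I_mono: "m \<le> n \<Longrightarrow> I n \<subseteq> I m"
proof
  fix x assume mn: "m \<le> n" and "x \<in> I n"
  then obtain c where c: "c \<in> carrier R" "x = c \<otimes> \<pi> [^] ((n - m) + m)" unfolding I_iff by auto
  have "x = (c \<otimes> \<pi> [^] (n - m)) \<otimes> \<pi> [^] m" unfolding c(2) nat_pow_mult[OF pi(1), symmetric]
    using c(1) pi_pow(1) by (simp add: m_assoc)
  then show "x \<in> I m" unfolding I_iff using c(1) pi_pow(1) by blast
qed

lemma I_0: "I 0 = carrier R" unfolding I_def by simp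

lemma I_1: "I (Suc 0) = nonunits R" unfolding I_eq pi(3) using pi by simp

lemma unit_iff: "x \<in> carrier R \<Longrightarrow> x \<in> Units R \<longleftrightarrow> x \<notin> I (Suc 0)"
  unfolding I_1 nonunits_def by blast

text \<open>The exponent is the last \<open>k\<close> with \<open>x \<in> I k\<close>. The powers
  are not assumed to intersect in zero, hence the condition that \<open>x\<close> avoids some
  \<open>I n\<close>.\<close>

lemma factor_R:
  assumes "x \<in> carrier R" "x \<notin> I n"
  obtains k u where "k < n" "u \<in> Units R" "x = u \<otimes> \<pi> [^] (k::nat)"
proof -
  obtain k where k: "k < n" "x \<in> I k" "x \<notin> I (Suc k)"
    using assms(2)
  proof (induction n)
    case 0
    then show ?case using assms(1) I_0 by simp
  next
    case (Suc n)
    then show ?case by (cases "x \<in> I n") (auto intro: less_SucI)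
  qed
  obtain c where c: "c \<in> carrier R" "x = c \<otimes> \<pi> [^] k" using k(2) unfolding I_iff by blast
  have "c \<notin> I (Suc 0)"
  proof
    assume "c \<in> I (Suc 0)"
    moreover have "\<pi> [^] k \<in> I k" unfolding I_eq by (rule cgenideal_self[OF pi_pow(1)])
    ultimately have "x \<in> I (Suc 0 + k)" unfolding c(2) by (rule I_prod)
    then show False using k(3) by simp
  qed
  then show ?thesis using that k(1) c unit_iff by blast
qed

text \<open>The two orders are below \<open>m\<close> and \<open>n\<close>, and they add up because
  a product of units is a unit.\<close>

lemma I_prime:
  assumes "x \<in> carrier R" "y \<in> carrier R" "x \<notin> I m" "y \<notin> I n"
  shows "x \<otimes> y \<notin> I (m + n)"
proof
  assume xy: "x \<otimes> y \<in> I (m + n)"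
  obtain k u where u: "k < m" "u \<in> Units R" "x = u \<otimes> \<pi> [^] (k::nat)" using factor_R[OF assms(1,3)] .
  obtain l w where w: "l < n" "w \<in> Units R" "y = w \<otimes> \<pi> [^] (l::nat)" using factor_R[OF assms(2,4)] .
  have "x \<otimes> y = (u \<otimes> w) \<otimes> (\<pi> [^] k \<otimes> \<pi> [^] l)" unfolding u(3) w(3)
    using Units_closed[OF u(2)] Units_closed[OF w(2)] pi_pow(1) by (simp add: m_ac)
  also have "\<dots> = (u \<otimes> w) \<otimes> \<pi> [^] (k + l)" unfolding nat_pow_mult[OF pi(1)] ..
  finally have e: "x \<otimes> y = (u \<otimes> w) \<otimes> \<pi> [^] (k + l)" .
  have "I (m + n) \<subseteq> I ((k + l) + Suc 0)" using u(1) w(1) by (intro I_mono) linarith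
  then have "(u \<otimes> w) \<otimes> \<pi> [^] (k + l) \<in> I ((k + l) + Suc 0)" using xy unfolding e by blast
  then have "u \<otimes> w \<in> I (Suc 0)" by (rule I_cancel[OF m_closed[OF Units_closed[OF u(2)] Units_closed[OF w(2)]]])
  then show False using unit_iff[of "u \<otimes> w"] Units_m_closed[OF u(2) w(2)] by blast
qed

text \<open>Sequences of representatives for elements of the inverse limit. As \<open>I 0\<close> is
  the whole ring, entry 0 carries no information; the residue class is entry 1.\<close>

definition Coh :: "(nat \<Rightarrow> 'a) \<Rightarrow> bool" where
  "Coh a \<longleftrightarrow> (\<forall>n. a n \<in> carrier R \<and> a (Suc n) \<ominus> a n \<in> I n)"

definition Lim :: "(nat \<Rightarrow> 'a) \<Rightarrow> nat \<Rightarrow> 'a set" where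
  "Lim a = (\<lambda>n. I n +> a n)"

lemma coset_eq_iff: "x \<in> carrier R \<Longrightarrow> y \<in> carrier R \<Longrightarrow> I n +> x = I n +> y \<longleftrightarrow> x \<ominus> y \<in> I n"
  using quotient_eq_iff_same_a_r_cos[OF I_ideal] by blast

lemma Lim_eq_iff:
  assumes "Coh a" "Coh b"
  shows "Lim a = Lim b \<longleftrightarrow> (\<forall>n. a n \<ominus> b n \<in> I n)"
  using assms unfolding Coh_def Lim_def fun_eq_iff by (simp add: coset_eq_iff)

text \<open>It translates the transition maps of \<open>completion\<close>, given by containment of
  cosets, into congruences.\<close>

lemma coset_sub_iff:
  assumes "x \<in> carrier R" "y \<in> carrier R"
  shows "I (Suc n) +> x \<subseteq> I n +> y \<longleftrightarrow> x \<ominus> y \<in> I n"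
proof
  assume "I (Suc n) +> x \<subseteq> I n +> y"
  moreover have "x \<in> I (Suc n) +> x" using I_zero[of "Suc n"] assms(1) by (force simp: a_r_coset_def r_coset_def)
  ultimately have "x \<in> I n +> y" by blast
  then obtain h where h: "h \<in> I n" "x = h \<oplus> y" by (auto simp: a_r_coset_def r_coset_def)
  have "x \<ominus> y = h" unfolding h(2) using I_closed[OF h(1)] assms(2) by algebra
  then show "x \<ominus> y \<in> I n" using h(1) by simp
next
  assume xy: "x \<ominus> y \<in> I n"
  show "I (Suc n) +> x \<subseteq> I n +> y"
  proof
    fix z assume "z \<in> I (Suc n) +> x"
    then obtain h where h: "h \<in> I (Suc n)" "z = h \<oplus> x" by (auto simp: a_r_coset_def r_coset_def)
    have "z = (h \<oplus> (x \<ominus> y)) \<oplus> y" unfolding h(2) using I_closed[OF h(1)] assms by algebra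
    moreover have "h \<oplus> (x \<ominus> y) \<in> I n" using I_mono[of n "Suc n"] h(1) xy by (intro I_add) auto
    ultimately show "z \<in> I n +> y" by (auto simp: a_r_coset_def r_coset_def)
  qed
qed

lemma quot_carrier: "carrier (R Quot I n) = (\<lambda>x. I n +> x) ` carrier R"
  by (auto simp: FactRing_def A_RCOSETS_def')

lemma A_carrier: "carrier A = Lim ` {a. Coh a}"
proof
  show "carrier A \<subseteq> Lim ` {a. Coh a}"
  proof
    fix s assume "s \<in> carrier A"
    then have s: "s n \<in> carrier (R Quot I n)" "s (Suc n) \<subseteq> s n" for n unfolding completion_def I_def by auto
    then have "\<forall>n. \<exists>a\<in>carrier R. s n = I n +> a" unfolding quot_carrier by blast
    then obtain a where a: "\<And>n. a n \<in> carrier R" "\<And>n. s n = I n +> a n" by metis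
    have "Coh a" unfolding Coh_def using a(1) s(2) unfolding a(2) by (simp add: coset_sub_iff)
    moreover have "s = Lim a" unfolding Lim_def using a(2) by (rule ext)
    ultimately show "s \<in> Lim ` {a. Coh a}" by blast
  qed
  show "Lim ` {a. Coh a} \<subseteq> carrier A"
  proof
    fix s assume "s \<in> Lim ` {a. Coh a}"
    then obtain a where a: "Coh a" "s = Lim a" by blast
    then have "I (Suc n) +> a (Suc n) \<subseteq> I n +> a n" "I n +> a n \<in> carrier (R Quot I n)" for n
      unfolding Coh_def quot_carrier by (simp_all add: coset_sub_iff)
    then show "s \<in> carrier A" unfolding a(2) completion_def I_def[symmetric] Lim_def by simp
  qed
qed

lemma Lim_mult: "Coh a \<Longrightarrow> Coh b \<Longrightarrow> Lim a \<otimes>\<^bsub>A\<^esub> Lim b = Lim (\<lambda>n. a n \<otimes> b n)"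
  unfolding completion_def I_def[symmetric] Coh_def Lim_def FactRing_def
  by (simp add: ideal.rcoset_mult_add[OF I_ideal])

lemma Lim_add: "Coh a \<Longrightarrow> Coh b \<Longrightarrow> Lim a \<oplus>\<^bsub>A\<^esub> Lim b = Lim (\<lambda>n. a n \<oplus> b n)"
  unfolding completion_def I_def[symmetric] Coh_def Lim_def FactRing_def
  using abelian_subgroup.a_rcos_sum[OF abelian_subgroupI3[OF ideal.axioms(1)[OF I_ideal] is_abelian_group]]
  by simp

lemma A_one: "\<one>\<^bsub>A\<^esub> = Lim (\<lambda>n. \<one>)"
  unfolding completion_def I_def[symmetric] Lim_def FactRing_def by simp

lemma A_zero: "\<zero>\<^bsub>A\<^esub> = Lim (\<lambda>n. \<zero>)"
proof -
  have "I n +> \<zero> = I n" for n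
    using ideal.Icarr[OF I_ideal] by (force simp: a_r_coset_def r_coset_def)
  then show ?thesis unfolding completion_def I_def[symmetric] Lim_def FactRing_def by simp
qed

lemma Coh_const: "x \<in> carrier R \<Longrightarrow> Coh (\<lambda>_. x)"
  unfolding Coh_def using I_zero by (simp add: a_minus_def r_neg)

lemma Coh_mult: "Coh a \<Longrightarrow> Coh b \<Longrightarrow> Coh (\<lambda>n. a n \<otimes> b n)"
proof -
  assume ab: "Coh a" "Coh b"
  have "a (Suc n) \<otimes> b (Suc n) \<ominus> a n \<otimes> b n \<in> I n" for n
  proof -
    have c: "a (Suc n) \<in> carrier R" "b (Suc n) \<in> carrier R" "a n \<in> carrier R" "b n \<in> carrier R"
      and d: "a (Suc n) \<ominus> a n \<in> I n" "b (Suc n) \<ominus> b n \<in> I n" using ab unfolding Coh_def by auto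
    have "a (Suc n) \<otimes> b (Suc n) \<ominus> a n \<otimes> b n = (a (Suc n) \<ominus> a n) \<otimes> b (Suc n) \<oplus> a n \<otimes> (b (Suc n) \<ominus> b n)"
      using c by algebra
    also have "\<dots> \<in> I n" by (rule I_add[OF I_mult(1)[OF d(1) c(2)] I_mult(2)[OF d(2) c(3)]])
    finally show ?thesis .
  qed
  then show ?thesis using ab unfolding Coh_def by simp
qed

lemma Coh_add: "Coh a \<Longrightarrow> Coh b \<Longrightarrow> Coh (\<lambda>n. a n \<oplus> b n)"
proof -
  assume ab: "Coh a" "Coh b"
  have "(a (Suc n) \<oplus> b (Suc n)) \<ominus> (a n \<oplus> b n) \<in> I n" for n
  proof -
    have c: "a (Suc n) \<in> carrier R" "b (Suc n) \<in> carrier R" "a n \<in> carrier R" "b n \<in> carrier R"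
      and d: "a (Suc n) \<ominus> a n \<in> I n" "b (Suc n) \<ominus> b n \<in> I n" using ab unfolding Coh_def by auto
    have "(a (Suc n) \<oplus> b (Suc n)) \<ominus> (a n \<oplus> b n) = (a (Suc n) \<ominus> a n) \<oplus> (b (Suc n) \<ominus> b n)"
      using c by algebra
    also have "\<dots> \<in> I n" by (rule I_add[OF d])
    finally show ?thesis .
  qed
  then show ?thesis using ab unfolding Coh_def by simp
qed

lemma Coh_neg: "Coh a \<Longrightarrow> Coh (\<lambda>n. \<ominus> a n)"
  using Coh_mult[OF Coh_const[of "\<ominus> \<one>"]] unfolding Coh_def by (simp add: l_minus)

lemma Coh_closed: "Coh a \<Longrightarrow> a n \<in> carrier R"
  unfolding Coh_def by blast

lemma A_cases:
  assumes "s \<in> carrier A"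
  obtains a where "Coh a" "s = Lim a"
  using assms unfolding A_carrier by blast

lemma Lim_closed: "Coh a \<Longrightarrow> Lim a \<in> carrier A"
  unfolding A_carrier by blast

lemma A_cring: "cring A"
proof (rule cringI)
  show "abelian_group A"
  proof (rule abelian_groupI)
    show "\<zero>\<^bsub>A\<^esub> \<in> carrier A" unfolding A_zero by (intro Lim_closed Coh_const zero_closed)
    fix x assume "x \<in> carrier A"
    then obtain a where a: "Coh a" "x = Lim a" by (rule A_cases)
    note ac = Coh_closed[OF a(1)]
    show "\<zero>\<^bsub>A\<^esub> \<oplus>\<^bsub>A\<^esub> x = x" unfolding A_zero a(2) Lim_add[OF Coh_const[OF zero_closed] a(1)] using ac by simp
    have "Lim (\<lambda>n. \<ominus> a n) \<oplus>\<^bsub>A\<^esub> x = \<zero>\<^bsub>A\<^esub>" unfolding A_zero a(2) Lim_add[OF Coh_neg[OF a(1)] a(1)] using ac by (simp add: l_neg)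
    then show "\<exists>y\<in>carrier A. y \<oplus>\<^bsub>A\<^esub> x = \<zero>\<^bsub>A\<^esub>" using Lim_closed[OF Coh_neg[OF a(1)]] by blast
    fix y assume "y \<in> carrier A"
    then obtain b where b: "Coh b" "y = Lim b" by (rule A_cases)
    note bc = Coh_closed[OF b(1)]
    show "x \<oplus>\<^bsub>A\<^esub> y \<in> carrier A" unfolding a(2) b(2) Lim_add[OF a(1) b(1)] by (intro Lim_closed Coh_add a b)
    show "x \<oplus>\<^bsub>A\<^esub> y = y \<oplus>\<^bsub>A\<^esub> x" unfolding a(2) b(2) Lim_add[OF a(1) b(1)] Lim_add[OF b(1) a(1)] using ac bc by (simp add: a_comm)
    fix z assume "z \<in> carrier A"
    then obtain c where c: "Coh c" "z = Lim c" by (rule A_cases)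
    note cc = Coh_closed[OF c(1)]
    show "x \<oplus>\<^bsub>A\<^esub> y \<oplus>\<^bsub>A\<^esub> z = x \<oplus>\<^bsub>A\<^esub> (y \<oplus>\<^bsub>A\<^esub> z)"
      unfolding a(2) b(2) c(2) Lim_add[OF a(1) b(1)] Lim_add[OF b(1) c(1)] Lim_add[OF Coh_add[OF a(1) b(1)] c(1)]
        Lim_add[OF a(1) Coh_add[OF b(1) c(1)]] using ac bc cc by (simp add: a_assoc)
  qed
  show "Group.comm_monoid A"
  proof (rule comm_monoidI)
    show "\<one>\<^bsub>A\<^esub> \<in> carrier A" unfolding A_one by (intro Lim_closed Coh_const one_closed)
    fix x assume "x \<in> carrier A"
    then obtain a where a: "Coh a" "x = Lim a" by (rule A_cases)
    note ac = Coh_closed[OF a(1)]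
    show "\<one>\<^bsub>A\<^esub> \<otimes>\<^bsub>A\<^esub> x = x" unfolding A_one a(2) Lim_mult[OF Coh_const[OF one_closed] a(1)] using ac by simp
    fix y assume "y \<in> carrier A"
    then obtain b where b: "Coh b" "y = Lim b" by (rule A_cases)
    note bc = Coh_closed[OF b(1)]
    show "x \<otimes>\<^bsub>A\<^esub> y \<in> carrier A" unfolding a(2) b(2) Lim_mult[OF a(1) b(1)] by (intro Lim_closed Coh_mult a b)
    show "x \<otimes>\<^bsub>A\<^esub> y = y \<otimes>\<^bsub>A\<^esub> x" unfolding a(2) b(2) Lim_mult[OF a(1) b(1)] Lim_mult[OF b(1) a(1)] using ac bc by (simp add: m_comm)
    fix z assume "z \<in> carrier A"
    then obtain c where c: "Coh c" "z = Lim c" by (rule A_cases)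
    note cc = Coh_closed[OF c(1)]
    show "x \<otimes>\<^bsub>A\<^esub> y \<otimes>\<^bsub>A\<^esub> z = x \<otimes>\<^bsub>A\<^esub> (y \<otimes>\<^bsub>A\<^esub> z)"
      unfolding a(2) b(2) c(2) Lim_mult[OF a(1) b(1)] Lim_mult[OF b(1) c(1)] Lim_mult[OF Coh_mult[OF a(1) b(1)] c(1)]
        Lim_mult[OF a(1) Coh_mult[OF b(1) c(1)]] using ac bc cc by (simp add: m_assoc)
  qed
  fix x y z assume "x \<in> carrier A" "y \<in> carrier A" "z \<in> carrier A"
  then obtain a b c where a: "Coh a" "x = Lim a" and b: "Coh b" "y = Lim b" and c: "Coh c" "z = Lim c"
    by (metis A_cases)
  show "(x \<oplus>\<^bsub>A\<^esub> y) \<otimes>\<^bsub>A\<^esub> z = x \<otimes>\<^bsub>A\<^esub> z \<oplus>\<^bsub>A\<^esub> y \<otimes>\<^bsub>A\<^esub> z"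
    unfolding a(2) b(2) c(2) Lim_add[OF a(1) b(1)] Lim_mult[OF a(1) c(1)] Lim_mult[OF b(1) c(1)]
      Lim_mult[OF Coh_add[OF a(1) b(1)] c(1)] Lim_add[OF Coh_mult[OF a(1) c(1)] Coh_mult[OF b(1) c(1)]]
    using Coh_closed[OF a(1)] Coh_closed[OF b(1)] Coh_closed[OF c(1)] by (simp add: l_distr)
qed

sublocale A: cring A by (rule A_cring)

lemma Coh_diff:
  assumes "Coh a" "m \<le> n"
  shows "a n \<ominus> a m \<in> I m"
  using assms(2)
proof (induction n rule: dec_induct)
  case base
  show ?case using Coh_closed[OF assms(1)] I_zero by (simp add: a_minus_def r_neg)
next
  case (step n)
  have c: "a (Suc n) \<in> carrier R" "a n \<in> carrier R" "a m \<in> carrier R" using Coh_closed[OF assms(1)] by auto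
  have "a (Suc n) \<ominus> a m = (a (Suc n) \<ominus> a n) \<oplus> (a n \<ominus> a m)" using c by algebra
  also have "\<dots> \<in> I m" using assms(1) I_mono[OF step(1)] step(3) unfolding Coh_def by (intro I_add) auto
  finally show ?case .
qed

lemma I_congr: "x \<in> carrier R \<Longrightarrow> y \<in> carrier R \<Longrightarrow> x \<ominus> y \<in> I n \<Longrightarrow> x \<in> I n \<longleftrightarrow> y \<in> I n"
proof -
  assume h: "x \<in> carrier R" "y \<in> carrier R" "x \<ominus> y \<in> I n"
  have e: "x = (x \<ominus> y) \<oplus> y" "y = x \<ominus> (x \<ominus> y)" using h(1,2) by algebra+
  show ?thesis
  proof
    assume "x \<in> I n"
    then have "x \<ominus> (x \<ominus> y) \<in> I n" using h(3) by (rule I_sub)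
    then show "y \<in> I n" using e(2) by simp
  next
    assume "y \<in> I n"
    with h(3) have "(x \<ominus> y) \<oplus> y \<in> I n" by (rule I_add)
    then show "x \<in> I n" using e(1) by simp
  qed
qed

lemma Coh_mem: "Coh a \<Longrightarrow> m \<le> n \<Longrightarrow> a n \<in> I m \<longleftrightarrow> a m \<in> I m"
  using I_congr[OF Coh_closed[of a n] Coh_closed[of a m] Coh_diff[of a m n]] by blast

lemma Lim_zero_iff: "Coh a \<Longrightarrow> Lim a = \<zero>\<^bsub>A\<^esub> \<longleftrightarrow> (\<forall>n. a n \<in> I n)"
  unfolding A_zero using Lim_eq_iff[OF _ Coh_const[OF zero_closed], of a] Coh_closed[of a] by (simp add: a_minus_def)

lemma I_proper: "\<one> \<notin> I (Suc n)"
  using unit_iff[of \<one>] I_mono[of "Suc 0" "Suc n"] by auto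

text \<open>If entries \<open>m\<close> and \<open>n\<close> of two factors witness that these are
  nonzero, both witnesses persist at index \<open>m + n\<close>, where \<open>I_prime\<close>
  applies.\<close>

lemma A_domain: "domain A"
proof (rule domain.intro[OF A_cring], rule domain_axioms.intro)
  show "\<one>\<^bsub>A\<^esub> \<noteq> \<zero>\<^bsub>A\<^esub>" unfolding A_one using Lim_zero_iff[OF Coh_const[OF one_closed]] I_proper[of 0] by auto
  fix x y assume xy: "x \<otimes>\<^bsub>A\<^esub> y = \<zero>\<^bsub>A\<^esub>" "x \<in> carrier A" "y \<in> carrier A"
  obtain a b where a: "Coh a" "x = Lim a" and b: "Coh b" "y = Lim b" using xy(2,3) by (metis A_cases)
  show "x = \<zero>\<^bsub>A\<^esub> \<or> y = \<zero>\<^bsub>A\<^esub>"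
  proof (rule ccontr)
    assume "\<not> ?thesis"
    then obtain m n where mn: "a m \<notin> I m" "b n \<notin> I n" unfolding a(2) b(2) using Lim_zero_iff[OF a(1)] Lim_zero_iff[OF b(1)] by blast
    have "a (m + n) \<notin> I m" "b (m + n) \<notin> I n" using mn Coh_mem[OF a(1), of m "m + n"] Coh_mem[OF b(1), of n "m + n"] by auto
    then have "a (m + n) \<otimes> b (m + n) \<notin> I (m + n)" using I_prime Coh_closed a(1) b(1) by blast
    then show False using xy(1) unfolding a(2) b(2) Lim_mult[OF a(1) b(1)] Lim_zero_iff[OF Coh_mult[OF a(1) b(1)]] by blast
  qed
qed

sublocale A: domain A by (rule A_domain)

text \<open>A nonzero residue makes all entries from index 1 on invertible, and inverses of
  congruent units are congruent.\<close>

lemma Lim_unit_iff: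
  assumes a: "Coh a"
  shows "Lim a \<in> Units A \<longleftrightarrow> a (Suc 0) \<notin> I (Suc 0)"
proof
  assume "Lim a \<in> Units A"
  then obtain y where y: "y \<in> carrier A" "Lim a \<otimes>\<^bsub>A\<^esub> y = \<one>\<^bsub>A\<^esub>" unfolding Units_def by auto
  then obtain b where b: "Coh b" "y = Lim b" by (metis A_cases)
  have "Lim (\<lambda>n. a n \<otimes> b n) = Lim (\<lambda>n. \<one>)" using y(2) unfolding b(2) Lim_mult[OF a b(1)] A_one .
  then have "a (Suc 0) \<otimes> b (Suc 0) \<ominus> \<one> \<in> I (Suc 0)"
    using Lim_eq_iff[OF Coh_mult[OF a b(1)] Coh_const[OF one_closed]] by blast
  then have "a (Suc 0) \<otimes> b (Suc 0) \<notin> I (Suc 0)"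
    using I_congr[OF _ one_closed] I_proper[of 0] Coh_closed[OF Coh_mult[OF a b(1)]] by blast
  then show "a (Suc 0) \<notin> I (Suc 0)" using I_mult(1) Coh_closed[OF b(1)] by blast
next
  assume a1: "a (Suc 0) \<notin> I (Suc 0)"
  have u: "a (Suc n) \<in> Units R" for n using a1 Coh_mem[OF a, of "Suc 0" "Suc n"] unit_iff Coh_closed[OF a] by auto
  \<comment> \<open>Entry 0 of \<open>a\<close> need not be a unit; any value is coherent
    there.\<close>
  define b where "b n = (if n = 0 then \<one> else inv (a n))" for n
  have bc: "b n \<in> carrier R" for n using u[of "n - 1"] by (auto simp: b_def)
  have "b (Suc n) \<ominus> b n \<in> I n" for n
  proof (cases n)
    case 0
    then show ?thesis using bc I_0 by simp
  next
    case (Suc m)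
    have an: "a (Suc n) \<in> carrier R" "a n \<in> carrier R" "a (Suc n) \<otimes> b (Suc n) = \<one>" "a n \<otimes> b n = \<one>" using u[of n] u[of m] Suc by (auto simp: b_def)
    have "b (Suc n) \<ominus> b n = (a n \<otimes> b n) \<otimes> b (Suc n) \<ominus> (a (Suc n) \<otimes> b (Suc n)) \<otimes> b n"
      unfolding an(3,4) using bc by simp
    also have "\<dots> = (\<ominus> (a (Suc n) \<ominus> a n)) \<otimes> (b n \<otimes> b (Suc n))"
      using an(1,2) bc[of n] bc[of "Suc n"] by algebra
    also have "\<dots> \<in> I n" using a bc unfolding Coh_def by (intro I_mult I_neg) auto
    finally show ?thesis .
  qed
  then have b: "Coh b" unfolding Coh_def using bc by blast
  have "Lim a \<otimes>\<^bsub>A\<^esub> Lim b = \<one>\<^bsub>A\<^esub>" unfolding Lim_mult[OF a b] A_one Lim_eq_iff[OF Coh_mult[OF a b] Coh_const[OF one_closed]]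
  proof
    fix n show "a n \<otimes> b n \<ominus> \<one> \<in> I n"
    proof (cases n)
      case 0
      then show ?thesis using Coh_closed[OF Coh_mult[OF a b]] I_0 by simp
    next
      case (Suc m)
      then have "a n \<otimes> b n = \<one>" using u[of m] by (simp add: b_def)
      then show ?thesis using I_zero by (simp add: a_minus_def r_neg)
    qed
  qed
  then show "Lim a \<in> Units A" using A.Units_one_closed A.unit_factor[of "Lim a" "Lim b"] Lim_closed a b by simp
qed

lemma const_pow: "x \<in> carrier R \<Longrightarrow> Lim (\<lambda>_. x) [^]\<^bsub>A\<^esub> (n::nat) = Lim (\<lambda>_. x [^] n)"
proof (induction n)
  case 0
  show ?case by (simp add: A_one)
next
  case (Suc n)
  then show ?case using Lim_mult[OF Coh_const Coh_const] by simp
qed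

lemma Lim_pow: "Coh a \<Longrightarrow> Coh (\<lambda>k. a k [^] (n::nat)) \<and> Lim a [^]\<^bsub>A\<^esub> n = Lim (\<lambda>k. a k [^] n)"
proof (induction n)
  case 0
  show ?case using Coh_const by (simp add: A_one)
next
  case (Suc n)
  then show ?case using Coh_mult[of "\<lambda>k. a k [^] n" a] Lim_mult[of "\<lambda>k. a k [^] n" a] by simp
qed

text \<open>Division by \<open>\<pi>^n\<close> costs \<open>n\<close> places of precision, so entry
  \<open>j\<close> of the quotient is taken from entry \<open>n + j\<close>.\<close>

lemma Lim_divide:
  assumes a: "Coh a" and n: "a n \<in> I n"
  obtains b where "Coh b" "Lim a = Lim b \<otimes>\<^bsub>A\<^esub> Lim (\<lambda>_. \<pi>) [^]\<^bsub>A\<^esub> n" "\<And>j. a (n + j) = b j \<otimes> \<pi> [^] n"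
proof -
  have "a (n + j) \<in> I n" for j using Coh_mem[OF a, of n "n + j"] n by simp
  then have "\<forall>j. \<exists>c\<in>carrier R. a (n + j) = c \<otimes> \<pi> [^] n" unfolding I_iff by blast
  then obtain b where b: "\<And>j. b j \<in> carrier R" "\<And>j. a (n + j) = b j \<otimes> \<pi> [^] n" by metis
  have "b (Suc j) \<ominus> b j \<in> I j" for j
  proof -
    have "(b (Suc j) \<ominus> b j) \<otimes> \<pi> [^] n = b (Suc j) \<otimes> \<pi> [^] n \<ominus> b j \<otimes> \<pi> [^] n" using b(1)[of j] b(1)[of "Suc j"] pi_pow(1)[of n] by algebra
    also have "\<dots> = a (Suc (n + j)) \<ominus> a (n + j)" unfolding b(2)[symmetric] by simp
    also have "\<dots> \<in> I (n + j)" using a unfolding Coh_def by blast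
    finally show ?thesis by (rule I_cancel[rotated]) (use b(1) in simp)
  qed
  then have cb: "Coh b" unfolding Coh_def using b(1) by blast
  have cp: "Coh (\<lambda>_. \<pi> [^] n)" by (rule Coh_const[OF pi_pow(1)])
  have "Lim a = Lim b \<otimes>\<^bsub>A\<^esub> Lim (\<lambda>_. \<pi>) [^]\<^bsub>A\<^esub> n"
    unfolding const_pow[OF pi(1)] Lim_mult[OF cb cp] Lim_eq_iff[OF a Coh_mult[OF cb cp]]
  proof
    fix k
    have "\<ominus> (a (n + k) \<ominus> a k) \<in> I k" by (rule I_neg[OF Coh_diff[OF a]]) simp
    moreover have "\<ominus> (a (n + k) \<ominus> a k) = a k \<ominus> a (n + k)" using Coh_closed[OF a, of k] Coh_closed[OF a, of "n + k"] by algebra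
    ultimately show "a k \<ominus> b k \<otimes> \<pi> [^] n \<in> I k" using b(2)[of k] by simp
  qed
  then show ?thesis using that cb b(2) by blast
qed

lemma unit_perturb:
  assumes "b \<in> Units R" "c \<in> carrier R" "c \<ominus> b \<in> I (Suc 0)"
  shows "c \<in> Units R"
  using I_congr[OF assms(2) Units_closed[OF assms(1)] assms(3)]
    unit_iff[OF assms(2)] unit_iff[OF Units_closed[OF assms(1)]] assms(1) by blast

text \<open>Newton's correction \<open>d = - (b^p - a) / (p b^(p-1))\<close> cancels the linear
  term. The error is a multiple of \<open>d^2\<close>, hence in \<open>I (n + n)\<close>, which lies
  in \<open>I (Suc n)\<close> because \<open>n > 0\<close>.\<close>

lemma hensel_step:
  assumes n: "0 < n" and b: "b \<in> Units R" and a: "a \<in> carrier R" and ba: "b [^] p \<ominus> a \<in> I n"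
  obtains b' where "b' \<in> Units R" "b' \<ominus> b \<in> I n" "b' [^] p \<ominus> a \<in> I (Suc n)"
proof -
  have bc: "b \<in> carrier R" using b by auto
  obtain k where k: "p = Suc k" using prime_gt_0_nat[OF prime_p] by (cases p) auto
  define q where "q = add_pow R p \<one> \<otimes> b [^] k"
  have qu: "q \<in> Units R" unfolding q_def using p_unit b by (intro Units_m_closed Units_pow_closed)
  have qc: "q \<in> carrier R" "inv q \<in> carrier R" "q \<otimes> inv q = \<one>" using qu by auto
  define c where "c = b [^] p \<ominus> a"
  define d where "d = \<ominus> (c \<otimes> inv q)"
  have cc: "c \<in> carrier R" unfolding c_def using bc a by simp
  have dI: "d \<in> I n" unfolding d_def using ba qc by (intro I_neg I_mult) (auto simp: c_def)
  have dc: "d \<in> carrier R" using I_closed[OF dI] .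
  obtain e where e: "e \<in> carrier R" "(b \<oplus> d) [^] p = b [^] p \<oplus> q \<otimes> d \<oplus> d \<otimes> d \<otimes> e"
    using binomial_mod_square[OF bc dc, of k] unfolding k q_def by blast
  have bp: "b [^] p = c \<oplus> a" unfolding c_def using nat_pow_closed[OF bc, of p] a by algebra
  have "q \<otimes> d = \<ominus> c"
  proof -
    have "q \<otimes> d = \<ominus> (c \<otimes> (q \<otimes> inv q))" unfolding d_def using qc(1,2) cc by algebra
    then show ?thesis unfolding qc(3) using cc by simp
  qed
  then have "(b \<oplus> d) [^] p \<ominus> a = (c \<oplus> a \<oplus> \<ominus> c \<oplus> d \<otimes> d \<otimes> e) \<ominus> a" unfolding e(2) bp by simp
  also have "\<dots> = d \<otimes> d \<otimes> e" using cc a dc e(1) by algebra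
  also have "\<dots> \<in> I (Suc n)"
  proof -
    have "d \<otimes> d \<in> I (n + n)" by (rule I_prod[OF dI dI])
    then have "d \<otimes> d \<in> I (Suc n)" using I_mono[of "Suc n" "n + n"] n by auto
    then show ?thesis using e(1) by (rule I_mult)
  qed
  finally have 1: "(b \<oplus> d) [^] p \<ominus> a \<in> I (Suc n)" .
  have "(b \<oplus> d) \<ominus> b = d" using bc dc by algebra
  then have 2: "(b \<oplus> d) \<ominus> b \<in> I n" using dI by simp
  then have "(b \<oplus> d) \<ominus> b \<in> I (Suc 0)" using I_mono[of "Suc 0" n] n by auto
  then have "b \<oplus> d \<in> Units R" using unit_perturb[OF b] bc dc by simp
  then show ?thesis using that 1 2 by blast
qed

lemma A_pth_root:
  assumes "u \<in> Units A"
  shows "\<exists>v\<in>carrier A. v [^]\<^bsub>A\<^esub> p = u"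
proof -
  obtain a where a: "Coh a" "u = Lim a" using assms A.Units_closed by (metis A_cases)
  have a1: "a (Suc 0) \<notin> I (Suc 0)" using assms Lim_unit_iff[OF a(1)] a(2) by simp
  note ac = Coh_closed[OF a(1)]
  let ?P = "\<lambda>n b. b \<in> Units R \<and> b [^] p \<ominus> a n \<in> I n"
  have "\<exists>b. \<forall>n. ?P n (b n) \<and> b (Suc n) \<ominus> b n \<in> I n"
  proof (rule dependent_nat_choice)
    \<comment> \<open>The congruence modulo \<open>I 0\<close> is void, so any unit may start the
      sequence.\<close>
    show "\<exists>b. ?P 0 b" using ac I_0 by (intro exI[of _ \<one>]) auto
    fix b n assume b: "?P n b"
    show "\<exists>b'. ?P (Suc n) b' \<and> b' \<ominus> b \<in> I n"
    proof (cases n)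
      \<comment> \<open>Newton's step needs \<open>n > 0\<close>. The first approximation is a root
        in the residue field, and it is a unit because its \<open>p\<close>-th power is one.\<close>
      case 0
      have u1: "a (Suc 0) \<in> Units R" using a1 unit_iff ac by simp
      obtain v where v: "v \<in> carrier R" "v [^] p \<ominus> a (Suc 0) \<in> PIdl \<pi>" using residue_root[OF u1] by blast
      have vI: "v [^] p \<ominus> a (Suc 0) \<in> I (Suc 0)" using v(2) I_1 pi(3) by simp
      then have "v [^] p \<in> Units R" using unit_perturb[OF u1] v(1) by simp
      then have "v [^] p \<notin> I (Suc 0)" using unit_iff v(1) by simp
      moreover have "v [^] p = v [^] (p - 1) \<otimes> v"
        using prime_gt_0_nat[OF prime_p] nat_pow_Suc[of v "p - 1"] by simp
      ultimately have "v \<notin> I (Suc 0)" using I_mult(2)[of v "Suc 0" "v [^] (p - 1)"] v(1) by auto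
      then have "v \<in> Units R" using v(1) unit_iff by simp
      moreover have "v \<ominus> b \<in> I 0" using v(1) b I_0 by auto
      ultimately show ?thesis using vI 0 by auto
    next
      case (Suc m)
      have bc: "b [^] p \<in> carrier R" using b by auto
      have "b [^] p \<ominus> a (Suc n) = (b [^] p \<ominus> a n) \<ominus> (a (Suc n) \<ominus> a n)" using bc ac[of n] ac[of "Suc n"] by algebra
      also have "\<dots> \<in> I n" by (rule I_sub[OF conjunct2[OF b]]) (use a(1) in \<open>simp add: Coh_def\<close>)
      finally have *: "b [^] p \<ominus> a (Suc n) \<in> I n" .
      obtain b' where "b' \<in> Units R" "b' \<ominus> b \<in> I n" "b' [^] p \<ominus> a (Suc n) \<in> I (Suc n)"
        using hensel_step[OF _ conjunct1[OF b] ac *] Suc by blast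
      then show ?thesis by blast
    qed
  qed
  then obtain b where b: "\<And>n. b n \<in> Units R" "\<And>n. b n [^] p \<ominus> a n \<in> I n" "\<And>n. b (Suc n) \<ominus> b n \<in> I n" by blast
  have cb: "Coh b" unfolding Coh_def using b(1,3) by auto
  have "Lim b [^]\<^bsub>A\<^esub> p = u" using Lim_pow[OF cb, of p] Lim_eq_iff[of "\<lambda>k. b k [^] p" a] a b(2) by simp
  then show ?thesis using Lim_closed[OF cb] by blast
qed

text \<open>A nonzero limit has an entry outside its power of the maximal ideal, so there is a last
  level \<open>k\<close> of divisibility; dividing by \<open>\<pi>^k\<close> leaves a nonzero
  residue.\<close>

lemma A_factor:
  assumes "s \<in> carrier A" "s \<noteq> \<zero>\<^bsub>A\<^esub>"
  shows "\<exists>u\<in>Units A. \<exists>n::nat. s = u \<otimes>\<^bsub>A\<^esub> Lim (\<lambda>_. \<pi>) [^]\<^bsub>A\<^esub> n"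
proof -
  obtain a where a: "Coh a" "s = Lim a" using assms by (metis A_cases)
  then obtain n where "a n \<notin> I n" using Lim_zero_iff[OF a(1)] assms(2) by blast
  then obtain k where k: "a k \<in> I k" "a (Suc k) \<notin> I (Suc k)"
  proof (induction n)
    case 0
    then show ?case using I_0 Coh_closed[OF a(1)] by simp
  next
    case (Suc n)
    then show ?case by blast
  qed
  obtain b where b: "Coh b" "Lim a = Lim b \<otimes>\<^bsub>A\<^esub> Lim (\<lambda>_. \<pi>) [^]\<^bsub>A\<^esub> k" "\<And>j. a (k + j) = b j \<otimes> \<pi> [^] k"
    using Lim_divide[OF a(1) k(1)] by blast
  have "b (Suc 0) \<notin> I (Suc 0)"
  proof
    assume "b (Suc 0) \<in> I (Suc 0)"
    moreover have "\<pi> [^] k \<in> I k" unfolding I_eq by (rule cgenideal_self[OF pi_pow(1)])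
    ultimately have "b (Suc 0) \<otimes> \<pi> [^] k \<in> I (Suc 0 + k)" by (rule I_prod)
    then show False using k(2) b(3)[of "Suc 0"] by simp
  qed
  then have "Lim b \<in> Units A" using Lim_unit_iff[OF b(1)] by simp
  then show ?thesis using b(2) a(2) by blast
qed

lemma A_nonunits: "nonunits A = PIdl\<^bsub>A\<^esub> (Lim (\<lambda>_. \<pi>))"
proof
  have pc: "Coh (\<lambda>_. \<pi>)" by (rule Coh_const[OF pi(1)])
  have piI: "\<pi> \<in> I (Suc 0)" unfolding I_1 pi(3) by (rule cgenideal_self[OF pi(1)])
  show "nonunits A \<subseteq> PIdl\<^bsub>A\<^esub> (Lim (\<lambda>_. \<pi>))"
  proof
    fix s assume s: "s \<in> nonunits A"
    then have "s \<in> carrier A" unfolding nonunits_def[of A] by blast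
    then obtain a where a: "Coh a" "s = Lim a" by (rule A_cases)
    have "a (Suc 0) \<in> I (Suc 0)" using s Lim_unit_iff[OF a(1)] a(2) unfolding nonunits_def[of A] by blast
    then obtain b where b: "Coh b" "Lim a = Lim b \<otimes>\<^bsub>A\<^esub> Lim (\<lambda>_. \<pi>) [^]\<^bsub>A\<^esub> Suc 0" using Lim_divide[OF a(1)] by blast
    have "s = Lim b \<otimes>\<^bsub>A\<^esub> Lim (\<lambda>_. \<pi>)" using b a(2) Lim_closed[OF pc] by simp
    then show "s \<in> PIdl\<^bsub>A\<^esub> (Lim (\<lambda>_. \<pi>))" unfolding A.cgenideal_iff using Lim_closed[OF b(1)] by blast
  qed
  show "PIdl\<^bsub>A\<^esub> (Lim (\<lambda>_. \<pi>)) \<subseteq> nonunits A"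
  proof
    fix s assume "s \<in> PIdl\<^bsub>A\<^esub> (Lim (\<lambda>_. \<pi>))"
    then obtain x where x: "x \<in> carrier A" "s = x \<otimes>\<^bsub>A\<^esub> Lim (\<lambda>_. \<pi>)" unfolding A.cgenideal_iff by blast
    obtain b where b: "Coh b" "x = Lim b" using x(1) by (rule A_cases)
    have s: "s = Lim (\<lambda>n. b n \<otimes> \<pi>)" unfolding x(2) b(2) by (rule Lim_mult[OF b(1) pc])
    have "b (Suc 0) \<otimes> \<pi> \<in> I (Suc 0)" using I_mult(2)[OF piI] Coh_closed[OF b(1)] by blast
    then show "s \<in> nonunits A" unfolding nonunits_def[of A] s using Lim_unit_iff[OF Coh_mult[OF b(1) pc]] Lim_closed[OF Coh_mult[OF b(1) pc]] by blast
  qed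
qed

theorem completion_dvr: "pth_root_dvr A (Lim (\<lambda>_. \<pi>)) p (Lim (\<lambda>_. \<zeta>))"
proof (rule pth_root_dvr.intro[OF A_domain], unfold_locales)
  show "Lim (\<lambda>_. \<pi>) \<in> carrier A" by (rule Lim_closed[OF Coh_const[OF pi(1)]])
  show "Lim (\<lambda>_. \<pi>) \<noteq> \<zero>\<^bsub>A\<^esub>"
  proof
    assume "Lim (\<lambda>_. \<pi>) = \<zero>\<^bsub>A\<^esub>"
    \<comment> \<open>Cancelling one factor \<open>\<pi>\<close> will put 1 into the maximal
      ideal.\<close>
    then have "\<pi> \<in> I (Suc 0 + Suc 0)" using Lim_zero_iff[OF Coh_const[OF pi(1)]] by simp
    then have "\<one> \<otimes> \<pi> [^] Suc 0 \<in> I (Suc 0 + Suc 0)" using pi by simp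
    then have "\<one> \<in> I (Suc 0)" by (rule I_cancel[OF one_closed])
    then show False using I_proper by blast
  qed
  show "nonunits A = PIdl\<^bsub>A\<^esub> (Lim (\<lambda>_. \<pi>))" by (rule A_nonunits)
  show "\<exists>u\<in>Units A. \<exists>n::nat. s = u \<otimes>\<^bsub>A\<^esub> Lim (\<lambda>_. \<pi>) [^]\<^bsub>A\<^esub> n" if "s \<in> carrier A" "s \<noteq> \<zero>\<^bsub>A\<^esub>" for s
    using A_factor[OF that] .
  show "Factorial_Ring.prime p" by (rule prime_p)
  show "\<exists>v\<in>carrier A. v [^]\<^bsub>A\<^esub> p = u" if "u \<in> Units A" for u using A_pth_root[OF that] .
  have np: "add_pow A n \<one>\<^bsub>A\<^esub> = Lim (\<lambda>_. add_pow R n \<one>)" for n :: nat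
  proof (induction n)
    case 0
    show ?case by (simp add: A_zero)
  next
    case (Suc n)
    have "add_pow A (Suc n) \<one>\<^bsub>A\<^esub> = Lim (\<lambda>_. add_pow R n \<one>) \<oplus>\<^bsub>A\<^esub> Lim (\<lambda>_. \<one>)"
      using Suc by (simp add: A.add.nat_pow_Suc A_one)
    also have "\<dots> = Lim (\<lambda>_. add_pow R n \<one> \<oplus> \<one>)" by (intro Lim_add Coh_const) auto
    finally show ?case by (simp add: add.nat_pow_Suc)
  qed
  show "add_pow A p \<one>\<^bsub>A\<^esub> \<in> Units A"
    unfolding np using Lim_unit_iff[OF Coh_const[OF Units_closed[OF p_unit]]] unit_iff[OF Units_closed[OF p_unit]] p_unit by blast
  show "Lim (\<lambda>_. \<zeta>) \<in> carrier A" by (rule Lim_closed[OF Coh_const[OF zeta(1)]])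
  show "Lim (\<lambda>_. \<zeta>) [^]\<^bsub>A\<^esub> p = \<one>\<^bsub>A\<^esub>" unfolding const_pow[OF zeta(1)] zeta(2) A_one ..
  show "Lim (\<lambda>_. \<zeta>) \<noteq> \<one>\<^bsub>A\<^esub>"
    unfolding A_one Lim_eq_iff[OF Coh_const[OF zeta(1)] Coh_const[OF one_closed]]
    using unit_iff[OF Units_closed[OF zeta(3)]] zeta(3) by blast
qed

end

section \<open>Local rings of projective curves\<close>

definition mono_eval :: "('n::finite \<Rightarrow>\<^sub>0 nat) \<Rightarrow> ('n \<Rightarrow> 'k::field) \<Rightarrow> 'k" where
  "mono_eval m v = (\<Prod>i\<in>UNIV. v i ^ Poly_Mapping.lookup m i)"

lemma mono_eval_add: "mono_eval (m + n) v = mono_eval m v * mono_eval n v"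
  by (simp add: mono_eval_def lookup_add power_add prod.distrib)

lemma mono_eval_0 [simp]: "mono_eval 0 v = 1"
  by (simp add: mono_eval_def)

text \<open>A common finite index set allows sums over different supports to be compared.\<close>

lemma mpoly_eval_superset:
  assumes "finite A" "Poly_Mapping.keys f \<subseteq> A"
  shows "mpoly_eval f v = (\<Sum>m\<in>A. Poly_Mapping.lookup f m * mono_eval m v)"
  unfolding mpoly_eval_def mono_eval_def
  by (rule sum.mono_neutral_left) (use assms in \<open>auto simp: in_keys_iff\<close>)

lemma mpoly_eval_add: "mpoly_eval (f + g) v = mpoly_eval f v + mpoly_eval g v"
proof -
  let ?A = "Poly_Mapping.keys f \<union> Poly_Mapping.keys g"
  have "Poly_Mapping.keys (f + g) \<subseteq> ?A" by (rule Poly_Mapping.keys_add)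
  then show ?thesis
    by (simp add: mpoly_eval_superset[of ?A] lookup_add distrib_right sum.distrib)
qed

lemma mpoly_eval_zero [simp]: "mpoly_eval 0 v = 0"
  by (simp add: mpoly_eval_def)

lemma mpoly_eval_uminus: "mpoly_eval (- f) v = - mpoly_eval f v"
  using mpoly_eval_add[of "- f" f v] by (simp add: eq_neg_iff_add_eq_0)

lemma mpoly_eval_diff: "mpoly_eval (f - g) v = mpoly_eval f v - mpoly_eval g v"
  using mpoly_eval_add[of f "- g" v] by (simp add: mpoly_eval_uminus)

lemma mpoly_eval_sum: "mpoly_eval (sum h A) v = (\<Sum>a\<in>A. mpoly_eval (h a) v)"
  by (induction A rule: infinite_finite_induct) (auto simp: mpoly_eval_add)

lemma mpoly_eval_single: "mpoly_eval (Poly_Mapping.single m c) v = c * mono_eval m v"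
  by (simp add: mpoly_eval_superset[of "{m}"])

lemma mpoly_as_sum:
  fixes f :: "('n::finite, 'k::field) mpoly"
  shows "f = (\<Sum>m\<in>Poly_Mapping.keys f. Poly_Mapping.single m (Poly_Mapping.lookup f m))"
  by (rule poly_mapping_eqI)
     (simp add: lookup_sum lookup_single when_def sum.delta in_keys_iff)

lemma mpoly_eval_mult: "mpoly_eval (f * g) v = mpoly_eval f v * mpoly_eval g v"
proof -
  let ?s = "\<lambda>f m. Poly_Mapping.single m (Poly_Mapping.lookup f m)"
  have "f * g = (\<Sum>m\<in>Poly_Mapping.keys f. ?s f m) * (\<Sum>n\<in>Poly_Mapping.keys g. ?s g n)"
    using mpoly_as_sum[of f] mpoly_as_sum[of g] by simp
  also have "\<dots> = (\<Sum>m\<in>Poly_Mapping.keys f. \<Sum>n\<in>Poly_Mapping.keys g. ?s f m * ?s g n)"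
    by (rule sum_product)
  finally have "mpoly_eval (f * g) v = (\<Sum>m\<in>Poly_Mapping.keys f. \<Sum>n\<in>Poly_Mapping.keys g.
      (Poly_Mapping.lookup f m * mono_eval m v) * (Poly_Mapping.lookup g n * mono_eval n v))"
    by (simp add: mpoly_eval_sum mult_single mpoly_eval_single mono_eval_add mult_ac)
  also have "\<dots> = mpoly_eval f v * mpoly_eval g v"
    by (simp add: sum_product[symmetric] mpoly_eval_def mono_eval_def)
  finally show ?thesis .
qed

lemma mpoly_eval_one [simp]: "mpoly_eval 1 v = 1"
  by (simp add: single_one[symmetric] mpoly_eval_single del: single_one)

lemmas mpoly_eval_simps = mpoly_eval_add mpoly_eval_diff mpoly_eval_mult

lemma homogeneous_scale:
  assumes "homogeneous d f"
  shows "mpoly_eval f (\<lambda>i. c * v i) = c ^ d * mpoly_eval f v"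
proof -
  have "mono_eval m (\<lambda>i. c * v i) = c ^ d * mono_eval m v" if "m \<in> Poly_Mapping.keys f" for m
    using assms that by (simp add: mono_eval_def homogeneous_def power_mult_distrib prod.distrib power_sum[symmetric])
  then show ?thesis
    unfolding mpoly_eval_def mono_eval_def[symmetric] sum_distrib_left by (intro sum.cong) (auto simp: mult_ac)
qed

lemma homogeneous_add: "homogeneous d f \<Longrightarrow> homogeneous d g \<Longrightarrow> homogeneous d (f + g)"
  unfolding homogeneous_def using Poly_Mapping.keys_add[of f g] by blast

lemma homogeneous_uminus: "homogeneous d f \<Longrightarrow> homogeneous d (- f)"
  unfolding homogeneous_def by simp

lemma homogeneous_diff: "homogeneous d f \<Longrightarrow> homogeneous d g \<Longrightarrow> homogeneous d (f - g)"
  using homogeneous_add[of d f "- g"] homogeneous_uminus[of d g] by simp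

lemma homogeneous_mult:
  assumes "homogeneous d f" "homogeneous e g"
  shows "homogeneous (d + e) (f * g)"
  unfolding homogeneous_def
proof
  fix m assume "m \<in> Poly_Mapping.keys (f * g)"
  then obtain a b where "a \<in> Poly_Mapping.keys f" "b \<in> Poly_Mapping.keys g" "m = a + b"
    using keys_mult[of f g] by blast
  then show "(\<Sum>i\<in>UNIV. Poly_Mapping.lookup m i) = d + e"
    using assms by (simp add: homogeneous_def lookup_add sum.distrib)
qed

lemma homogeneous_zero [simp]: "homogeneous d 0"
  by (simp add: homogeneous_def)

lemma homogeneous_const [simp]: "homogeneous 0 (Poly_Mapping.single 0 c)"
  by (simp add: homogeneous_def)

lemma homogeneous_one [simp]: "homogeneous 0 1"
  by (simp add: homogeneous_def)

lemma homogeneous_power: "homogeneous d f \<Longrightarrow> homogeneous (d * n) (f ^ n)"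
  by (induction n) (auto simp: homogeneous_mult add.commute)

lemma proj_point_eq:
  assumes "x \<in> proj_space" "v \<in> x"
  shows "x = {(\<lambda>i. c * v i) | c. c \<noteq> 0}"
proof -
  obtain w where w: "x = {(\<lambda>i. c * w i) | c. c \<noteq> 0}" using assms(1) unfolding proj_space_def by blast
  obtain c where c: "c \<noteq> 0" "v = (\<lambda>i. c * w i)" using assms(2) unfolding w by blast
  show ?thesis
  proof (rule equalityI; rule subsetI)
    fix u assume "u \<in> x"
    then obtain d where d: "d \<noteq> 0" "u = (\<lambda>i. d * w i)" unfolding w by blast
    have "u = (\<lambda>i. (d / c) * v i)" unfolding d c using c(1) by (simp add: fun_eq_iff)
    moreover have "d / c \<noteq> 0" using d c by simp
    ultimately show "u \<in> {(\<lambda>i. c * v i) | c. c \<noteq> 0}" by blast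
  next
    fix u assume "u \<in> {(\<lambda>i. c * v i) | c. c \<noteq> 0}"
    then obtain d where d: "d \<noteq> 0" "u = (\<lambda>i. d * v i)" by blast
    have "u = (\<lambda>i. (d * c) * w i)" unfolding d c by (simp add: fun_eq_iff mult.assoc)
    moreover have "d * c \<noteq> 0" using d c by simp
    ultimately show "u \<in> x" unfolding w by blast
  qed
qed

text \<open>The coordinate vectors of a point differ by nonzero scalars, which a homogeneous
  polynomial turns into a nonzero factor.\<close>

lemma vanishes_at_iff:
  assumes "x \<in> proj_space" "v \<in> x" "homogeneous d f"
  shows "vanishes_at f x \<longleftrightarrow> mpoly_eval f v = 0"
proof
  assume "mpoly_eval f v = 0"
  then show "vanishes_at f x"
    unfolding vanishes_at_def using proj_point_eq[OF assms(1,2)] homogeneous_scale[OF assms(3), of _ v] by auto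
qed (use assms in \<open>simp add: vanishes_at_def\<close>)

lemma proj_space_nonempty: "x \<in> proj_space \<Longrightarrow> \<exists>v. v \<in> x \<and> v \<noteq> (\<lambda>i. 0)"
proof -
  assume "x \<in> proj_space"
  then obtain w where w: "x = {(\<lambda>i. c * w i) | c. c \<noteq> 0}" "w \<noteq> (\<lambda>i. 0)" unfolding proj_space_def by blast
  have "w \<in> x" unfolding w(1) by (rule CollectI, rule exI[of _ 1]) simp
  then show ?thesis using w(2) by blast
qed

text \<open>Vanishing is phrased with coordinate vectors, so that relations between fractions become
  identities between values in the ground field.\<close>

definition vanishes_on :: "('n::finite, 'k::field) point set \<Rightarrow> ('n, 'k) mpoly \<Rightarrow> bool" where
  "vanishes_on C f \<longleftrightarrow> (\<forall>v\<in>\<Union>C. mpoly_eval f v = 0)"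

lemma vanishes_on_iff: "(\<forall>y\<in>C. vanishes_at f y) \<longleftrightarrow> vanishes_on C f"
  by (auto simp: vanishes_on_def vanishes_at_def)

text \<open>The zero sets of \<open>a\<close> and \<open>b\<close> in \<open>C\<close> are closed
  and cover \<open>C\<close>, so irreducibility makes one of them all of \<open>C\<close>.\<close>

lemma irreducible_closed_prime:
  assumes C: "irreducible_closed C" and h: "homogeneous d a" "homogeneous e b" and ab: "vanishes_on C (a * b)"
  shows "vanishes_on C a \<or> vanishes_on C b"
proof -
  obtain F where F: "\<forall>f\<in>F. \<exists>d. homogeneous d f" "C = {x \<in> proj_space. \<forall>f\<in>F. vanishes_at f x}"
    using C unfolding irreducible_closed_def zariski_closed_def by blast
  have cl: "zariski_closed {x \<in> C. vanishes_at g x}" if "homogeneous d g" for g d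
    unfolding zariski_closed_def using F that by (intro exI[of _ "insert g F"]) auto
  have "C = {x \<in> C. vanishes_at a x} \<union> {x \<in> C. vanishes_at b x}"
  proof -
    have "vanishes_at a x \<or> vanishes_at b x" if x: "x \<in> C" for x
    proof -
      have xp: "x \<in> proj_space" using x F by blast
      obtain v where v: "v \<in> x" using proj_space_nonempty[OF xp] by blast
      have "mpoly_eval a v * mpoly_eval b v = 0" using ab x v unfolding vanishes_on_def mpoly_eval_mult by blast
      then show ?thesis using vanishes_at_iff[OF xp v h(1)] vanishes_at_iff[OF xp v h(2)] by auto
    qed
    then show ?thesis by blast
  qed
  then have "C = {x \<in> C. vanishes_at a x} \<or> C = {x \<in> C. vanishes_at b x}"
    using C cl[OF h(1)] cl[OF h(2)] unfolding irreducible_closed_def by blast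
  then show ?thesis unfolding vanishes_on_iff[symmetric] by blast
qed

section \<open>The local ring at a point\<close>

locale curve_point =
  fixes C :: "('n::finite, 'k::alg_closed_field) point set" and x :: "('n, 'k) point" and v0 :: "'n \<Rightarrow> 'k"
  assumes C: "irreducible_closed C" and xC: "x \<in> C" and v0: "v0 \<in> x"
begin

abbreviation "V \<equiv> \<Union>C"
abbreviation "ev \<equiv> mpoly_eval"
abbreviation "R \<equiv> local_ring C x"
abbreviation "cls f g \<equiv> local_rel C x `` {(f, g)}"
abbreviation "Fr \<equiv> local_fractions x"

lemma x_proj: "x \<in> proj_space"
  using C xC unfolding irreducible_closed_def zariski_closed_def by blast

lemma v0_V: "v0 \<in> V" using xC v0 by blast

lemma Fr_iff: "(f, g) \<in> Fr \<longleftrightarrow> (\<exists>d. homogeneous d f \<and> homogeneous d g) \<and> ev g v0 \<noteq> 0"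
  unfolding local_fractions_def using vanishes_at_iff[OF x_proj v0] by auto

lemma FrE:
  assumes "(f, g) \<in> Fr"
  obtains d where "homogeneous d f" "homogeneous d g" "ev g v0 \<noteq> 0"
  using assms unfolding Fr_iff by blast

lemma rel_iff: "((f, g), (f', g')) \<in> local_rel C x \<longleftrightarrow> (f, g) \<in> Fr \<and> (f', g') \<in> Fr \<and>
    (\<forall>v\<in>V. ev f v * ev g' v = ev f' v * ev g v)"
  unfolding local_rel_def vanishes_on_iff vanishes_on_def by (auto simp: mpoly_eval_simps)

text \<open>\<open>g\<close> does not vanish on all of \<open>C\<close>, since \<open>v0\<close>
  belongs to a point of \<open>C\<close>, so primeness applies. This is what makes
  \<open>local_rel\<close> transitive.\<close>

lemma cancel:
  assumes g: "homogeneous e g" "ev g v0 \<noteq> 0" and h: "homogeneous d h" and gh: "\<forall>v\<in>V. ev g v * ev h v = 0"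
  shows "\<forall>v\<in>V. ev h v = 0"
  using irreducible_closed_prime[OF C g(1) h] g(2) v0_V gh by (auto simp: vanishes_on_def mpoly_eval_mult)

lemma rel_equiv: "equiv Fr (local_rel C x)"
proof (rule equivI)
  show "local_rel C x \<subseteq> Fr \<times> Fr" unfolding local_rel_def by auto
  show "refl_on Fr (local_rel C x)" by (auto simp: refl_on_def rel_iff)
  show "sym (local_rel C x)" by (auto simp: sym_def rel_iff)
  show "trans (local_rel C x)"
  proof (rule transI)
    fix a b c assume ab: "(a, b) \<in> local_rel C x" and bc: "(b, c) \<in> local_rel C x"
    obtain f g f' g' f'' g'' where abc: "a = (f, g)" "b = (f', g')" "c = (f'', g'')" by (cases a, cases b, cases c)
    have F: "(f, g) \<in> Fr" "(f', g') \<in> Fr" "(f'', g'') \<in> Fr"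
      and e: "\<And>v. v \<in> V \<Longrightarrow> ev f v * ev g' v = ev f' v * ev g v" "\<And>v. v \<in> V \<Longrightarrow> ev f' v * ev g'' v = ev f'' v * ev g' v"
      using ab bc unfolding abc rel_iff by auto
    obtain d where d: "homogeneous d f" "homogeneous d g" using F(1) by (rule FrE)
    obtain d' where d': "homogeneous d' f'" "homogeneous d' g'" "ev g' v0 \<noteq> 0" using F(2) by (rule FrE)
    obtain d'' where d'': "homogeneous d'' f''" "homogeneous d'' g''" using F(3) by (rule FrE)
    have h: "homogeneous (d + d'') (f * g'' - f'' * g)"
      using homogeneous_mult[OF d(1) d''(2)] homogeneous_mult[OF d''(1) d(2)] by (intro homogeneous_diff) (auto simp: add.commute)
    have "\<forall>v\<in>V. ev g' v * ev (f * g'' - f'' * g) v = 0"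
    proof
      fix v assume v: "v \<in> V"
      have "ev g' v * ev (f * g'' - f'' * g) v = (ev f v * ev g' v) * ev g'' v - (ev f'' v * ev g' v) * ev g v"
        by (simp add: mpoly_eval_simps algebra_simps)
      also have "\<dots> = 0" unfolding e(1)[OF v] e(2)[OF v, symmetric] by (simp add: algebra_simps)
      finally show "ev g' v * ev (f * g'' - f'' * g) v = 0" .
    qed
    then have "\<forall>v\<in>V. ev (f * g'' - f'' * g) v = 0" by (rule cancel[OF d'(2,3) h])
    then show "(a, c) \<in> local_rel C x" unfolding abc rel_iff using F by (auto simp: mpoly_eval_simps)
  qed
qed

lemma cls_eq_iff:
  assumes "(f, g) \<in> Fr" "(f', g') \<in> Fr"
  shows "cls f g = cls f' g' \<longleftrightarrow> (\<forall>v\<in>V. ev f v * ev g' v = ev f' v * ev g v)"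
  using eq_equiv_class_iff[OF rel_equiv assms] assms by (simp add: rel_iff)

lemma mem_cls: "(f', g') \<in> cls f g \<longleftrightarrow> ((f, g), (f', g')) \<in> local_rel C x" by simp

lemma Fr_mult: "(f, g) \<in> Fr \<Longrightarrow> (f', g') \<in> Fr \<Longrightarrow> (f * f', g * g') \<in> Fr"
  unfolding Fr_iff using homogeneous_mult by (fastforce simp: mpoly_eval_mult)

lemma Fr_add: "(f, g) \<in> Fr \<Longrightarrow> (f', g') \<in> Fr \<Longrightarrow> (f * g' + f' * g, g * g') \<in> Fr"
proof -
  assume F: "(f, g) \<in> Fr" "(f', g') \<in> Fr"
  obtain d where d: "homogeneous d f" "homogeneous d g" "ev g v0 \<noteq> 0" using F(1) by (rule FrE)
  obtain d' where d': "homogeneous d' f'" "homogeneous d' g'" "ev g' v0 \<noteq> 0" using F(2) by (rule FrE)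
  have "homogeneous (d + d') (f * g' + f' * g)"
    using homogeneous_mult[OF d(1) d'(2)] homogeneous_mult[OF d'(1) d(2)] by (intro homogeneous_add) (auto simp: add.commute)
  then show ?thesis unfolding Fr_iff using homogeneous_mult[OF d(2) d'(2)] d(3) d'(3) by (auto simp: mpoly_eval_mult)
qed

lemma Fr_uminus: "(f, g) \<in> Fr \<Longrightarrow> (- f, g) \<in> Fr"
  unfolding Fr_iff using homogeneous_uminus by blast

lemma Fr_const: "(Poly_Mapping.single 0 c, 1) \<in> Fr"
  unfolding Fr_iff using homogeneous_const homogeneous_one by (auto intro: exI[of _ 0])

lemma Fr_one: "(1, 1) \<in> Fr" and Fr_zero: "(0, 1) \<in> Fr"
  unfolding Fr_iff by (auto intro: exI[of _ 0])

lemma R_mult: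
  assumes F: "(f, g) \<in> Fr" "(f', g') \<in> Fr"
  shows "cls f g \<otimes>\<^bsub>R\<^esub> cls f' g' = cls (f * f') (g * g')"
proof -
  have 1: "cls (a * a') (b * b') = cls (f * f') (g * g')" if "(a, b) \<in> cls f g" "(a', b') \<in> cls f' g'" for a b a' b'
  proof -
    have h: "(a, b) \<in> Fr" "(a', b') \<in> Fr" "\<And>v. v \<in> V \<Longrightarrow> ev f v * ev b v = ev a v * ev g v"
      "\<And>v. v \<in> V \<Longrightarrow> ev f' v * ev b' v = ev a' v * ev g' v" using that unfolding mem_cls rel_iff by auto
    have "ev (a * a') v * ev (g * g') v = ev (f * f') v * ev (b * b') v" if v: "v \<in> V" for v
    proof -
      have "ev (a * a') v * ev (g * g') v = (ev a v * ev g v) * (ev a' v * ev g' v)" by (simp add: mpoly_eval_mult)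
      also have "\<dots> = ev (f * f') v * ev (b * b') v" unfolding h(3)[OF v, symmetric] h(4)[OF v, symmetric] by (simp add: mpoly_eval_mult)
      finally show ?thesis .
    qed
    then show ?thesis using cls_eq_iff[OF Fr_mult[OF h(1,2)] Fr_mult[OF F]] by blast
  qed
  have 2: "(f, g) \<in> cls f g" "(f', g') \<in> cls f' g'" using F by (auto simp: rel_iff)
  have "cls f g \<otimes>\<^bsub>R\<^esub> cls f' g' = (\<Union>(a, b)\<in>cls f g. \<Union>(a', b')\<in>cls f' g'. cls (a * a') (b * b'))"
    unfolding local_ring_def by simp
  also have "\<dots> = (\<Union>z\<in>cls f g. \<Union>z'\<in>cls f' g'. cls (f * f') (g * g'))"
    using 1 by (intro SUP_cong refl) (auto simp: split_beta)
  also have "\<dots> = cls (f * f') (g * g')" using 2 by blast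
  finally show ?thesis .
qed

lemma R_add:
  assumes F: "(f, g) \<in> Fr" "(f', g') \<in> Fr"
  shows "cls f g \<oplus>\<^bsub>R\<^esub> cls f' g' = cls (f * g' + f' * g) (g * g')"
proof -
  have 1: "cls (a * b' + a' * b) (b * b') = cls (f * g' + f' * g) (g * g')" if "(a, b) \<in> cls f g" "(a', b') \<in> cls f' g'" for a b a' b'
  proof -
    have h: "(a, b) \<in> Fr" "(a', b') \<in> Fr" "\<And>v. v \<in> V \<Longrightarrow> ev f v * ev b v = ev a v * ev g v"
      "\<And>v. v \<in> V \<Longrightarrow> ev f' v * ev b' v = ev a' v * ev g' v" using that unfolding mem_cls rel_iff by auto
    have "ev (a * b' + a' * b) v * ev (g * g') v = ev (f * g' + f' * g) v * ev (b * b') v" if v: "v \<in> V" for v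
    proof -
      have "ev (a * b' + a' * b) v * ev (g * g') v = (ev a v * ev g v) * (ev b' v * ev g' v) + (ev a' v * ev g' v) * (ev b v * ev g v)"
        by (simp add: mpoly_eval_simps algebra_simps)
      also have "\<dots> = ev (f * g' + f' * g) v * ev (b * b') v" unfolding h(3)[OF v, symmetric] h(4)[OF v, symmetric]
        by (simp add: mpoly_eval_simps algebra_simps)
      finally show ?thesis .
    qed
    then show ?thesis using cls_eq_iff[OF Fr_add[OF h(1,2)] Fr_add[OF F]] by blast
  qed
  have 2: "(f, g) \<in> cls f g" "(f', g') \<in> cls f' g'" using F by (auto simp: rel_iff)
  have "cls f g \<oplus>\<^bsub>R\<^esub> cls f' g' = (\<Union>(a, b)\<in>cls f g. \<Union>(a', b')\<in>cls f' g'. cls (a * b' + a' * b) (b * b'))"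
    unfolding local_ring_def by simp
  also have "\<dots> = (\<Union>z\<in>cls f g. \<Union>z'\<in>cls f' g'. cls (f * g' + f' * g) (g * g'))"
    using 1 by (intro SUP_cong refl) (auto simp: split_beta)
  also have "\<dots> = cls (f * g' + f' * g) (g * g')" using 2 by blast
  finally show ?thesis .
qed

lemma R_one: "\<one>\<^bsub>R\<^esub> = cls 1 1" and R_zero: "\<zero>\<^bsub>R\<^esub> = cls 0 1"
  by (simp_all add: local_ring_def)

lemma R_closed: "(f, g) \<in> Fr \<Longrightarrow> cls f g \<in> carrier R"
  by (auto simp: local_ring_def quotient_def)

lemma R_cases:
  assumes "r \<in> carrier R"
  obtains f g where "(f, g) \<in> Fr" "r = cls f g"
  using assms by (auto simp: local_ring_def quotient_def)

lemma R_cring: "cring R"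
proof (rule cringI)
  show "abelian_group R"
  proof (rule abelian_groupI)
    show "\<zero>\<^bsub>R\<^esub> \<in> carrier R" unfolding R_zero by (rule R_closed[OF Fr_zero])
    fix a assume "a \<in> carrier R"
    then obtain f g where a: "(f, g) \<in> Fr" "a = cls f g" by (rule R_cases)
    show "\<zero>\<^bsub>R\<^esub> \<oplus>\<^bsub>R\<^esub> a = a" unfolding R_zero a(2) R_add[OF Fr_zero a(1)] by simp
    have "cls (- f) g \<oplus>\<^bsub>R\<^esub> a = \<zero>\<^bsub>R\<^esub>" unfolding R_zero a(2) R_add[OF Fr_uminus[OF a(1)] a(1)]
      using cls_eq_iff[OF Fr_add[OF Fr_uminus[OF a(1)] a(1)] Fr_zero] by (simp add: mpoly_eval_simps mpoly_eval_uminus)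
    then show "\<exists>b\<in>carrier R. b \<oplus>\<^bsub>R\<^esub> a = \<zero>\<^bsub>R\<^esub>" using R_closed[OF Fr_uminus[OF a(1)]] by blast
    fix b assume "b \<in> carrier R"
    then obtain f' g' where b: "(f', g') \<in> Fr" "b = cls f' g'" by (rule R_cases)
    show "a \<oplus>\<^bsub>R\<^esub> b \<in> carrier R" unfolding a(2) b(2) R_add[OF a(1) b(1)] by (rule R_closed[OF Fr_add[OF a(1) b(1)]])
    show "a \<oplus>\<^bsub>R\<^esub> b = b \<oplus>\<^bsub>R\<^esub> a" unfolding a(2) b(2) R_add[OF a(1) b(1)] R_add[OF b(1) a(1)] by (simp add: algebra_simps)
    fix c assume "c \<in> carrier R"
    then obtain f'' g'' where c: "(f'', g'') \<in> Fr" "c = cls f'' g''" by (rule R_cases)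
    show "a \<oplus>\<^bsub>R\<^esub> b \<oplus>\<^bsub>R\<^esub> c = a \<oplus>\<^bsub>R\<^esub> (b \<oplus>\<^bsub>R\<^esub> c)"
      unfolding a(2) b(2) c(2) R_add[OF a(1) b(1)] R_add[OF b(1) c(1)] R_add[OF Fr_add[OF a(1) b(1)] c(1)] R_add[OF a(1) Fr_add[OF b(1) c(1)]]
      by (simp add: algebra_simps)
  qed
  show "Group.comm_monoid R"
  proof (rule comm_monoidI)
    show "\<one>\<^bsub>R\<^esub> \<in> carrier R" unfolding R_one by (rule R_closed[OF Fr_one])
    fix a assume "a \<in> carrier R"
    then obtain f g where a: "(f, g) \<in> Fr" "a = cls f g" by (rule R_cases)
    show "\<one>\<^bsub>R\<^esub> \<otimes>\<^bsub>R\<^esub> a = a" unfolding R_one a(2) R_mult[OF Fr_one a(1)] by simp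
    fix b assume "b \<in> carrier R"
    then obtain f' g' where b: "(f', g') \<in> Fr" "b = cls f' g'" by (rule R_cases)
    show "a \<otimes>\<^bsub>R\<^esub> b \<in> carrier R" unfolding a(2) b(2) R_mult[OF a(1) b(1)] by (rule R_closed[OF Fr_mult[OF a(1) b(1)]])
    show "a \<otimes>\<^bsub>R\<^esub> b = b \<otimes>\<^bsub>R\<^esub> a" unfolding a(2) b(2) R_mult[OF a(1) b(1)] R_mult[OF b(1) a(1)] by (simp add: algebra_simps)
    fix c assume "c \<in> carrier R"
    then obtain f'' g'' where c: "(f'', g'') \<in> Fr" "c = cls f'' g''" by (rule R_cases)
    show "a \<otimes>\<^bsub>R\<^esub> b \<otimes>\<^bsub>R\<^esub> c = a \<otimes>\<^bsub>R\<^esub> (b \<otimes>\<^bsub>R\<^esub> c)"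
      unfolding a(2) b(2) c(2) R_mult[OF a(1) b(1)] R_mult[OF b(1) c(1)] R_mult[OF Fr_mult[OF a(1) b(1)] c(1)] R_mult[OF a(1) Fr_mult[OF b(1) c(1)]]
      by (simp add: algebra_simps)
  qed
  fix a b c assume "a \<in> carrier R" "b \<in> carrier R" "c \<in> carrier R"
  then obtain f g f' g' f'' g'' where a: "(f, g) \<in> Fr" "a = cls f g" and b: "(f', g') \<in> Fr" "b = cls f' g'" and c: "(f'', g'') \<in> Fr" "c = cls f'' g''"
    by (metis R_cases)
  show "(a \<oplus>\<^bsub>R\<^esub> b) \<otimes>\<^bsub>R\<^esub> c = a \<otimes>\<^bsub>R\<^esub> c \<oplus>\<^bsub>R\<^esub> b \<otimes>\<^bsub>R\<^esub> c"
    unfolding a(2) b(2) c(2) R_add[OF a(1) b(1)] R_mult[OF a(1) c(1)] R_mult[OF b(1) c(1)]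
      R_mult[OF Fr_add[OF a(1) b(1)] c(1)] R_add[OF Fr_mult[OF a(1) c(1)] Fr_mult[OF b(1) c(1)]]
    using cls_eq_iff[OF Fr_mult[OF Fr_add[OF a(1) b(1)] c(1)] Fr_add[OF Fr_mult[OF a(1) c(1)] Fr_mult[OF b(1) c(1)]]]
    by (simp add: mpoly_eval_simps algebra_simps)
qed

sublocale R: cring R by (rule R_cring)

text \<open>The value of a fraction at the point, that is, its class in the residue field. It
  depends on the class alone because the defining relation can be evaluated at
  \<open>v0\<close>.\<close>

definition res :: "(('n, 'k) mpoly \<times> ('n, 'k) mpoly) set \<Rightarrow> 'k" where
  "res r = (THE c. \<exists>(f, g)\<in>r. c = ev f v0 / ev g v0)"

lemma res_cls:
  assumes F: "(f, g) \<in> Fr"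
  shows "res (cls f g) = ev f v0 / ev g v0"
  unfolding res_def
proof (rule the_equality)
  show "\<exists>(f', g')\<in>cls f g. ev f v0 / ev g v0 = ev f' v0 / ev g' v0"
    using F by (intro bexI[of _ "(f, g)"]) (auto simp: rel_iff)
  fix c assume "\<exists>(f', g')\<in>cls f g. c = ev f' v0 / ev g' v0"
  then obtain f' g' where f': "((f, g), (f', g')) \<in> local_rel C x" "c = ev f' v0 / ev g' v0" by auto
  then have "ev f v0 * ev g' v0 = ev f' v0 * ev g v0" "ev g v0 \<noteq> 0" "ev g' v0 \<noteq> 0" using v0_V by (auto simp: rel_iff Fr_iff)
  then show "c = ev f v0 / ev g v0" unfolding f'(2) by (simp add: frac_eq_eq)
qed

lemma Fr_nz: "(f, g) \<in> Fr \<Longrightarrow> ev g v0 \<noteq> 0" by (simp add: Fr_iff)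

lemma res_mult: "a \<in> carrier R \<Longrightarrow> b \<in> carrier R \<Longrightarrow> res (a \<otimes>\<^bsub>R\<^esub> b) = res a * res b"
  by (elim R_cases) (simp add: R_mult res_cls Fr_mult mpoly_eval_mult)

lemma res_add: "a \<in> carrier R \<Longrightarrow> b \<in> carrier R \<Longrightarrow> res (a \<oplus>\<^bsub>R\<^esub> b) = res a + res b"
  by (elim R_cases) (simp add: R_add res_cls Fr_add mpoly_eval_simps Fr_nz add_frac_eq)

lemma res_one [simp]: "res \<one>\<^bsub>R\<^esub> = 1" and res_zero [simp]: "res \<zero>\<^bsub>R\<^esub> = 0"
  by (simp_all add: R_one R_zero res_cls Fr_one Fr_zero)

lemma res_neg: "a \<in> carrier R \<Longrightarrow> res (\<ominus>\<^bsub>R\<^esub> a) = - res a"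
  using res_add[of "\<ominus>\<^bsub>R\<^esub> a" a] by (simp add: R.l_neg eq_neg_iff_add_eq_0)

lemma res_diff: "a \<in> carrier R \<Longrightarrow> b \<in> carrier R \<Longrightarrow> res (a \<ominus>\<^bsub>R\<^esub> b) = res a - res b"
  unfolding a_minus_def by (simp add: res_add res_neg)

text \<open>If the value is nonzero, numerator and denominator may be exchanged. Hence the nonunits
  form the kernel of \<open>res\<close>.\<close>

lemma unit_iff: "a \<in> carrier R \<Longrightarrow> a \<in> Units R \<longleftrightarrow> res a \<noteq> 0"
proof
  assume a: "a \<in> carrier R" "a \<in> Units R"
  then obtain b where "b \<in> carrier R" "a \<otimes>\<^bsub>R\<^esub> b = \<one>\<^bsub>R\<^esub>" unfolding Units_def by auto
  then have "res a * res b = 1" using res_mult[OF a(1)] by (metis res_one)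
  then show "res a \<noteq> 0" by auto
next
  assume a: "a \<in> carrier R" "res a \<noteq> 0"
  obtain f g where fg: "(f, g) \<in> Fr" "a = cls f g" using a(1) by (rule R_cases)
  have "ev f v0 \<noteq> 0" using a(2) fg by (simp add: res_cls)
  then have gf: "(g, f) \<in> Fr" using fg(1) unfolding Fr_iff by blast
  have "a \<otimes>\<^bsub>R\<^esub> cls g f = \<one>\<^bsub>R\<^esub>" unfolding fg(2) R_mult[OF fg(1) gf] R_one
    using cls_eq_iff[OF Fr_mult[OF fg(1) gf] Fr_one] by (simp add: mpoly_eval_mult)
  then show "a \<in> Units R" using a(1) R_closed[OF gf] R.m_comm unfolding Units_def by fastforce
qed

lemma nonunits_eq: "nonunits R = {a \<in> carrier R. res a = 0}"
  unfolding nonunits_def using unit_iff R.Units_closed by auto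

lemma R_domain: "domain R"
proof (rule domain.intro[OF R_cring], rule domain_axioms.intro)
  show "\<one>\<^bsub>R\<^esub> \<noteq> \<zero>\<^bsub>R\<^esub>" using res_one res_zero by (metis one_neq_zero)
  fix a b assume ab: "a \<otimes>\<^bsub>R\<^esub> b = \<zero>\<^bsub>R\<^esub>" "a \<in> carrier R" "b \<in> carrier R"
  obtain f g where a: "(f, g) \<in> Fr" "a = cls f g" using ab(2) by (rule R_cases)
  obtain f' g' where b: "(f', g') \<in> Fr" "b = cls f' g'" using ab(3) by (rule R_cases)
  have z: "c = \<zero>\<^bsub>R\<^esub> \<longleftrightarrow> vanishes_on C f" if "(f, g) \<in> Fr" "c = cls f g" for f g c
    unfolding that(2) R_zero cls_eq_iff[OF that(1) Fr_zero] by (simp add: vanishes_on_def)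
  have "vanishes_on C (f * f')" using z[OF Fr_mult[OF a(1) b(1)] refl] ab(1) unfolding a(2) b(2) R_mult[OF a(1) b(1)] by blast
  moreover obtain d d' where "homogeneous d f" "homogeneous d' f'" using a(1) b(1) unfolding Fr_iff by blast
  ultimately have "vanishes_on C f \<or> vanishes_on C f'" using irreducible_closed_prime[OF C] by blast
  then show "a = \<zero>\<^bsub>R\<^esub> \<or> b = \<zero>\<^bsub>R\<^esub>" using z[OF a] z[OF b] by blast
qed

definition cst :: "'k \<Rightarrow> (('n, 'k) mpoly \<times> ('n, 'k) mpoly) set" where
  "cst c = cls (Poly_Mapping.single 0 c) 1"

lemma cst_closed [simp]: "cst c \<in> carrier R" unfolding cst_def by (rule R_closed[OF Fr_const])

lemma res_cst [simp]: "res (cst c) = c"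
  unfolding cst_def res_cls[OF Fr_const] by (simp add: mpoly_eval_single)

lemma cst_mult: "cst a \<otimes>\<^bsub>R\<^esub> cst b = cst (a * b)"
  unfolding cst_def R_mult[OF Fr_const Fr_const] by (simp add: mult_single)

lemma cst_add: "cst a \<oplus>\<^bsub>R\<^esub> cst b = cst (a + b)"
  unfolding cst_def R_add[OF Fr_const Fr_const] by (simp add: single_add)

lemma cst_one: "cst 1 = \<one>\<^bsub>R\<^esub>" and cst_zero: "cst 0 = \<zero>\<^bsub>R\<^esub>"
  by (simp_all add: cst_def R_one R_zero)

lemma cst_pow: "cst a [^]\<^bsub>R\<^esub> (n::nat) = cst (a ^ n)"
  by (induction n) (simp_all add: cst_one cst_mult mult.commute)

lemma local_constants_eq: "local_constants C x = range cst"
  by (auto simp: local_constants_def cst_def)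

end

section \<open>Nakayama's lemma for finitely generated ideals\<close>

context cring
begin

text \<open>Every element of \<open>M M\<close> has the form \<open>j + m a\<close> with
  \<open>j\<close> in \<open>J\<close> and \<open>m\<close> in \<open>M\<close>. Applied to
  \<open>a\<close> modulo \<open>J\<close>, this puts \<open>(1 - m) a\<close> into
  \<open>J\<close>, and \<open>1 - m\<close> is a unit.\<close>

lemma nakayama_step:
  assumes M: "ideal M R" and J: "ideal J R" "J \<subseteq> M" and a: "a \<in> M"
    and u: "\<And>m. m \<in> M \<Longrightarrow> \<one> \<ominus> m \<in> Units R"
    and gen: "M \<subseteq> J <+>\<^bsub>R\<^esub> PIdl a" and mod: "\<And>y. y \<in> M \<Longrightarrow> \<exists>j\<in>J. y \<ominus> j \<in> ideal_prod R M M"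
  shows "M \<subseteq> J"
proof -
  interpret M: ideal M R by fact
  interpret J: ideal J R by fact
  have ac: "a \<in> carrier R" using a by (rule M.Icarr)
  have split: "\<exists>j\<in>J. \<exists>r\<in>carrier R. y = j \<oplus> r \<otimes> a" if "y \<in> M" for y
    using subsetD[OF gen that] unfolding set_add_def' cgenideal_def by blast
  have prod: "\<exists>j\<in>J. \<exists>m\<in>M. s = j \<oplus> m \<otimes> a" if "s \<in> ideal_prod R M M" for s
    using that
  proof (induction rule: ideal_prod.induct)
    case (prod i k)
    obtain j r where jr: "j \<in> J" "r \<in> carrier R" "k = j \<oplus> r \<otimes> a" using split[OF prod(2)] by blast
    have ic: "i \<in> carrier R" "j \<in> carrier R" using prod(1) jr(1) M.Icarr J.Icarr by auto
    have "i \<otimes> k = i \<otimes> j \<oplus> (i \<otimes> r) \<otimes> a" unfolding jr(3) using ic jr(2) ac by algebra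
    moreover have "i \<otimes> j \<in> J" "i \<otimes> r \<in> M" using J.I_l_closed[OF jr(1) ic(1)] M.I_r_closed[OF prod(1) jr(2)] by auto
    ultimately show ?case by blast
  next
    case (sum s1 s2)
    then obtain j1 m1 j2 m2 where h: "j1 \<in> J" "m1 \<in> M" "s1 = j1 \<oplus> m1 \<otimes> a" "j2 \<in> J" "m2 \<in> M" "s2 = j2 \<oplus> m2 \<otimes> a" by blast
    have c: "j1 \<in> carrier R" "m1 \<in> carrier R" "j2 \<in> carrier R" "m2 \<in> carrier R" using h M.Icarr J.Icarr by auto
    have "s1 \<oplus> s2 = (j1 \<oplus> j2) \<oplus> (m1 \<oplus> m2) \<otimes> a" unfolding h(3,6) using c ac by algebra
    moreover have "j1 \<oplus> j2 \<in> J" "m1 \<oplus> m2 \<in> M" using J.a_closed[OF h(1,4)] M.a_closed[OF h(2,5)] by auto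
    ultimately show ?case by blast
  qed
  obtain j0 where j0: "j0 \<in> J" "a \<ominus> j0 \<in> ideal_prod R M M" using mod[OF a] by blast
  obtain j m where jm: "j \<in> J" "m \<in> M" "a \<ominus> j0 = j \<oplus> m \<otimes> a" using prod[OF j0(2)] by blast
  have c: "j0 \<in> carrier R" "j \<in> carrier R" "m \<in> carrier R" using j0 jm M.Icarr J.Icarr by auto
  have "a = (a \<ominus> j0) \<oplus> j0" using ac c(1) by algebra
  also have "\<dots> = j \<oplus> m \<otimes> a \<oplus> j0" unfolding jm(3) ..
  finally have "(\<one> \<ominus> m) \<otimes> a = (j \<oplus> m \<otimes> a \<oplus> j0) \<ominus> m \<otimes> a" using ac c(3) by (simp add: l_distr l_minus a_minus_def)
  also have "\<dots> = j \<oplus> j0" using c ac by algebra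
  finally have e: "(\<one> \<ominus> m) \<otimes> a = j \<oplus> j0" .
  have um: "\<one> \<ominus> m \<in> Units R" by (rule u[OF jm(2)])
  have "inv (\<one> \<ominus> m) \<otimes> ((\<one> \<ominus> m) \<otimes> a) = (inv (\<one> \<ominus> m) \<otimes> (\<one> \<ominus> m)) \<otimes> a"
    by (rule m_assoc[symmetric, OF Units_inv_closed[OF um] Units_closed[OF um] ac])
  then have "a = inv (\<one> \<ominus> m) \<otimes> ((\<one> \<ominus> m) \<otimes> a)" unfolding Units_l_inv[OF um] using ac by simp
  also have "\<dots> \<in> J" unfolding e using um J.a_closed[OF jm(1) j0(1)] by (intro J.I_l_closed) auto
  finally have aJ: "a \<in> J" .
  show "M \<subseteq> J"
  proof
    fix y assume "y \<in> M"
    then obtain j r where "j \<in> J" "r \<in> carrier R" "y = j \<oplus> r \<otimes> a" using split by blast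
    then show "y \<in> J" using J.a_closed J.I_l_closed[OF aJ] by simp
  qed
qed

text \<open>Generation of \<open>M\<close> by \<open>J\<close> and \<open>S\<close> is expressed
  through the ideals containing both. One element of \<open>S\<close> at a time is moved into
  \<open>J\<close> and then removed by \<open>nakayama_step\<close>.\<close>

lemma nakayama:
  assumes "finite S" "ideal M R" and u: "\<And>m. m \<in> M \<Longrightarrow> \<one> \<ominus> m \<in> Units R"
    and "ideal J R" "J \<subseteq> M" "S \<subseteq> M"
    and "\<And>N. ideal N R \<Longrightarrow> J \<subseteq> N \<Longrightarrow> S \<subseteq> N \<Longrightarrow> M \<subseteq> N"
    and "\<And>y. y \<in> M \<Longrightarrow> \<exists>j\<in>J. y \<ominus> j \<in> ideal_prod R M M"
  shows "M \<subseteq> J"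
  using assms(1,4-8)
proof (induction S arbitrary: J)
  case empty
  then show ?case by blast
next
  case (insert a S)
  interpret M: ideal M R by fact
  interpret J: ideal J R by (rule insert.prems)
  have aM: "a \<in> M" and ac: "a \<in> carrier R" using insert.prems(3) M.Icarr by auto
  let ?J = "J <+>\<^bsub>R\<^esub> PIdl a"
  have I: "ideal (PIdl a) R" by (rule cgenideal_ideal[OF ac])
  interpret I: ideal "PIdl a" R by (rule I)
  have J': "ideal ?J R" by (rule add_ideals[OF insert.prems(1) I])
  have JJ: "J \<subseteq> ?J"
  proof
    fix j assume j: "j \<in> J"
    then have "j = j \<oplus> \<zero>" using J.Icarr by simp
    then show "j \<in> ?J" unfolding set_add_def' using j I.zero_closed by blast
  qed
  have aJ: "a \<in> ?J"
  proof -
    have "a = \<zero> \<oplus> a" using ac by simp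
    then show ?thesis unfolding set_add_def' using J.zero_closed cgenideal_self[OF ac] by blast
  qed
  have "PIdl a \<subseteq> M" by (rule cgenideal_minimal[OF assms(2) aM])
  then have J'M: "?J \<subseteq> M" unfolding set_add_def' using insert.prems(2) M.a_closed by blast
  have g: "M \<subseteq> ?J"
  proof (rule insert.IH[OF J' J'M])
    show "S \<subseteq> M" using insert.prems(3) by simp
    show "M \<subseteq> N" if "ideal N R" "?J \<subseteq> N" "S \<subseteq> N" for N
      using insert.prems(4)[OF that(1)] JJ aJ that(2,3) by blast
    show "\<exists>j\<in>?J. y \<ominus> j \<in> ideal_prod R M M" if "y \<in> M" for y using insert.prems(5)[OF that] JJ by blast
  qed
  show ?case
  proof (rule nakayama_step[OF assms(2) insert.prems(1,2) aM _ g])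
    show "\<one> \<ominus> m \<in> Units R" if "m \<in> M" for m by (rule u[OF that])
    show "\<exists>j\<in>J. y \<ominus> j \<in> ideal_prod R M M" if "y \<in> M" for y by (rule insert.prems(5)[OF that])
  qed
qed

end

text \<open>Chains can be truncated, so two dimensions cannot differ. This identifies the number
  hidden in \<open>nonsingular_at\<close> with 1.\<close>

lemma has_dim_unique:
  assumes "has_dim C 1" "has_dim C d"
  shows "d = 1"
proof -
  have pre: "irreducible_chain C m Z" if "irreducible_chain C n Z" "m \<le> n" for m n Z
    using that unfolding irreducible_chain_def by auto
  obtain Z where "irreducible_chain C 1 Z" using assms(1) unfolding has_dim_def by blast
  then have "\<not> Suc d \<le> 1" using assms(2) pre unfolding has_dim_def by blast
  moreover obtain Z' where "irreducible_chain C d Z'" using assms(2) unfolding has_dim_def by blast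
  then have "\<not> Suc 1 \<le> d" using assms(1) pre unfolding has_dim_def by blast
  ultimately show ?thesis by linarith
qed

section \<open>The maximal ideal and its generator\<close>

context curve_point
begin

abbreviation "M \<equiv> nonunits R"

sublocale R: domain R by (rule R_domain)

lemma M_iff: "a \<in> M \<longleftrightarrow> a \<in> carrier R \<and> res a = 0"
  unfolding nonunits_eq by simp

lemma M_ideal: "ideal M R"
proof (rule idealI)
  show "ring R" by (rule R.ring_axioms)
  show "subgroup M (add_monoid R)"
  proof (rule R.add.subgroupI)
    show "M \<subseteq> carrier R" by (auto simp: nonunits_def)
    show "M \<noteq> {}" using M_iff[of "\<zero>\<^bsub>R\<^esub>"] by auto
    show "\<ominus>\<^bsub>R\<^esub> a \<in> M" if "a \<in> M" for a using that by (simp add: M_iff res_neg)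
    show "a \<oplus>\<^bsub>R\<^esub> b \<in> M" if "a \<in> M" "b \<in> M" for a b using that by (simp add: M_iff res_add)
  qed
  show "r \<otimes>\<^bsub>R\<^esub> a \<in> M" "a \<otimes>\<^bsub>R\<^esub> r \<in> M" if "a \<in> M" "r \<in> carrier R" for a r
    using that by (simp_all add: M_iff res_mult)
qed

lemma one_minus_unit: "m \<in> M \<Longrightarrow> \<one>\<^bsub>R\<^esub> \<ominus>\<^bsub>R\<^esub> m \<in> Units R"
  using unit_iff[of "\<one>\<^bsub>R\<^esub> \<ominus>\<^bsub>R\<^esub> m"] by (simp add: M_iff res_diff)

definition i0 :: 'n where "i0 = (SOME i. v0 i \<noteq> 0)"

lemma i0: "v0 i0 \<noteq> 0"
proof -
  obtain v where v: "v \<in> x" "v \<noteq> (\<lambda>i. 0)" using proj_space_nonempty[OF x_proj] by blast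
  then obtain c where "v = (\<lambda>i. c * v0 i)" using proj_point_eq[OF x_proj v0] by blast
  then have "\<exists>i. v0 i \<noteq> 0" using v(2) by auto
  then show ?thesis unfolding i0_def by (rule someI_ex)
qed

definition coord :: "'n \<Rightarrow> ('n, 'k) mpoly" where
  "coord i = Poly_Mapping.single (Poly_Mapping.single i 1) 1"

lemma coord_homogeneous: "homogeneous 1 (coord i)"
  by (simp add: homogeneous_def coord_def lookup_single when_def sum.delta)

lemma coord_eval: "ev (coord i) v = v i"
proof -
  have "mono_eval (Poly_Mapping.single i 1) v = (\<Prod>j\<in>UNIV. if i = j then v j else 1)"
    unfolding mono_eval_def by (rule prod.cong) (auto simp: lookup_single when_def)
  then show ?thesis by (simp add: coord_def mpoly_eval_single)
qed

text \<open>A denominator of each degree that does not vanish at the point.\<close>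

definition X0 :: "nat \<Rightarrow> ('n, 'k) mpoly" where "X0 d = coord i0 ^ d"

lemma X0: "homogeneous d (X0 d)" "ev (X0 d) v = v i0 ^ d" "X0 d * X0 e = X0 (d + e)"
proof -
  show "homogeneous d (X0 d)" using homogeneous_power[OF coord_homogeneous[of i0], of d] by (simp add: X0_def)
  show "ev (X0 d) v = v i0 ^ d" by (induction d) (auto simp: X0_def mpoly_eval_mult coord_eval)
  show "X0 d * X0 e = X0 (d + e)" by (simp add: X0_def power_add)
qed

lemma Fr_X0: "homogeneous d f \<Longrightarrow> (f, X0 d) \<in> Fr"
  unfolding Fr_iff using X0(1,2) i0 by auto

text \<open>The affine coordinates on the chart where coordinate \<open>i0\<close> is nonzero,
  translated to be zero at the point.\<close>

definition Y :: "'n \<Rightarrow> (('n, 'k) mpoly \<times> ('n, 'k) mpoly) set" where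
  "Y i = cls (coord i) (X0 1) \<ominus>\<^bsub>R\<^esub> cst (v0 i / v0 i0)"

lemma Y_M: "Y i \<in> M"
proof -
  have F: "(coord i, X0 1) \<in> Fr" by (rule Fr_X0[OF coord_homogeneous])
  have "res (cls (coord i) (X0 1)) = v0 i / v0 i0" unfolding res_cls[OF F] by (simp add: coord_eval X0(2))
  then show ?thesis unfolding M_iff Y_def using R_closed[OF F] by (simp add: res_diff)
qed

text \<open>Modulo the centred affine coordinates every function on the chart equals its value at
  the point. The property passes to sums and products, so constants and coordinates suffice.\<close>

lemma dehomogenize:
  assumes N: "ideal N R" and YN: "\<And>i. Y i \<in> N"
  shows "homogeneous d f \<Longrightarrow> cls f (X0 d) \<ominus>\<^bsub>R\<^esub> cst (ev f v0 / v0 i0 ^ d) \<in> N"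
proof -
  interpret N: ideal N R by fact
  let ?P = "\<lambda>d f. cls f (X0 d) \<ominus>\<^bsub>R\<^esub> cst (ev f v0 / v0 i0 ^ d) \<in> N"
  have add: "?P d (f + g)" if h: "homogeneous d f" "homogeneous d g" and P: "?P d f" "?P d g" for d f g
  proof -
    note F = Fr_X0[OF h(1)] Fr_X0[OF h(2)] Fr_X0[OF homogeneous_add[OF h]]
    have e1: "cls (f + g) (X0 d) = cls f (X0 d) \<oplus>\<^bsub>R\<^esub> cls g (X0 d)"
      unfolding R_add[OF F(1,2)] cls_eq_iff[OF F(3) Fr_add[OF F(1,2)]] by (simp add: mpoly_eval_simps algebra_simps)
    have e2: "cst (ev (f + g) v0 / v0 i0 ^ d) = cst (ev f v0 / v0 i0 ^ d) \<oplus>\<^bsub>R\<^esub> cst (ev g v0 / v0 i0 ^ d)"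
      unfolding cst_add by (simp add: mpoly_eval_add add_divide_distrib)
    have "cls (f + g) (X0 d) \<ominus>\<^bsub>R\<^esub> cst (ev (f + g) v0 / v0 i0 ^ d) =
      (cls f (X0 d) \<ominus>\<^bsub>R\<^esub> cst (ev f v0 / v0 i0 ^ d)) \<oplus>\<^bsub>R\<^esub> (cls g (X0 d) \<ominus>\<^bsub>R\<^esub> cst (ev g v0 / v0 i0 ^ d))"
      unfolding e1 e2 using R_closed[OF F(1)] R_closed[OF F(2)] cst_closed[of "ev f v0 / v0 i0 ^ d"] cst_closed[of "ev g v0 / v0 i0 ^ d"] by algebra
    then show ?thesis using N.a_closed[OF P] by simp
  qed
  have mult: "?P (d + e) (f * g)" if h: "homogeneous d f" "homogeneous e g" and P: "?P d f" "?P e g" for d e f g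
  proof -
    note F = Fr_X0[OF h(1)] Fr_X0[OF h(2)] Fr_X0[OF homogeneous_mult[OF h]]
    have e1: "cls (f * g) (X0 (d + e)) = cls f (X0 d) \<otimes>\<^bsub>R\<^esub> cls g (X0 e)"
      unfolding R_mult[OF F(1,2)] X0(3) ..
    have e2: "cst (ev (f * g) v0 / v0 i0 ^ (d + e)) = cst (ev f v0 / v0 i0 ^ d) \<otimes>\<^bsub>R\<^esub> cst (ev g v0 / v0 i0 ^ e)"
      unfolding cst_mult by (simp add: mpoly_eval_mult power_add)
    let ?a = "cls f (X0 d)" and ?b = "cls g (X0 e)" and ?c = "cst (ev f v0 / v0 i0 ^ d)" and ?d = "cst (ev g v0 / v0 i0 ^ e)"
    have c: "?a \<in> carrier R" "?b \<in> carrier R" "?c \<in> carrier R" "?d \<in> carrier R" using R_closed[OF F(1)] R_closed[OF F(2)] by auto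
    have "?a \<otimes>\<^bsub>R\<^esub> ?b \<ominus>\<^bsub>R\<^esub> ?c \<otimes>\<^bsub>R\<^esub> ?d = (?a \<ominus>\<^bsub>R\<^esub> ?c) \<otimes>\<^bsub>R\<^esub> ?b \<oplus>\<^bsub>R\<^esub> ?c \<otimes>\<^bsub>R\<^esub> (?b \<ominus>\<^bsub>R\<^esub> ?d)" using c by algebra
    also have "\<dots> \<in> N" by (rule N.a_closed[OF N.I_r_closed[OF P(1) c(2)] N.I_l_closed[OF P(2) c(3)]])
    finally show ?thesis unfolding e1 e2 .
  qed
  have zero: "?P d 0" for d
  proof -
    have F: "(0, X0 d) \<in> Fr" by (rule Fr_X0) simp
    have "cls 0 (X0 d) = \<zero>\<^bsub>R\<^esub>" unfolding R_zero cls_eq_iff[OF F Fr_zero] by simp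
    then show ?thesis using N.zero_closed by (simp add: cst_zero a_minus_def)
  qed
  have const: "?P 0 (Poly_Mapping.single 0 c)" for c
    using N.zero_closed by (simp add: X0_def cst_def[symmetric] mpoly_eval_single a_minus_def R.r_neg)
  have crd: "?P 1 (coord i)" for i using YN[of i] by (simp add: Y_def coord_eval)
  \<comment> \<open>Induction on the degree: a coordinate occurring in the monomial is split
    off.\<close>
  have mono: "?P d (Poly_Mapping.single m c)" if "(\<Sum>i\<in>UNIV. Poly_Mapping.lookup m i) = d" for m c d
    using that
  proof (induction d arbitrary: m)
    case 0
    then have "m = 0" by (intro poly_mapping_eqI) simp
    then show ?case using const[of c] by simp
  next
    case (Suc d)
    then have "\<exists>i. Poly_Mapping.lookup m i \<noteq> 0" by (metis sum.neutral nat.distinct(1))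
    then obtain i where i: "Poly_Mapping.lookup m i \<noteq> 0" by blast
    define m' where "m' = m - Poly_Mapping.single i 1"
    have mm: "m = m' + Poly_Mapping.single i 1"
      unfolding m'_def using i by (intro poly_mapping_eqI) (auto simp: lookup_add lookup_minus lookup_single when_def)
    have "(\<Sum>j\<in>UNIV. Poly_Mapping.lookup m j) = (\<Sum>j\<in>UNIV. Poly_Mapping.lookup m' j) + 1"
      unfolding mm by (simp add: lookup_add sum.distrib lookup_single when_def)
    then have d': "(\<Sum>j\<in>UNIV. Poly_Mapping.lookup m' j) = d" using Suc.prems by simp
    have "homogeneous d (Poly_Mapping.single m' c)" using d' by (simp add: homogeneous_def)
    from mult[OF this coord_homogeneous Suc.IH[OF d'] crd]
    show ?case unfolding mm coord_def mult_single by simp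
  qed
  assume f: "homogeneous d f"
  have "homogeneous d (\<Sum>m\<in>A. Poly_Mapping.single m (Poly_Mapping.lookup f m)) \<and>
      ?P d (\<Sum>m\<in>A. Poly_Mapping.single m (Poly_Mapping.lookup f m))" if "finite A" "A \<subseteq> Poly_Mapping.keys f" for A
    using that
  proof (induction A)
    case empty
    then show ?case using zero by simp
  next
    case (insert m A)
    have d: "(\<Sum>i\<in>UNIV. Poly_Mapping.lookup m i) = d" using f insert.prems by (auto simp: homogeneous_def)
    have h: "homogeneous d (Poly_Mapping.single m (Poly_Mapping.lookup f m))" using d by (simp add: homogeneous_def)
    show ?case using insert h add[OF h _ mono[OF d]] homogeneous_add[OF h] by simp
  qed
  from this[OF finite_keys subset_refl] show "?P d f" unfolding mpoly_as_sum[of f, symmetric] by blast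
qed

text \<open>Write \<open>f/g\<close> as \<open>f/X0^d\<close> times \<open>X0^d/g\<close>, reading
  \<open>X0\<close> as the chosen coordinate. As \<open>f\<close> vanishes at the point, the first
  factor lies in \<open>N\<close> by \<open>dehomogenize\<close>.\<close>

lemma M_generated:
  assumes N: "ideal N R" and YN: "\<And>i. Y i \<in> N"
  shows "M \<subseteq> N"
proof
  interpret N: ideal N R by fact
  fix a assume a: "a \<in> M"
  then obtain f g where fg: "(f, g) \<in> Fr" "a = cls f g" unfolding M_iff using R_cases by metis
  obtain d where d: "homogeneous d f" "homogeneous d g" "ev g v0 \<noteq> 0" using fg(1) by (rule FrE)
  have f0: "ev f v0 = 0" using a d(3) unfolding M_iff fg(2) res_cls[OF fg(1)] by simp
  have F: "(f, X0 d) \<in> Fr" "(X0 d, g) \<in> Fr" using Fr_X0[OF d(1)] d(2,3) X0(1) unfolding Fr_iff by auto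
  have "cls f (X0 d) \<ominus>\<^bsub>R\<^esub> cst (ev f v0 / v0 i0 ^ d) \<in> N" by (rule dehomogenize[OF N YN d(1)])
  then have "cls f (X0 d) \<in> N" using R_closed[OF F(1)] by (simp add: f0 cst_zero a_minus_def)
  then have "cls f (X0 d) \<otimes>\<^bsub>R\<^esub> cls (X0 d) g \<in> N" using R_closed[OF F(2)] by (rule N.I_r_closed)
  moreover have "cls f (X0 d) \<otimes>\<^bsub>R\<^esub> cls (X0 d) g = a"
    unfolding R_mult[OF F] fg(2) cls_eq_iff[OF Fr_mult[OF F] fg(1)] by (simp add: mpoly_eval_mult)
  ultimately show "a \<in> N" by simp
qed

text \<open>A lift of a basis vector of the cotangent space generates the maximal ideal modulo its
  square, hence by Nakayama the ideal itself.\<close>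

lemma uniformizer:
  assumes dim: "has_dim C 1" and ns: "nonsingular_at C x"
  obtains \<pi> where "\<pi> \<in> carrier R" "\<pi> \<noteq> \<zero>\<^bsub>R\<^esub>" "M = PIdl\<^bsub>R\<^esub> \<pi>"
proof -
  define M2 where "M2 = ideal_pow R M 2"
  obtain d where d: "has_dim C d" "cotangent_dim C x d" using ns unfolding nonsingular_at_def by blast
  have "d = 1" by (rule has_dim_unique[OF dim d(1)])
  then have cd: "ring.dimension (R Quot M2) 1 ((\<lambda>c. M2 +>\<^bsub>R\<^esub> c) ` range cst) ((\<lambda>a. M2 +>\<^bsub>R\<^esub> a) ` M)"
    using d(2) unfolding cotangent_dim_def Let_def M2_def local_constants_eq by simp
  have M2e: "M2 = ideal_prod R (ideal_prod R (carrier R) M) M" unfolding M2_def by (simp add: numeral_2_eq_2)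
  have CM: "ideal (ideal_prod R (carrier R) M) R" by (rule R.ideal_prod_is_ideal[OF R.oneideal M_ideal])
  have M2I: "ideal M2 R" unfolding M2e by (rule R.ideal_prod_is_ideal[OF CM M_ideal])
  interpret M2: ideal M2 R by (rule M2I)
  interpret M: ideal M R by (rule M_ideal)
  \<comment> \<open>\<open>ideal_pow\<close> starts from the whole ring, so the square carries an
    extra factor, which the ideal absorbs.\<close>
  have sub: "M2 \<subseteq> ideal_prod R M M"
  proof
    fix s assume "s \<in> M2"
    then show "s \<in> ideal_prod R M M" unfolding M2e
    proof (induction rule: ideal_prod.induct)
      case (prod i j)
      have "i \<in> M" using prod(1) R.ideal_prod_inter[OF R.oneideal M_ideal] by blast
      then show ?case using prod(2) by (rule ideal_prod.prod)
    next
      case (sum s1 s2)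
      show ?case by (rule ideal_prod.sum[OF sum.IH])
    qed
  qed
  let ?Q = "R Quot M2"
  interpret Q: ring ?Q by (rule M2.quotient_is_ring)
  interpret q: ring_hom_cring R ?Q "(+>\<^bsub>R\<^esub>) M2" by (rule M2.rcos_ring_hom_cring[OF R.is_cring])
  let ?K = "(\<lambda>c. M2 +>\<^bsub>R\<^esub> c) ` range cst"
  have E0: "E = {\<zero>\<^bsub>?Q\<^esub>}" if "Q.dimension 0 K E" for K E
    using that by (cases rule: Q.dimension.cases) simp_all
  \<comment> \<open>Dimension one means a single extension of the zero space by a line, spanned by a
    nonzero vector \<open>v\<close>.\<close>
  obtain v where v: "(\<lambda>a. M2 +>\<^bsub>R\<^esub> a) ` M = Q.line_extension ?K v {\<zero>\<^bsub>?Q\<^esub>}" "v \<in> carrier ?Q" "v \<noteq> \<zero>\<^bsub>?Q\<^esub>"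
    using cd
  proof (cases rule: Q.dimension.cases)
    case (Suc_dim v E n)
    have "n = 0" using Suc_dim(1) by simp
    then have E: "E = {\<zero>\<^bsub>?Q\<^esub>}" using Suc_dim(5) E0 by simp
    show ?thesis using that[OF Suc_dim(2)[unfolded E] Suc_dim(3)] Suc_dim(4) unfolding E by blast
  qed simp
  have one: "M2 +>\<^bsub>R\<^esub> cst 1 = \<one>\<^bsub>?Q\<^esub>" unfolding cst_one by simp
  have "v = \<one>\<^bsub>?Q\<^esub> \<otimes>\<^bsub>?Q\<^esub> v \<oplus>\<^bsub>?Q\<^esub> \<zero>\<^bsub>?Q\<^esub>" using v(2) by simp
  then have "v \<in> (\<lambda>a. M2 +>\<^bsub>R\<^esub> a) ` M" unfolding v(1) Q.line_extension_mem_iff using one by blast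
  then obtain \<pi> where pi: "\<pi> \<in> M" "v = M2 +>\<^bsub>R\<^esub> \<pi>" by blast
  have pc: "\<pi> \<in> carrier R" using pi(1) by (rule M.Icarr)
  have p0: "\<pi> \<noteq> \<zero>\<^bsub>R\<^esub>" using v(3) pi(2) by auto
  have J: "ideal (PIdl\<^bsub>R\<^esub> \<pi>) R" by (rule R.cgenideal_ideal[OF pc])
  have JM: "PIdl\<^bsub>R\<^esub> \<pi> \<subseteq> M" by (rule R.cgenideal_minimal[OF M_ideal pi(1)])
  have mod: "\<exists>j\<in>PIdl\<^bsub>R\<^esub> \<pi>. y \<ominus>\<^bsub>R\<^esub> j \<in> ideal_prod R M M" if y: "y \<in> M" for y
  proof -
    have yc: "y \<in> carrier R" using y by (rule M.Icarr)
    have "M2 +>\<^bsub>R\<^esub> y \<in> Q.line_extension ?K v {\<zero>\<^bsub>?Q\<^esub>}" unfolding v(1)[symmetric] using y by blast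
    then obtain c where c: "M2 +>\<^bsub>R\<^esub> y = (M2 +>\<^bsub>R\<^esub> cst c) \<otimes>\<^bsub>?Q\<^esub> v \<oplus>\<^bsub>?Q\<^esub> \<zero>\<^bsub>?Q\<^esub>" unfolding Q.line_extension_mem_iff by blast
    have "M2 +>\<^bsub>R\<^esub> y = M2 +>\<^bsub>R\<^esub> (cst c \<otimes>\<^bsub>R\<^esub> \<pi>)" unfolding c pi(2) using pc by simp
    then have "y \<ominus>\<^bsub>R\<^esub> cst c \<otimes>\<^bsub>R\<^esub> \<pi> \<in> M2" using R.quotient_eq_iff_same_a_r_cos[OF M2I yc, of "cst c \<otimes>\<^bsub>R\<^esub> \<pi>"] pc by simp
    then have "y \<ominus>\<^bsub>R\<^esub> cst c \<otimes>\<^bsub>R\<^esub> \<pi> \<in> ideal_prod R M M" by (rule subsetD[OF sub])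
    moreover have "cst c \<otimes>\<^bsub>R\<^esub> \<pi> \<in> PIdl\<^bsub>R\<^esub> \<pi>" unfolding R.cgenideal_iff using cst_closed[of c] by (rule bexI[rotated]) (rule refl)
    ultimately show ?thesis by (rule bexI)
  qed
  have "M \<subseteq> PIdl\<^bsub>R\<^esub> \<pi>"
  proof (rule R.nakayama[OF _ M_ideal one_minus_unit J JM, of "range Y"])
    show "finite (range Y)" by simp
    show "range Y \<subseteq> M" using Y_M by blast
    show "M \<subseteq> N" if "ideal N R" "range Y \<subseteq> N" for N by (rule M_generated[OF that(1)]) (use that(2) in blast)
    show "\<exists>j\<in>PIdl\<^bsub>R\<^esub> \<pi>. y \<ominus>\<^bsub>R\<^esub> j \<in> ideal_prod R M M" if "y \<in> M" for y by (rule mod[OF that])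
  qed
  then have "M = PIdl\<^bsub>R\<^esub> \<pi>" using JM by (rule equalityI)
  then show ?thesis by (rule that[OF pc p0])
qed

end

section \<open>Application to the curve\<close>

lemma primitive_root_exists:
  assumes p: "Factorial_Ring.prime p" and ch: "p \<noteq> CHAR('k::alg_closed_field)"
  shows "of_nat p \<noteq> (0::'k)" "\<exists>z::'k. z ^ p = 1 \<and> z \<noteq> 1"
proof -
  show np: "of_nat p \<noteq> (0::'k)"
  proof
    assume "of_nat p = (0::'k)"
    then have "CHAR('k) dvd p" by (simp add: of_nat_eq_0_iff_char_dvd)
    then have "CHAR('k) = 1 \<or> CHAR('k) = p" using p unfolding prime_nat_iff by blast
    moreover have "CHAR('k) \<noteq> 1"
    proof
      assume "CHAR('k) = 1"
      then have "of_nat 1 = (0::'k)" using of_nat_CHAR by metis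
      then show False by simp
    qed
    ultimately show False using ch by auto
  qed
  have p1: "1 < p" by (rule prime_gt_1_nat[OF p])
  \<comment> \<open>A root of \<open>1 + z + ... + z^(p-1)\<close> has \<open>z^p = 1\<close>; it is
    not 1, where the sum would be \<open>p\<close>, nonzero in the field.\<close>
  obtain z :: 'k where z: "(\<Sum>k\<le>p - 1. 1 * z ^ k) = 0" using alg_closed[of "p - 1" "\<lambda>_. 1"] p1 by auto
  then have s: "(\<Sum>k<p. z ^ k) = 0" using p1 by (simp add: lessThan_Suc_atMost[symmetric])
  have "z ^ p - 1 = (z - 1) * (\<Sum>k<p. z ^ k)" by (rule power_diff_1_eq)
  then have "z ^ p = 1" using s by simp
  moreover have "z \<noteq> 1" using s np by auto
  ultimately show "\<exists>z::'k. z ^ p = 1 \<and> z \<noteq> 1" by blast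
qed

theorem curve_local_ring:
  fixes C :: "('n::finite, 'k::alg_closed_field) point set"
  assumes C: "nonsingular_projective_curve C" and x: "x \<in> C"
    and p: "Factorial_Ring.prime p" "p \<noteq> CHAR('k)"
  shows "\<exists>\<pi> \<zeta>. pth_root_local (local_ring C x) \<pi> p \<zeta>"
proof -
  have ic: "irreducible_closed C" and dim: "has_dim C 1" and ns: "nonsingular_at C x"
    using C x unfolding nonsingular_projective_curve_def by auto
  have "x \<in> proj_space" using ic x unfolding irreducible_closed_def zariski_closed_def by blast
  then obtain v0 where v0: "v0 \<in> x" using proj_space_nonempty by blast
  interpret c: curve_point C x v0 by unfold_locales (rule ic x v0)+
  obtain \<pi> where pi: "\<pi> \<in> carrier c.R" "\<pi> \<noteq> \<zero>\<^bsub>c.R\<^esub>" "c.M = PIdl\<^bsub>c.R\<^esub> \<pi>" using c.uniformizer[OF dim ns] .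
  obtain z :: 'k where z: "z ^ p = 1" "z \<noteq> 1" using primitive_root_exists(2)[OF p] by blast
  have "pth_root_local c.R \<pi> p (c.cst z)"
  proof (rule pth_root_local.intro[OF c.R_domain], unfold_locales)
    show "\<pi> \<in> carrier c.R" "\<pi> \<noteq> \<zero>\<^bsub>c.R\<^esub>" "c.M = PIdl\<^bsub>c.R\<^esub> \<pi>" by (rule pi)+
    show "Factorial_Ring.prime p" by (rule p)
    have np: "add_pow c.R n \<one>\<^bsub>c.R\<^esub> = c.cst (of_nat n)" for n :: nat
    proof (induction n)
      case 0
      then show ?case by (simp add: c.cst_zero)
    next
      case (Suc n)
      then show ?case by (simp add: c.R.add.nat_pow_Suc c.cst_one[symmetric] c.cst_add add.commute)
    qed
    show "add_pow c.R p \<one>\<^bsub>c.R\<^esub> \<in> Units c.R" unfolding np using primitive_root_exists(1)[OF p] by (simp add: c.unit_iff)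
    show "c.cst z \<in> carrier c.R" by simp
    show "c.cst z [^]\<^bsub>c.R\<^esub> p = \<one>\<^bsub>c.R\<^esub>" unfolding c.cst_pow z(1) c.cst_one ..
    show "c.cst z \<ominus>\<^bsub>c.R\<^esub> \<one>\<^bsub>c.R\<^esub> \<in> Units c.R" using z(2) by (simp add: c.unit_iff c.res_diff)
    fix u assume u: "u \<in> Units c.R"
    then have uc: "u \<in> carrier c.R" by auto
    \<comment> \<open>The residue field is the ground field, so an approximate \<open>p\<close>-th
      root is a constant supplied by algebraic closedness.\<close>
    obtain y where y: "y ^ p = c.res u" using nth_root_exists[of p] prime_gt_0_nat[OF p(1)] by blast
    have "c.cst y [^]\<^bsub>c.R\<^esub> p \<ominus>\<^bsub>c.R\<^esub> u \<in> c.M" unfolding c.M_iff using uc y by (simp add: c.cst_pow c.res_diff)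
    then show "\<exists>v\<in>carrier c.R. v [^]\<^bsub>c.R\<^esub> p \<ominus>\<^bsub>c.R\<^esub> u \<in> PIdl\<^bsub>c.R\<^esub> \<pi>" unfolding pi(3) by (intro bexI[of _ "c.cst y"]) auto
  qed
  then show ?thesis by blast
qed

lemma adele_ring_eq: "adele_ring C = restricted_product C (local_field C) (local_integers C)"
  by (simp add: adele_ring_def restricted_product_def)

lemma complete_local_ring_dvr:
  fixes C :: "('n::finite, 'k::alg_closed_field) point set"
  assumes "nonsingular_projective_curve C" "x \<in> C" "Factorial_Ring.prime p" "p \<noteq> CHAR('k)"
  obtains \<pi> \<zeta> where "pth_root_dvr (complete_local_ring C x) \<pi> p \<zeta>"
proof -
  obtain \<pi> \<zeta> where "pth_root_local (local_ring C x) \<pi> p \<zeta>" using curve_local_ring[OF assms] by blast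
  from pth_root_local.completion_dvr[OF this] show ?thesis
    using that unfolding complete_local_ring_def by blast
qed

text \<open>Each local condition is read off from the completed local ring; the divisibility of the
  valuation by \<open>p\<close>, which defines \<open>Ram\<close>, decides between
  \<open>kummer_domain\<close> and \<open>unramified_roots_card\<close>.\<close>

lemma adelic_kummer_curve:
  fixes C :: "('n::finite, 'k::alg_closed_field) point set"
  assumes C: "nonsingular_projective_curve C" and p: "Factorial_Ring.prime p" "p \<noteq> CHAR('k)"
    and t: "t \<in> ideles C"
  shows "adelic_kummer C (local_field C) (local_integers C) p t (Ram C p t)"
proof -
  have dvr: "\<exists>\<pi> \<zeta>. pth_root_dvr (complete_local_ring C x) \<pi> p \<zeta>" if "x \<in> C" for x
    using complete_local_ring_dvr[OF C that p] by blast
  have K: "field (local_field C x)" if x: "x \<in> C" for x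
  proof -
    obtain \<pi> \<zeta> where "pth_root_dvr (complete_local_ring C x) \<pi> p \<zeta>" using dvr[OF x] by blast
    from pth_root_dvr.K_field[OF this] show ?thesis unfolding local_field_def .
  qed
  have tU: "t \<in> Units (restricted_product C (local_field C) (local_integers C))"
    using t unfolding ideles_def adele_ring_eq .
  \<comment> \<open>An idele has an adelic inverse, so all its components are nonzero and have a
    meaningful valuation.\<close>
  have t0: "t x \<in> carrier (local_field C x) - {\<zero>\<^bsub>local_field C x\<^esub>}" if x: "x \<in> C" for x
  proof -
    interpret K: field "local_field C x" by (rule K[OF x])
    obtain s where s: "s x \<in> carrier (local_field C x)" "t x \<in> carrier (local_field C x)"
      "(\<lambda>x\<in>C. t x \<otimes>\<^bsub>local_field C x\<^esub> s x) = (\<lambda>x\<in>C. \<one>\<^bsub>local_field C x\<^esub>)"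
      using tU x unfolding Units_def restricted_product_def by auto
    have "t x \<otimes>\<^bsub>local_field C x\<^esub> s x = \<one>\<^bsub>local_field C x\<^esub>" using fun_cong[OF s(3), of x] x by simp
    then show ?thesis using s by auto
  qed
  show ?thesis
  proof (rule adelic_kummer.intro)
    show "Factorial_Ring.prime p" by (rule p)
    show "t \<in> Units (restricted_product C (local_field C) (local_integers C))" by (rule tU)
    show "Ram C p t \<subseteq> C" unfolding Ram_def by blast
  next
    fix x assume x: "x \<in> C"
    obtain \<pi> \<zeta> where "pth_root_dvr (complete_local_ring C x) \<pi> p \<zeta>" using dvr[OF x] by blast
    then interpret d: pth_root_dvr "complete_local_ring C x" \<pi> p \<zeta> .
    show "field (local_field C x)" by (rule K[OF x])
    show "subring (local_integers C x) (local_field C x)"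
      using d.OK_subring unfolding local_integers_def local_field_def .
    show "\<exists>q\<in>local_integers C x. add_pow (local_field C x) p \<one>\<^bsub>local_field C x\<^esub> \<otimes>\<^bsub>local_field C x\<^esub> q = \<one>\<^bsub>local_field C x\<^esub>"
      using d.OK_p_inverse unfolding local_integers_def local_field_def .
    show "z \<in> local_integers C x" if "z \<in> carrier (local_field C x)" "z [^]\<^bsub>local_field C x\<^esub> p \<in> local_integers C x" for z
      using d.OK_root_closed that unfolding local_integers_def local_field_def .
  next
    fix x assume x: "x \<in> Ram C p t"
    then have xC: "x \<in> C" and nd: "\<not> int p dvd frac_val (complete_local_ring C x) (t x)" unfolding Ram_def by auto
    obtain \<pi> \<zeta> where "pth_root_dvr (complete_local_ring C x) \<pi> p \<zeta>" using dvr[OF xC] by blast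
    then interpret d: pth_root_dvr "complete_local_ring C x" \<pi> p \<zeta> .
    have "valued_kummer d.K (frac_val (complete_local_ring C x)) p (t x)"
      using t0[OF xC] p(1) nd unfolding local_field_def
      by (intro valued_kummer.intro[OF d.K_field] valued_kummer_axioms.intro d.frac_val_mult d.frac_val_add)
    from valued_kummer.kummer_domain[OF this]
    show "domain (kummer_algebra (local_field C x) p (t x))" unfolding local_field_def .
    show "card {w \<in> carrier (local_field C x). w [^]\<^bsub>local_field C x\<^esub> p = \<one>\<^bsub>local_field C x\<^esub>} = p"
      using d.roots_of_unity_card unfolding local_field_def .
  next
    fix x assume x: "x \<in> C - Ram C p t"
    then have xC: "x \<in> C" and dv: "int p dvd frac_val (complete_local_ring C x) (t x)" unfolding Ram_def by auto
    obtain \<pi> \<zeta> where "pth_root_dvr (complete_local_ring C x) \<pi> p \<zeta>" using dvr[OF xC] by blast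
    then interpret d: pth_root_dvr "complete_local_ring C x" \<pi> p \<zeta> .
    show "card {z \<in> carrier (local_field C x). z [^]\<^bsub>local_field C x\<^esub> p = t x} = p"
      using d.unramified_roots_card[OF _ dv] t0[OF xC] unfolding local_field_def .
  qed
qed

theorem theorem3p64:
  fixes C :: "('n::finite, 'k::alg_closed_field) point set"
    and p :: nat
    and t :: "('n, 'k) adele"
    and G1 G2 :: "(('n, 'k) adele_kummer_elem \<Rightarrow> ('n, 'k) adele_kummer_elem) set"
  assumes "nonsingular_projective_curve C"
    and "Factorial_Ring.prime p" and "p \<noteq> CHAR('k)"
    and "t \<in> ideles C"
    and "pointwise_transitive C p t G1"
    and "pointwise_transitive C p t G2"
  shows "galois_equivalent C p t G1 G2 \<longleftrightarrow> proj_Ram C p t ` G1 = proj_Ram C p t ` G2"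
proof -
  interpret a: adelic_kummer C "local_field C" "local_integers C" p t "Ram C p t"
    by (rule adelic_kummer_curve[OF assms(1-4)])
  have L: "local_proj C p t y = a.L y" for y
    by (rule ext) (simp add: local_proj_def coeff_proj_def)
  \<comment> \<open>Both sides are the same description by \<open>THE\<close> once the adele ring is
    read as a restricted product.\<close>
  have "aut_component C p t y g = a.component y g" for y g
    unfolding aut_component_def a.component_def local_aut_group_def adele_ring_eq L ..
  then have pr: "proj_Ram C p t = (\<lambda>g. \<lambda>y\<in>Ram C p t. a.component y g)"
    by (simp add: proj_Ram_def fun_eq_iff)
  \<comment> \<open>The Galois property is used in the form of its fixed ring condition, which makes
    a generator act nontrivially at every point.\<close>
  have G: "subgroup G a.A \<and> card G = p \<and> {s \<in> carrier a.kum.S. \<forall>f\<in>G. f s = s} = a.kum.emb ` carrier a.R"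
    if "pointwise_transitive C p t G" for G
    using that unfolding pointwise_transitive_def galois_extension_def adele_ring_eq
    by (elim conjE) (intro conjI; assumption)
  note G1 = G[OF assms(5), THEN conjunct1] G[OF assms(5), THEN conjunct2, THEN conjunct1]
    G[OF assms(5), THEN conjunct2, THEN conjunct2]
  note G2 = G[OF assms(6), THEN conjunct1] G[OF assms(6), THEN conjunct2, THEN conjunct1]
    G[OF assms(6), THEN conjunct2, THEN conjunct2]
  show ?thesis
    unfolding galois_equivalent_def adele_ring_eq pr by (rule a.conjugate_iff[OF G1 G2])
qed

end
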